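(* Let $d$ be a positive integer. Let $\mathcal{T}(S_d)$, $\mathcal{T}(S'_d)$ and $\mathcal{T}(S''_d)$ be the families of trees of diameter $d$ generated (by diameter-preserving unfoldings) from the seeds $S_d$, $S'_d$ and $S''_d$, respectively, where $S'_d$ is defined for $d\geq 4$ and $S''_d$ for odd $d\geq 5$. Then for every $T\in \mathcal{T}(S_d)\cup\mathcal{T}(S'_d)\cup\mathcal{T}(S''_d)$ we have $q(T)=d+1$.
   Context: For a real symmetric $n\times n$ matrix $M=(m_{ij})$, its underlying graph has vertex set $\{1,\dots,n\}$ with distinct $i,j$ adjacent iff $m_{ij}\neq 0$ (diagonal entries are unrestricted). For a tree $T$, $\mathcal{S}(T)$ is the set of real symmetric matrices with underlying graph $T$, and $q(T)=\min\{|\mathrm{DSpec}(A)| : A\in\mathcal{S}(T)\}$, where $\mathrm{DSpec}(A)$ is the set of distinct eigenvalues of $A$. The diameter of a tree is the maximum number of edges of a path in it. Main root: if $T$ has diameter $2k$, its main root is the central vertex of a longest path; if $T$ has diameter $2k+1$, the central edge of a longest path is the main edge and both its endpoints are main roots (these are well defined). Operation $\odot$: for disjoint rooted trees $T_0,T_1,\dots,T_p$ ($p\ge1$) with roots $v_0,\dots,v_p$, $T_0\odot(T_1,\dots,T_p)$ is the tree obtained from their disjoint union by adding the edges $v_0v_i$, $1\le i\le p$, rooted at $v_0$; write $T_0\odot T_1$ when $p=1$. Seeds (as rooted trees): $S_0=K_1$, $S_1=P_2$ (two vertices), $S_2=P_3$ rooted at its central vertex; $S'_4=S_0\odot(S_1,S_1)$,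 $S'_5=(S_0\odot S_1)\odot(S_0\odot S_1)$, $S''_5=(S_0\odot S_1)\odot(S_1\odot S_1)$; and for $k\ge2$: $S_{2k-1}=S_{2k-3}\odot S_{2k-3}$, $S_{2k}=S_{2k-3}\odot(S_{2k-3},S_{2k-3})$, $S'_{2k+2}=S_{2k-3}\odot(S_{2k-1},S_{2k-1})$, $S'_{2k+3}=(S_{2k-3}\odot S_{2k-1})\odot(S_{2k-3}\odot S_{2k-1})$, $S''_{2k+3}=(S_{2k-3}\odot S_{2k-1})\odot(S_{2k-1}\odot S_{2k-1})$. Each $S_d,S'_d,S''_d$ has diameter $d$. Unfoldings: a branch of a tree $T$ at a vertex $v$ is a component of $T-v$, rooted at the neighbour of $v$. An $s$-combinatorial branch duplication ($s$-CBD) of a branch $B$ at $v$ produces the tree obtained by attaching $s$ disjoint copies of $B$ to $v$ (joining $v$ to the root of each copy). A diameter-preserving CBD is one performed on a branch at $v$ that contains no main root of the current tree. For a seed $S$ of diameter $d$, $\mathcal{T}(S)$ is the set of (unlabelled) trees obtained from $S$ by finite sequences (possibly empty) of diameter-preserving CBDs. *)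

theory Defs
  imports
    "Jordan_Normal_Form.Spectral_Radius"
    "Graph_Theory.Pair_Digraph"
    "Graph_Theory.Vertex_Walk"
    "Graph_Theory.Digraph_Component"
    "Graph_Theory.Digraph_Isomorphism"
begin

text \<open>A simple graph is a \<open>pair_pre_digraph\<close> with an irreflexive symmetric arc relation:
  an edge between \<open>u\<close> and \<open>v\<close> is the pair of arcs \<open>(u, v)\<close>, \<open>(v, u)\<close>.\<close>

section \<open>Matrices described by a graph\<close>

text \<open>Vertices are numbered from 0, following the index convention of matrices.\<close>

definition underlying_graph :: "real mat \<Rightarrow> nat pair_pre_digraph" where
  "underlying_graph M =
    \<lparr> pverts = {0..<dim_row M},
      parcs = {(i, j). i < dim_row M \<and> j < dim_row M \<and> i \<noteq> j \<and> M $$ (i, j) \<noteq> 0} \<rparr>"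

text \<open>Trees are unlabelled, so ``with underlying graph \<open>T\<close>'' is read up to isomorphism.\<close>

definition sym_mats :: "'a pair_pre_digraph \<Rightarrow> real mat set" where
  "sym_mats T =
    {M. square_mat M \<and> transpose_mat M = M \<and>
        digraph_iso (with_proj (underlying_graph M)) (with_proj T)}"

definition q_tree :: "'a pair_pre_digraph \<Rightarrow> nat" where
  "q_tree T = (LEAST m. \<exists>M \<in> sym_mats T. m = card (spectrum M))"

section \<open>Diameter and main roots\<close>

definition diam :: "'a pair_pre_digraph \<Rightarrow> nat" where
  "diam G = Max {vwalk_length p | p. vpath p (with_proj G)}"

text \<open>For diameter \<open>2k\<close> both indices are \<open>k\<close>; for diameter \<open>2k+1\<close> they are \<open>k\<close> and \<open>k+1\<close>.\<close>

definition main_roots :: "'a pair_pre_digraph \<Rightarrow> 'a set" where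
  "main_roots G =
    {p ! i | p i. vpath p (with_proj G) \<and> vwalk_length p = diam G \<and>
                  i \<in> {diam G div 2, (diam G + 1) div 2}}"

section \<open>Rooted trees and seeds\<close>

type_synonym 'a rooted = "'a pair_pre_digraph \<times> 'a"

text \<open>Vertices are lists, so that disjointness of the operands can be enforced by prefixing the
  vertices of the \<open>i\<close>-th operand with \<open>i\<close>, where \<open>T0\<close> is operand 0.\<close>

definition odot :: "nat list rooted \<Rightarrow> nat list rooted list \<Rightarrow> nat list rooted" where
  "odot T0 Ts =
    (let Us = T0 # Ts; r = (\<lambda>i. i # snd (Us ! i)) in
      (\<lparr> pverts = (\<Union>i<length Us. (#) i ` pverts (fst (Us ! i))),
         parcs = (\<Union>i<length Us. map_prod ((#) i) ((#) i) ` parcs (fst (Us ! i)))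
                 \<union> (\<Union>i\<in>{1..length Ts}. {(r 0, r i), (r i, r 0)}) \<rparr>,
       r 0))"

fun seed :: "nat \<Rightarrow> nat list rooted" where
  "seed 0 = (\<lparr> pverts = {[]}, parcs = {} \<rparr>, [])"
| "seed (Suc 0) = (\<lparr> pverts = {[], [0]}, parcs = {([], [0]), ([0], [])} \<rparr>, [])"
| "seed (Suc (Suc 0)) =
    (\<lparr> pverts = {[], [0], [1]},
       parcs = {([], [0]), ([0], []), ([], [1]), ([1], [])} \<rparr>, [])"
| "seed (Suc (Suc (Suc n))) =
    (if even n then odot (seed (Suc n)) [seed (Suc n)] else odot (seed n) [seed n, seed n])"

text \<open>\<open>seed'\<close> is meaningful for \<open>d \<ge> 4\<close> only, and \<open>seed''\<close> for odd \<open>d \<ge> 5\<close> only.\<close>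

definition seed' :: "nat \<Rightarrow> nat list rooted" where
  "seed' d =
    (if d = 4 then odot (seed 0) [seed 1, seed 1]
     else if d = 5 then odot (odot (seed 0) [seed 1]) [odot (seed 0) [seed 1]]
     else if even d then odot (seed (d - 5)) [seed (d - 3), seed (d - 3)]
     else odot (odot (seed (d - 6)) [seed (d - 4)]) [odot (seed (d - 6)) [seed (d - 4)]])"

definition seed'' :: "nat \<Rightarrow> nat list rooted" where
  "seed'' d =
    (if d = 5 then odot (odot (seed 0) [seed 1]) [odot (seed 1) [seed 1]]
     else odot (odot (seed (d - 6)) [seed (d - 4)]) [odot (seed (d - 4)) [seed (d - 4)]])"

lemma seed_recursion:
  assumes "k \<ge> 2"
  shows "seed (2*k - 1) = odot (seed (2*k - 3)) [seed (2*k - 3)]"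
    and "seed (2*k) = odot (seed (2*k - 3)) [seed (2*k - 3), seed (2*k - 3)]"
    and "seed' (2*k + 2) = odot (seed (2*k - 3)) [seed (2*k - 1), seed (2*k - 1)]"
    and "seed' (2*k + 3) =
      odot (odot (seed (2*k - 3)) [seed (2*k - 1)]) [odot (seed (2*k - 3)) [seed (2*k - 1)]]"
    and "seed'' (2*k + 3) =
      odot (odot (seed (2*k - 3)) [seed (2*k - 1)]) [odot (seed (2*k - 1)) [seed (2*k - 1)]]"
proof -
  obtain m where m: "k = Suc (Suc m)"
    using assms by (metis add_2_eq_Suc le_Suc_ex)
  have e: "2*k - 3 = Suc (2*m)" "2*k - 1 = Suc (Suc (Suc (2*m)))"
    "2*k = Suc (Suc (Suc (Suc (2*m))))"
    using m by auto
  show "seed (2*k - 1) = odot (seed (2*k - 3)) [seed (2*k - 3)]"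
    unfolding e by simp
  show "seed (2*k) = odot (seed (2*k - 3)) [seed (2*k - 3), seed (2*k - 3)]"
    unfolding e(1) e(3) by simp
  have o: "2*k + 2 - 5 = 2*k - 3" "2*k + 2 - 3 = 2*k - 1"
    "2*k + 3 - 6 = 2*k - 3" "2*k + 3 - 4 = 2*k - 1"
    using assms by auto
  have n: "2*k + 2 \<noteq> 4" "2*k + 2 \<noteq> 5" "2*k + 3 \<noteq> 4" "2*k + 3 \<noteq> 5"
    "even (2*k + 2)" "odd (2*k + 3)"
    using assms by presburger+
  show "seed' (2*k + 2) = odot (seed (2*k - 3)) [seed (2*k - 1), seed (2*k - 1)]"
    unfolding seed'_def o using n by (simp only: if_False if_True)
  show "seed' (2*k + 3) =
      odot (odot (seed (2*k - 3)) [seed (2*k - 1)]) [odot (seed (2*k - 3)) [seed (2*k - 1)]]"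
    unfolding seed'_def o using n by (simp only: if_False if_True)
  show "seed'' (2*k + 3) =
      odot (odot (seed (2*k - 3)) [seed (2*k - 1)]) [odot (seed (2*k - 1)) [seed (2*k - 1)]]"
    unfolding seed''_def o using n by (simp only: if_False if_True)
qed

section \<open>Unfoldings\<close>

text \<open>A branch is given by its vertex set. In a symmetric digraph the strongly connected
  components are the connected components. The root of a branch of a tree at \<open>v\<close> is its
  only neighbour of \<open>v\<close>.\<close>

definition is_branch :: "'a pair_pre_digraph \<Rightarrow> 'a \<Rightarrow> 'a set \<Rightarrow> bool" where
  "is_branch G v B \<longleftrightarrow>
    v \<in> pverts G \<and> B \<in> pre_digraph.sccs_verts (pre_digraph.del_vert (with_proj G) v)"

text \<open>\<open>H\<close> arises from \<open>G\<close> by attaching to \<open>v\<close>, in addition to the branch \<open>B\<close> itself,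
  \<open>s\<close> further disjoint copies \<open>f i ` B\<close> on fresh vertices.\<close>

definition is_CBD ::
  "nat \<Rightarrow> 'a \<Rightarrow> 'a set \<Rightarrow> 'a pair_pre_digraph \<Rightarrow> 'a pair_pre_digraph \<Rightarrow> bool" where
  "is_CBD s v B G H \<longleftrightarrow>
    is_branch G v B \<and>
    (\<exists>f :: nat \<Rightarrow> 'a \<Rightarrow> 'a.
      inj_on (\<lambda>(i, x). f i x) ({..<s} \<times> B) \<and>
      (\<forall>i<s. f i ` B \<inter> pverts G = {}) \<and>
      pverts H = pverts G \<union> (\<Union>i<s. f i ` B) \<and>
      parcs H = parcs G
        \<union> (\<Union>i<s. map_prod (f i) (f i) ` (parcs G \<inter> B \<times> B))
        \<union> (\<Union>i<s. \<Union>r\<in>{r \<in> B. (v, r) \<in> parcs G}. {(v, f i r), (f i r, v)}))"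

definition dp_CBD :: "'a pair_pre_digraph \<Rightarrow> 'a pair_pre_digraph \<Rightarrow> bool" where
  "dp_CBD G H \<longleftrightarrow> (\<exists>s\<ge>1. \<exists>v B. is_CBD s v B G H \<and> B \<inter> main_roots G = {})"

text \<open>The family consists of unlabelled trees, hence the closure under isomorphism.\<close>

definition unfoldings :: "nat list rooted \<Rightarrow> 'a pair_pre_digraph set" where
  "unfoldings S = {T. \<exists>G. dp_CBD\<^sup>*\<^sup>* (fst S) G \<and> digraph_iso (with_proj G) (with_proj T)}"

end

theory Submission
  imports Defs
begin

text \<open>
  Lower bound: re-root the tree at an end \<open>u\<close> of a longest path. For a matrix \<open>A\<close> of the tree and a
  polynomial \<open>p\<close>, the vector \<open>p(A) e\<^sub>u\<close> reaches exactly down to level \<open>degree p\<close>, so that the minimal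
  polynomial of \<open>e\<^sub>u\<close> has degree greater than \<open>d\<close>; as \<open>A\<close> is symmetric, its roots are simple, real,
  and eigenvalues.

  Upper bound: eliminating the branches below \<open>v\<close> from \<open>x I - A\<close> leaves a rational function
  \<open>F\<^sub>v(x) = x - a\<^sub>v - (\<Sum>c. w\<^sub>c / F\<^sub>c(x))\<close>, the sum being over the children \<open>c\<close> of \<open>v\<close>. A number at which
  no \<open>F\<^sub>v\<close> vanishes (and, for odd \<open>d\<close>, the product of the two functions at the main edge is not the
  squared weight of that edge) is not an eigenvalue. Duplicating a branch while dividing its weight
  evenly among the copies changes no \<open>F\<^sub>v\<close>, so it suffices to weight the seeds such that all
  zeros that matter lie in a set of \<open>d + 1\<close> points. The seed \<open>S\<^bsub>2j-1\<^esub>\<close> is the binomial tree of order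
  \<open>j\<close>; for points \<open>a\<^sub>1 < \<dots> < a\<^bsub>2j+1\<^esub>\<close> with rapidly decreasing gaps it has a weighting whose root
  function is \<open>(x - a\<^sub>1) (x - a\<^sub>3) \<dots> / ((x - a\<^sub>2) (x - a\<^sub>4) \<dots>)\<close> and whose other zeros are
  among \<open>a\<^sub>2, \<dots>, a\<^bsub>2j\<^esub>\<close>. Gluing two trees works because the product of two such functions for
  interlaced points is a quadratic polynomial, and subtracting the weight of the new edge only
  moves its two roots outwards.
\<close>

section \<open>Lower bound by minimal polynomials\<close>

text \<open>The obstacle is the number of points: only \<open>d + 1\<close> are allowed, while a
  seed has exponentially many vertices, each with its own function and zeros. So the pieces that are
  glued must share almost all their zeros. They are arranged to have a common list \<open>L\<close>
  of \<open>d - 1\<close> points, and only the two roots of one quadratic are added. A zero of a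
  root function that is still to be changed by gluing may lie anywhere, which gives the necessary
  freedom. Sharing \<open>L\<close> forces equal pieces onto different lists of points, one of them
  with a shifted end, so the induction must realize a tree on all suitable lists, not on a single
  one.

  Both bounds are carried by one predicate, \<open>realized\<close>: its tree structure yields the
  lower bound and its weights yield the upper bound. It survives isomorphism and duplication with
  the same \<open>\<Lambda>\<close>. Only \<open>card \<Lambda> \<le> d + 1\<close> is ever shown
  for these sets; equality of the number of eigenvalues comes from the lower bound.\<close>

definition mat_op :: "nat \<Rightarrow> (nat \<Rightarrow> nat \<Rightarrow> real) \<Rightarrow> (nat \<Rightarrow> complex) \<Rightarrow> nat \<Rightarrow> complex" where
  "mat_op n A u = (\<lambda>x. if x < n then \<Sum>y<n. of_real (A x y) * u y else 0)"

text \<open>This is \<open>p(A) u\<close> by Horner's scheme. Vectors are functions on all naturals,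
  to be read as supported on \<open>{..<n}\<close>; scalars are complex so that a polynomial has as
  many roots, with multiplicity, as its degree.\<close>

definition poly_op ::
  "nat \<Rightarrow> (nat \<Rightarrow> nat \<Rightarrow> real) \<Rightarrow> complex poly \<Rightarrow> (nat \<Rightarrow> complex) \<Rightarrow> nat \<Rightarrow> complex" where
  "poly_op n A p u = fold_coeffs (\<lambda>a v x. a * u x + mat_op n A v x) p (\<lambda>_. 0)"

lemma mat_op_linear:
  "mat_op n A (\<lambda>x. a * u x + b * v x) = (\<lambda>x. a * mat_op n A u x + b * mat_op n A v x)"
  by (auto simp: mat_op_def fun_eq_iff sum_distrib_left sum.distrib algebra_simps)

lemma mat_op_add: "mat_op n A (\<lambda>x. u x + v x) = (\<lambda>x. mat_op n A u x + mat_op n A v x)"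
  using mat_op_linear[of n A 1 u 1 v] by simp

lemma mat_op_scale: "mat_op n A (\<lambda>x. a * u x) = (\<lambda>x. a * mat_op n A u x)"
  using mat_op_linear[of n A a u 0 u] by simp

lemma mat_op_zero: "mat_op n A (\<lambda>_. 0) = (\<lambda>_. 0)"
  by (auto simp: mat_op_def)

lemma poly_op_0 [simp]: "poly_op n A 0 u = (\<lambda>_. 0)"
  by (simp add: poly_op_def)

lemma poly_op_pCons:
  "poly_op n A (pCons a p) u = (\<lambda>x. a * u x + mat_op n A (poly_op n A p u) x)"
proof (cases "p = 0 \<and> a = 0")
  case True
  then show ?thesis by (simp add: mat_op_zero)
next
  case False
  then show ?thesis
    by (cases "a = 0") (auto simp: poly_op_def fold_coeffs_pCons_coeff_not_0_eq fold_coeffs_pCons_not_0_0_eq)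
qed

lemma poly_op_add: "poly_op n A (p + q) u = (\<lambda>x. poly_op n A p u x + poly_op n A q u x)"
  by (induction p q rule: poly_induct2) (auto simp: poly_op_pCons mat_op_add algebra_simps)

lemma poly_op_smult: "poly_op n A (Polynomial.smult c p) u = (\<lambda>x. c * poly_op n A p u x)"
  by (induction p) (auto simp: poly_op_pCons mat_op_scale algebra_simps)

lemma poly_op_mult: "poly_op n A (p * q) u = poly_op n A p (poly_op n A q u)"
  by (induction p) (auto simp: poly_op_pCons poly_op_add poly_op_smult)

lemma poly_op_sum: "poly_op n A (\<Sum>i\<in>I. p i) u = (\<lambda>x. \<Sum>i\<in>I. poly_op n A (p i) u x)"
  by (induction I rule: infinite_finite_induct) (auto simp: poly_op_add)

lemma poly_op_linear_factor: "poly_op n A [:- \<mu>, 1:] u = (\<lambda>x. mat_op n A u x - \<mu> * u x)"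
  by (simp add: poly_op_pCons mat_op_zero)

lemma poly_op_outside:
  assumes "\<And>x. x \<ge> n \<Longrightarrow> u x = 0" and "x \<ge> n"
  shows "poly_op n A p u x = 0"
  using assms by (cases p) (simp add: poly_op_pCons mat_op_def)

text \<open>The \<open>n + 1\<close> vectors \<open>u, A u, ..., A^n u\<close> live in dimension
  \<open>n\<close>; the coefficients of a linear dependency form \<open>p\<close>.\<close>

lemma annihilating_poly_exists:
  assumes "\<And>x. x \<ge> n \<Longrightarrow> u x = 0"
  shows "\<exists>p. p \<noteq> 0 \<and> poly_op n A p u = (\<lambda>_. 0)"
proof -
  define K where "K = mat (Suc n) (Suc n) (\<lambda>(x, i). poly_op n A (monom 1 i) u x)"
  have K: "K \<in> carrier_mat (Suc n) (Suc n)"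
    by (simp add: K_def)
  \<comment> \<open>Row \<open>n\<close> of \<open>K\<close> lists entries outside the support, so
    it is zero. Padding to a square matrix lets the determinant detect the dependency.\<close>
  have rows: "K = mat\<^sub>r (Suc n) (Suc n) (\<lambda>i. if i = n then 0\<^sub>v (Suc n) else row K i)"
    using poly_op_outside[OF assms] by (intro eq_matI) (auto simp: K_def)
  have "det K = 0"
    by (subst rows, rule det_row_0) (auto simp: K_def)
  then obtain v where v: "v \<in> carrier_vec (Suc n)" "v \<noteq> 0\<^sub>v (Suc n)" "K *\<^sub>v v = 0\<^sub>v (Suc n)"
    using det_0_iff_vec_prod_zero[OF K] by auto
  define p where "p = (\<Sum>i<Suc n. Polynomial.smult (v $ i) (monom 1 i))"
  obtain i where i: "i < Suc n" "v $ i \<noteq> 0"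
    using v(1,2) by (metis carrier_vecD eq_vecI index_zero_vec(1) index_zero_vec(2))
  have "coeff p i = (\<Sum>j<Suc n. if j = i then v $ j else 0)"
    unfolding p_def coeff_sum by (intro sum.cong) (auto simp: coeff_monom)
  also have "\<dots> = v $ i"
    using i by simp
  finally have "coeff p i = v $ i" .
  then have "p \<noteq> 0"
    using i by auto
  moreover have "poly_op n A p u x = 0" for x
  proof (cases "x < n")
    case True
    have "(K *\<^sub>v v) $ x = (\<Sum>i<Suc n. v $ i * poly_op n A (monom 1 i) u x)"
      using True v(1) by (simp add: K_def scalar_prod_def mult.commute lessThan_atLeast0)
    then show ?thesis
      using v(3) True by (simp add: p_def poly_op_sum poly_op_smult poly_op_add)
  next
    case False
    then show ?thesis
      using assms poly_op_outside by auto
  qed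
  ultimately show ?thesis
    by (intro exI[of _ p]) auto
qed

section \<open>Symmetry: the minimal polynomial of a vector has real and simple roots\<close>

locale symmetric_op =
  fixes n :: nat and A :: "nat \<Rightarrow> nat \<Rightarrow> real"
  assumes sym: "\<And>x y. x < n \<Longrightarrow> y < n \<Longrightarrow> A x y = A y x"
begin

definition herm :: "(nat \<Rightarrow> complex) \<Rightarrow> (nat \<Rightarrow> complex) \<Rightarrow> complex" where
  "herm u v = (\<Sum>x<n. cnj (u x) * v x)"

lemma herm_self_adjoint: "herm (mat_op n A u) v = herm u (mat_op n A v)"
proof -
  have "herm (mat_op n A u) v = (\<Sum>x<n. \<Sum>y<n. of_real (A x y) * cnj (u y) * v x)"
    by (simp add: herm_def mat_op_def sum_distrib_right)
  also have "\<dots> = (\<Sum>y<n. \<Sum>x<n. of_real (A x y) * cnj (u y) * v x)"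
    by (rule sum.swap)
  also have "\<dots> = (\<Sum>y<n. \<Sum>x<n. cnj (u y) * (of_real (A y x) * v x))"
    by (intro sum.cong) (auto simp: sym)
  also have "\<dots> = herm u (mat_op n A v)"
    by (simp add: herm_def mat_op_def sum_distrib_left)
  finally show ?thesis .
qed

lemma herm_self_eq_0:
  assumes "herm u u = 0" and "\<And>x. x \<ge> n \<Longrightarrow> u x = 0"
  shows "u = (\<lambda>_. 0)"
proof -
  have "herm u u = of_real (\<Sum>x<n. (cmod (u x))\<^sup>2)"
    unfolding herm_def of_real_sum by (intro sum.cong refl) (simp only: complex_norm_square mult.commute)
  then have "(\<Sum>x<n. (cmod (u x))\<^sup>2) = 0"
    using assms(1) by (metis of_real_eq_0_iff)
  then have "\<And>x. x < n \<Longrightarrow> u x = 0"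
    by (simp add: sum_nonneg_eq_0_iff)
  then show ?thesis
    using assms(2) by (auto simp: fun_eq_iff not_less[symmetric])
qed

lemma eigenvalue_real:
  assumes "mat_op n A v = (\<lambda>x. \<mu> * v x)" "v \<noteq> (\<lambda>_. 0)" "\<And>x. x \<ge> n \<Longrightarrow> v x = 0"
  shows "\<mu> \<in> \<real>"
proof -
  have "cnj \<mu> * herm v v = \<mu> * herm v v"
    using herm_self_adjoint[of v v] unfolding assms(1)
    by (simp add: herm_def sum_distrib_left mult_ac)
  then have "cnj \<mu> = \<mu>"
    using herm_self_eq_0[of v] assms(2,3) by auto
  then show ?thesis
    by (simp add: Reals_cnj_iff)
qed

definition eigs :: "real set" where
  "eigs = {\<mu>. \<exists>v :: nat \<Rightarrow> real. (\<exists>x<n. v x \<noteq> 0) \<and> (\<forall>x<n. (\<Sum>y<n. A x y * v y) = \<mu> * v x)}"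

text \<open>For a real matrix and a real eigenvalue, the real and imaginary parts of a complex
  eigenvector satisfy the same equations, and one of them is nonzero.\<close>

lemma Re_in_eigs:
  assumes v: "mat_op n A v = (\<lambda>x. \<mu> * v x)" "v \<noteq> (\<lambda>_. 0)" "\<And>x. x \<ge> n \<Longrightarrow> v x = 0"
  shows "Re \<mu> \<in> eigs"
proof -
  have mu: "\<mu> = of_real (Re \<mu>)"
    using eigenvalue_real[OF v] by simp
  have eq: "(\<Sum>y<n. of_real (A x y) * v y) = of_real (Re \<mu>) * v x" if "x < n" for x
    using fun_cong[OF v(1), of x] that mu by (simp add: mat_op_def)
  have re: "(\<Sum>y<n. A x y * Re (v y)) = Re \<mu> * Re (v x)" if "x < n" for x
    using arg_cong[OF eq[OF that], of Re] by simp
  have im: "(\<Sum>y<n. A x y * Im (v y)) = Re \<mu> * Im (v x)" if "x < n" for x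
    using arg_cong[OF eq[OF that], of Im] by simp
  obtain x where "x < n" "v x \<noteq> 0"
    using v(2,3) by (meson ext not_le)
  then consider "Re (v x) \<noteq> 0" | "Im (v x) \<noteq> 0"
    by (auto simp: complex_eq_iff)
  then show ?thesis
  proof cases
    case 1
    then show ?thesis
      unfolding eigs_def using re \<open>x < n\<close> by (intro CollectI exI[of _ "\<lambda>x. Re (v x)"]) auto
  next
    case 2
    then show ?thesis
      unfolding eigs_def using im \<open>x < n\<close> by (intro CollectI exI[of _ "\<lambda>x. Im (v x)"]) auto
  qed
qed

text \<open>Take \<open>p\<close> of least degree. For a root \<open>\<mu>\<close> with
  \<open>p = (X - \<mu>) q\<close>, minimality makes \<open>q(A) u\<close> a nonzero eigenvector.
  Symmetry excludes double roots, so there are \<open>degree p\<close> distinct roots, all of them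
  real.\<close>

lemma vector_minimal_poly:
  assumes u: "\<And>x. x \<ge> n \<Longrightarrow> u x = 0"
  shows "\<exists>p. p \<noteq> 0 \<and> poly_op n A p u = (\<lambda>_. 0) \<and>
    (\<exists>R. finite R \<and> R \<subseteq> eigs \<and> card R = degree p)"
proof -
  define P where "P p \<longleftrightarrow> p \<noteq> 0 \<and> poly_op n A p u = (\<lambda>_. 0)" for p
  define p where "p = arg_min degree P"
  obtain p0 where "P p0"
    using annihilating_poly_exists[where n = n and u = u and A = A, OF u] unfolding P_def by auto
  from arg_min_nat_lemma[of P, OF this, of degree]
  have p: "p \<noteq> 0" "poly_op n A p u = (\<lambda>_. 0)"
    and least: "\<And>q. q \<noteq> 0 \<Longrightarrow> poly_op n A q u = (\<lambda>_. 0) \<Longrightarrow> degree p \<le> degree q"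
    by (simp_all only: P_def p_def[symmetric] not_False_eq_True simp_thms)
  have out: "poly_op n A q u x = 0" if "x \<ge> n" for q x
    using u that by (rule poly_op_outside)
  have nz: "poly_op n A q u \<noteq> (\<lambda>_. 0)" if "p = [:- \<mu>, 1:] * q" for \<mu> q
  proof -
    have "q \<noteq> 0"
      using p(1) that by auto
    moreover from this have "degree q < degree p"
      unfolding that by (subst degree_mult_eq) auto
    ultimately show ?thesis
      using least[of q] by force
  qed
  have eig: "mat_op n A (poly_op n A q u) = (\<lambda>x. \<mu> * poly_op n A q u x)"
    if "p = [:- \<mu>, 1:] * q" for \<mu> q
    using p(2) unfolding that poly_op_mult poly_op_linear_factor by (simp add: fun_eq_iff)
  have root: "\<exists>q. p = [:- \<mu>, 1:] * q" if "poly p \<mu> = 0" for \<mu>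
    using that by (simp add: poly_eq_0_iff_dvd dvd_def)
  have real: "\<mu> \<in> \<real>" and mem: "Re \<mu> \<in> eigs" if "poly p \<mu> = 0" for \<mu>
    using root[OF that] eig nz out eigenvalue_real Re_in_eigs by metis+
  \<comment> \<open>If \<open>p = (X - \<mu>)^2 q\<close>, then
    \<open>z = (A - \<mu>) q(A) u\<close> is nonzero with \<open>(A - \<mu>) z = 0\<close>, while
    self-adjointness gives \<open><z, z> = <q(A) u, (A - \<mu>) z> = 0\<close>.\<close>
  have simple: "\<not> [:- \<mu>, 1:]\<^sup>2 dvd p" for \<mu>
  proof
    assume "[:- \<mu>, 1:]\<^sup>2 dvd p"
    then obtain q where q: "p = [:- \<mu>, 1:] * ([:- \<mu>, 1:] * q)"
      unfolding power2_eq_square by (metis dvdE mult.assoc)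
    define v where "v = poly_op n A q u"
    define z where "z = (\<lambda>x. mat_op n A v x - \<mu> * v x)"
    have zq: "z = poly_op n A ([:- \<mu>, 1:] * q) u"
      by (simp only: z_def v_def poly_op_mult poly_op_linear_factor)
    have z: "z \<noteq> (\<lambda>_. 0)" "mat_op n A z = (\<lambda>x. \<mu> * z x)" "\<And>x. x \<ge> n \<Longrightarrow> z x = 0"
      unfolding zq using nz[OF q] eig[OF q] out by auto
    have "cnj \<mu> = \<mu>"
      using real[of \<mu>] q by (simp add: Reals_cnj_iff)
    then have "herm z z = herm (mat_op n A v) z - \<mu> * herm v z"
      by (simp add: z_def herm_def algebra_simps sum_subtractf sum_distrib_left)
    also have "\<dots> = 0"
      unfolding herm_self_adjoint z(2) by (simp add: herm_def sum_distrib_left mult_ac)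
    finally show False
      using herm_self_eq_0[of z] z(1,3) by blast
  qed
  have "order \<mu> p \<le> 1" for \<mu>
    using simple[of \<mu>] p(1) order_divides[of \<mu> 2 p] by linarith
  then have "rsquarefree p"
    using p(1) by (simp add: rsquarefree_def')
  then have "card {\<mu>. poly p \<mu> = 0} = degree p"
    using rsquarefree_card_degree[OF p(1)] by simp
  moreover have "inj_on Re {\<mu>. poly p \<mu> = 0}"
    using real by (intro inj_onI) (metis mem_Collect_eq of_real_Re)
  ultimately have "card (Re ` {\<mu>. poly p \<mu> = 0}) = degree p"
    by (simp add: card_image)
  moreover have "finite (Re ` {\<mu>. poly p \<mu> = 0})"
    using poly_roots_finite[OF p(1)] by simp
  ultimately show ?thesis
    using p mem by (intro exI[of _ p] conjI exI[of _ "Re ` {\<mu>. poly p \<mu> = 0}"]) auto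
qed

end

text \<open>No cancellation occurs at level \<open>degree p\<close>, since a vertex has only one neighbour on the previous
  level.\<close>

lemma poly_op_level:
  fixes A :: "nat \<Rightarrow> nat \<Rightarrow> real" and level :: "nat \<Rightarrow> nat"
  assumes root: "\<And>y. y < n \<Longrightarrow> level y = 0 \<longleftrightarrow> y = r"
    and parent: "\<And>y. y < n \<Longrightarrow> level y > 0 \<Longrightarrow>
      \<exists>z<n. A y z \<noteq> 0 \<and> Suc (level z) = level y \<and>
        (\<forall>z'<n. z' \<noteq> z \<longrightarrow> A y z' \<noteq> 0 \<longrightarrow> level y \<le> level z')"
    and p: "p \<noteq> 0"
  shows "y < n \<Longrightarrow> degree p < level y \<Longrightarrow> poly_op n A p (\<lambda>x. if x = r then 1 else 0) y = 0"
    and "y < n \<Longrightarrow> degree p = level y \<Longrightarrow> poly_op n A p (\<lambda>x. if x = r then 1 else 0) y \<noteq> 0"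
proof -
  let ?e = "\<lambda>x. if x = r then 1 else 0 :: complex"
  have "(degree p < level y \<longrightarrow> poly_op n A p ?e y = 0) \<and>
      (degree p = level y \<longrightarrow> poly_op n A p ?e y \<noteq> 0)" if "y < n" for y
    using p that
  proof (induction p arbitrary: y)
    case (pCons a p)
    show ?case
    proof (cases "p = 0")
      case True
      then show ?thesis
        using pCons.prems root[of y] by (auto simp: poly_op_pCons mat_op_zero)
    next
      case False
      show ?thesis
      proof (cases "Suc (degree p) \<le> level y")
        case True
        then have "y \<noteq> r"
          using root[of y] pCons.prems(2) by auto
        then have val: "poly_op n A (pCons a p) ?e y = (\<Sum>z<n. of_real (A y z) * poly_op n A p ?e z)"
          using pCons.prems(2) by (simp add: poly_op_pCons mat_op_def)
        obtain z where z: "z < n" "A y z \<noteq> 0" "Suc (level z) = level y"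
          "\<And>z'. z' < n \<Longrightarrow> z' \<noteq> z \<Longrightarrow> A y z' \<noteq> 0 \<Longrightarrow> level y \<le> level z'"
          using parent[of y] pCons.prems(2) True by auto
        have "of_real (A y z') * poly_op n A p ?e z' = 0" if "z' < n" "z' \<noteq> z" for z'
        proof (cases "A y z' = 0")
          case nz: False
          then have "degree p < level z'"
            using z(4)[OF that nz] True by simp
          then show ?thesis
            using pCons.IH[of z'] False that by simp
        qed simp
        then have "(\<Sum>z'<n. of_real (A y z') * poly_op n A p ?e z')
            = (\<Sum>z'\<in>{z}. of_real (A y z') * poly_op n A p ?e z')"
          using z(1) by (intro sum.mono_neutral_right) auto
        then have "poly_op n A (pCons a p) ?e y = of_real (A y z) * poly_op n A p ?e z"
          unfolding val by simp
        then show ?thesis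
          using pCons.IH[OF False z(1)] z(2,3) False by simp
      next
        case lt: False
        then show ?thesis
          using False by simp
      qed
    qed
  qed simp
  then show "y < n \<Longrightarrow> degree p < level y \<Longrightarrow> poly_op n A p ?e y = 0"
    and "y < n \<Longrightarrow> degree p = level y \<Longrightarrow> poly_op n A p ?e y \<noteq> 0"
    by auto
qed

text \<open>Every level up to \<open>d\<close> is inhabited. If an annihilating \<open>p\<close> of
  the root vector had degree at most \<open>d\<close>, a vertex of level \<open>degree p\<close>
  would have a nonzero entry in \<open>p(A) e\<close>. In the condition on \<open>z'\<close>, the
  case \<open>z' = y\<close> holds trivially, so diagonal entries are unrestricted.\<close>

lemma (in symmetric_op) card_eigs_ge:
  fixes level :: "nat \<Rightarrow> nat"
  assumes root: "\<And>y. y < n \<Longrightarrow> level y = 0 \<longleftrightarrow> y = r"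
    and parent: "\<And>y. y < n \<Longrightarrow> level y > 0 \<Longrightarrow>
      \<exists>z<n. A y z \<noteq> 0 \<and> Suc (level z) = level y \<and>
        (\<forall>z'<n. z' \<noteq> z \<longrightarrow> A y z' \<noteq> 0 \<longrightarrow> level y \<le> level z')"
    and r: "r < n" and deep: "y < n" "level y = d" and fin: "finite eigs"
  shows "d + 1 \<le> card eigs"
proof -
  have levels: "\<exists>z<n. level z = m" if "m \<le> d" for m
    using that
  proof (induction rule: inc_induct)
    case (step m)
    then show ?case using parent by (metis Suc_inject zero_less_Suc)
  qed (use deep in auto)
  let ?e = "\<lambda>x. if x = r then 1 else 0 :: complex"
  obtain p R where p: "p \<noteq> 0" "poly_op n A p ?e = (\<lambda>_. 0)"
    and R: "finite R" "R \<subseteq> eigs" "card R = degree p"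
    using vector_minimal_poly[of ?e] r by force
  have "d < degree p"
  proof (rule ccontr)
    assume "\<not> d < degree p"
    then obtain z where "z < n" "level z = degree p"
      using levels[of "degree p"] by auto
    then show False
      using poly_op_level(2)[where A = A, OF root parent p(1), of z] p(2) by simp
  qed
  then show ?thesis
    using card_mono[OF fin R(2)] R(3) by simp
qed

lemma spectrum_eq_eigs:
  assumes M: "M \<in> carrier_mat n n"
  shows "spectrum M = {\<mu>. \<exists>v :: nat \<Rightarrow> real. (\<exists>x<n. v x \<noteq> 0) \<and>
    (\<forall>x<n. (\<Sum>y<n. M $$ (x, y) * v y) = \<mu> * v x)}"
proof (intro Set.set_eqI iffI)
  fix \<mu> :: real assume "\<mu> \<in> spectrum M"
  then obtain v where v: "v \<in> carrier_vec n" "v \<noteq> 0\<^sub>v n" "M *\<^sub>v v = \<mu> \<cdot>\<^sub>v v"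
    using M by (auto simp: spectrum_def eigenvalue_def eigenvector_def)
  obtain x where "x < n" "v $ x \<noteq> 0"
    using v(1,2) by (metis carrier_vecD eq_vecI index_zero_vec(1) index_zero_vec(2))
  moreover have "(\<Sum>y<n. M $$ (x, y) * v $ y) = \<mu> * v $ x" if "x < n" for x
    using arg_cong[OF v(3), of "\<lambda>w. w $ x"] that v(1) M by (simp add: scalar_prod_def lessThan_atLeast0)
  ultimately show "\<mu> \<in> {\<mu>. \<exists>v :: nat \<Rightarrow> real. (\<exists>x<n. v x \<noteq> 0) \<and>
      (\<forall>x<n. (\<Sum>y<n. M $$ (x, y) * v y) = \<mu> * v x)}"
    by (intro CollectI exI[of _ "\<lambda>x. v $ x"]) auto
next
  fix \<mu> :: real assume "\<mu> \<in> {\<mu>. \<exists>v :: nat \<Rightarrow> real. (\<exists>x<n. v x \<noteq> 0) \<and>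
    (\<forall>x<n. (\<Sum>y<n. M $$ (x, y) * v y) = \<mu> * v x)}"
  then obtain v :: "nat \<Rightarrow> real" and x where x: "x < n" "v x \<noteq> 0"
    and v: "\<And>x. x < n \<Longrightarrow> (\<Sum>y<n. M $$ (x, y) * v y) = \<mu> * v x"
    by blast
  have "M *\<^sub>v vec n v = \<mu> \<cdot>\<^sub>v vec n v"
    using v M by (intro eq_vecI) (auto simp: scalar_prod_def lessThan_atLeast0)
  moreover have "vec n v \<noteq> 0\<^sub>v n"
    using x by (metis index_vec index_zero_vec(1))
  ultimately show "\<mu> \<in> spectrum M"
    using M by (auto simp: spectrum_def eigenvalue_def eigenvector_def intro!: exI[of _ "vec n v"])
qed

section \<open>Trees with a centre\<close>

text \<open>A tree is encoded by a parent map \<open>par\<close> and the depth \<open>dep\<close> below the centre. A central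
  vertex is its own parent; the endpoints of a central edge are the parents of each other.\<close>

locale ptree =
  fixes G :: "'v pair_pre_digraph" and par :: "'v \<Rightarrow> 'v" and dep :: "'v \<Rightarrow> nat"
  assumes finite_verts: "finite (pverts G)"
    and par_in: "\<And>v. v \<in> pverts G \<Longrightarrow> par v \<in> pverts G"
    and dep_par: "\<And>v. v \<in> pverts G \<Longrightarrow> dep v > 0 \<Longrightarrow> dep v = Suc (dep (par v))"
    and dep_par_root: "\<And>r. r \<in> pverts G \<Longrightarrow> dep r = 0 \<Longrightarrow> dep (par r) = 0"
    and par_par_root: "\<And>r. r \<in> pverts G \<Longrightarrow> dep r = 0 \<Longrightarrow> par (par r) = r"
    and roots: "\<And>r s. r \<in> pverts G \<Longrightarrow> dep r = 0 \<Longrightarrow> s \<in> pverts G \<Longrightarrow> dep s = 0 \<Longrightarrow>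
      s = r \<or> s = par r"
    and arcs_iff: "\<And>x y. (x, y) \<in> parcs G \<longleftrightarrow>
      x \<in> pverts G \<and> y \<in> pverts G \<and> x \<noteq> y \<and> (par x = y \<or> par y = x)"
begin

abbreviation "V \<equiv> pverts G"

lemma funpow_par_in: "v \<in> V \<Longrightarrow> (par ^^ i) v \<in> V"
  by (induction i) (auto simp: par_in)

lemma dep_funpow: "v \<in> V \<Longrightarrow> i \<le> dep v \<Longrightarrow> dep ((par ^^ i) v) = dep v - i"
proof (induction i)
  case (Suc i)
  then show ?case
    using dep_par[of "(par ^^ i) v"] funpow_par_in[of v i] by auto
qed simp

lemma arc_cases:
  assumes "(x, y) \<in> parcs G"
  obtains (up) "x \<in> V" "y \<in> V" "dep x = Suc (dep y)" "par x = y"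
    | (down) "x \<in> V" "y \<in> V" "dep y = Suc (dep x)" "par y = x"
    | (root) "x \<in> V" "y \<in> V" "dep x = 0" "dep y = 0" "x \<noteq> y" "par x = y" "par y = x"
proof -
  have xy: "x \<in> V" "y \<in> V" "x \<noteq> y" "par x = y \<or> par y = x"
    using assms by (auto simp: arcs_iff)
  show thesis
  proof (cases "par x = y")
    case True
    then show ?thesis
      using xy dep_par[of x] dep_par_root[of x] par_par_root[of x] up root by (cases "dep x = 0") auto
  next
    case False
    then show ?thesis
      using xy dep_par[of y] dep_par_root[of y] par_par_root[of y] down by (cases "dep y = 0") auto
  qed
qed

end

section \<open>Paths, the diameter and the main roots\<close>

lemma vpath_Cons_Cons:
  "vpath (x # y # q) (with_proj G) \<longleftrightarrow>
    x \<in> pverts G \<and> x \<notin> set (y # q) \<and> (x, y) \<in> parcs G \<and> vpath (y # q) (with_proj G)"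
  by (auto simp: vpath_def vwalk_def)

text \<open>After a step down, the only neighbour that is not a child is the vertex just left. The
  path must keep descending, and its length is a difference of depths.\<close>

lemma (in ptree) descending_vpath_length:
  assumes "vpath (x # y # q) (with_proj G)" "par y = x" "dep y = Suc (dep x)"
  shows "length q + 1 + dep x = dep (last (y # q))"
  using assms
proof (induction q arbitrary: x y)
  case (Cons z q)
  then have yz: "(y, z) \<in> parcs G" "x \<noteq> z" and p: "vpath (y # z # q) (with_proj G)"
    by (auto simp: vpath_Cons_Cons)
  from yz(1) show ?case
  proof (cases rule: arc_cases)
    case down
    then show ?thesis using Cons.IH[OF p] Cons.prems by auto
  qed (use Cons.prems yz in auto)
qed simp

text \<open>For \<open>d = 2k\<close> the ancestors compared in \<open>deep_pair\<close> have depth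
  1, so two deepest vertices lie in different branches at the centre. For \<open>d = 2k + 1\<close>
  they have depth 0, so the two vertices lie on different sides of the main edge. In both cases the
  path between them has length \<open>d\<close>.\<close>

locale diam_tree = ptree +
  fixes d :: nat
  assumes d_pos: "d \<ge> 1"
    and dep_le: "\<And>v. v \<in> V \<Longrightarrow> dep v \<le> d div 2"
    and par_root: "\<And>r. r \<in> V \<Longrightarrow> dep r = 0 \<Longrightarrow> par r = r \<longleftrightarrow> even d"
    and deep_pair: "\<exists>x\<in>V. \<exists>y\<in>V. dep x = d div 2 \<and> dep y = d div 2 \<and>
      (par ^^ ((d + 1) div 2 - 1)) x \<noteq> (par ^^ ((d + 1) div 2 - 1)) y"
begin

text \<open>A path ascends, crosses the main edge at most once, and descends. The term
  \<open>d mod 2\<close> pays for the crossing, which exists only for odd \<open>d\<close>.\<close>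

lemma vpath_length_le:
  assumes "vpath p (with_proj G)"
  shows "length p \<le> dep (hd p) + dep (last p) + 1 + d mod 2"
  using assms
proof (induction p rule: induct_list012)
  case (3 x y q)
  then have xy: "(x, y) \<in> parcs G" and p: "vpath (y # q) (with_proj G)" and nx: "x \<notin> set (y # q)"
    by (auto simp: vpath_Cons_Cons)
  from xy show ?case
  proof (cases rule: arc_cases)
    case up
    then show ?thesis using 3(2)[OF p] by auto
  next
    case down
    then show ?thesis using descending_vpath_length[OF 3(3)] by auto
  next
    case root
    then have "odd d" using par_root[of x] by auto
    then have d2: "d mod 2 = 1" by presburger
    show ?thesis
    proof (cases q)
      case Nil
      then show ?thesis using d2 by simp
    next
      case (Cons z q')
      then have yz: "(y, z) \<in> parcs G" "x \<noteq> z" and p: "vpath (y # z # q') (with_proj G)"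
        using 3(3) by (auto simp: vpath_Cons_Cons)
      from yz(1) show ?thesis
      proof (cases rule: arc_cases)
        case down
        then show ?thesis
          using descending_vpath_length[OF p] root Cons d2 by auto
      qed (use root yz in auto)
    qed
  qed
qed auto

lemma vpath_length_le_d:
  assumes "vpath p (with_proj G)"
  shows "length p \<le> d + 1"
proof -
  have "p \<noteq> []" "set p \<subseteq> V"
    using assms by (auto simp: vpath_def vwalk_def)
  then have "hd p \<in> V" "last p \<in> V"
    by auto
  then have "dep (hd p) \<le> d div 2" "dep (last p) \<le> d div 2"
    by (auto intro: dep_le)
  then show ?thesis
    using vpath_length_le[OF assms] div_mult_mod_eq[of d 2] by linarith
qed

definition tip1 where
  "tip1 = (SOME x. x \<in> V \<and> dep x = d div 2 \<and> (\<exists>y\<in>V. dep y = d div 2 \<and>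
      (par ^^ ((d + 1) div 2 - 1)) x \<noteq> (par ^^ ((d + 1) div 2 - 1)) y))"

definition tip2 where
  "tip2 = (SOME y. y \<in> V \<and> dep y = d div 2 \<and>
      (par ^^ ((d + 1) div 2 - 1)) tip1 \<noteq> (par ^^ ((d + 1) div 2 - 1)) y)"

lemma tips:
  "tip1 \<in> V" "dep tip1 = d div 2" "tip2 \<in> V" "dep tip2 = d div 2"
  "(par ^^ ((d + 1) div 2 - 1)) tip1 \<noteq> (par ^^ ((d + 1) div 2 - 1)) tip2"
proof -
  have 1: "tip1 \<in> V \<and> dep tip1 = d div 2 \<and> (\<exists>y\<in>V. dep y = d div 2 \<and>
      (par ^^ ((d + 1) div 2 - 1)) tip1 \<noteq> (par ^^ ((d + 1) div 2 - 1)) y)"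
    unfolding tip1_def by (rule someI_ex) (use deep_pair in blast)
  have 2: "tip2 \<in> V \<and> dep tip2 = d div 2 \<and>
      (par ^^ ((d + 1) div 2 - 1)) tip1 \<noteq> (par ^^ ((d + 1) div 2 - 1)) tip2"
    unfolding tip2_def by (rule someI_ex) (use 1 in blast)
  show "tip1 \<in> V" "dep tip1 = d div 2" "tip2 \<in> V" "dep tip2 = d div 2"
    "(par ^^ ((d + 1) div 2 - 1)) tip1 \<noteq> (par ^^ ((d + 1) div 2 - 1)) tip2"
    using 1 2 by auto
qed

text \<open>Equal vertices have equal depth, so \<open>i = j\<close>. Chains that meet stay
  together, but those of the tips are still apart after \<open>(d + 1) div 2 - 1\<close> steps. The
  bounds differ so that for even \<open>d\<close> the centre belongs to the chain of
  \<open>tip1\<close> only.\<close>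

lemma chains_disjoint:
  assumes "i \<le> d div 2" "j < (d + 1) div 2"
  shows "(par ^^ i) tip1 \<noteq> (par ^^ j) tip2"
proof
  assume eq: "(par ^^ i) tip1 = (par ^^ j) tip2"
  have "j \<le> d div 2"
    using assms(2) by linarith
  then have "i = j"
    using arg_cong[OF eq, of dep] dep_funpow[OF tips(1)] dep_funpow[OF tips(3)] tips(2,4) assms(1)
    by simp
  let ?m = "(d + 1) div 2 - 1"
  have m: "?m = (?m - j) + j"
    using assms(2) by simp
  have "(par ^^ ?m) tip1 = (par ^^ ?m) tip2"
    by (subst (1 2) m) (simp only: funpow_add o_apply eq[unfolded \<open>i = j\<close>])
  then show False
    using tips(5) by simp
qed

lemma root_tip1: "(par ^^ (d div 2)) tip1 \<in> V" "dep ((par ^^ (d div 2)) tip1) = 0"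
  using funpow_par_in[OF tips(1)] dep_funpow[OF tips(1)] tips(2) by auto

text \<open>For odd \<open>d\<close> the exponent on the left is larger by one: the chain of
  \<open>tip2\<close> crosses the main edge, since \<open>par\<close> exchanges the two
  roots.\<close>

lemma chains_meet: "(par ^^ ((d + 1) div 2)) tip2 = (par ^^ (d div 2)) tip1"
proof (cases "even d")
  case True
  then have "(par ^^ (d div 2)) tip2 = (par ^^ (d div 2)) tip1"
    using roots[OF root_tip1, of "(par ^^ (d div 2)) tip2"] par_root[OF root_tip1]
      funpow_par_in[OF tips(3)] dep_funpow[OF tips(3)] tips(4) by auto
  then show ?thesis
    using True by simp
next
  case False
  then have m: "(d + 1) div 2 = Suc (d div 2)"
    by presburger
  have "(par ^^ (d div 2)) tip2 = par ((par ^^ (d div 2)) tip1)"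
    using roots[OF root_tip1, of "(par ^^ (d div 2)) tip2"] chains_disjoint[of "d div 2" "d div 2"]
      funpow_par_in[OF tips(3)] dep_funpow[OF tips(3)] tips(4) m by auto
  then show ?thesis
    unfolding m using par_par_root[OF root_tip1] by simp
qed

definition long_path :: "nat \<Rightarrow> 'a" where
  "long_path i = (if i \<le> d div 2 then (par ^^ i) tip1 else (par ^^ (d - i)) tip2)"

lemma long_path_in: "long_path i \<in> V"
  using funpow_par_in tips by (auto simp: long_path_def)

lemma inj_long_path: "inj_on long_path {0..<d + 1}"
proof (rule inj_onI)
  have dp: "dep (long_path i) = (if i \<le> d div 2 then d div 2 - i else d div 2 - (d - i))"
    if "i < d + 1" for i
  proof (cases "i \<le> d div 2")
    case False
    then have "d - i \<le> d div 2" by linarith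
    then show ?thesis using False dep_funpow[OF tips(3)] tips(4) by (auto simp: long_path_def)
  qed (use dep_funpow[OF tips(1)] tips(2) in \<open>auto simp: long_path_def\<close>)
  fix i j assume ij: "i \<in> {0..<d + 1}" "j \<in> {0..<d + 1}" "long_path i = long_path j"
  have ne: "long_path a \<noteq> long_path b" if "a \<le> d div 2" "\<not> b \<le> d div 2" "b < d + 1" for a b
  proof -
    have "d - b < (d + 1) div 2" using that by linarith
    then show ?thesis using chains_disjoint[OF that(1)] that by (auto simp: long_path_def)
  qed
  have side: "i \<le> d div 2 \<longleftrightarrow> j \<le> d div 2"
    using ne[of i j] ne[of j i] ij by fastforce
  have ij': "i \<le> d" "j \<le> d"
    using ij by auto
  have eq: "dep (long_path i) = dep (long_path j)"
    using ij(3) by simp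
  show "i = j"
  proof (cases "i \<le> d div 2")
    case True
    then have "d div 2 - i = d div 2 - j"
      using eq dp[of i] dp[of j] ij' side by simp
    then show ?thesis
      using True side by auto
  next
    case False
    then have "d div 2 - (d - i) = d div 2 - (d - j)"
      using eq dp[of i] dp[of j] ij' side by simp
    moreover have "d - i \<le> d div 2" "d - j \<le> d div 2"
      using False side by linarith+
    ultimately show ?thesis
      using ij' by auto
  qed
qed

lemma arc_long_path:
  assumes "i < d"
  shows "(long_path i, long_path (Suc i)) \<in> parcs G"
proof -
  have "long_path i \<noteq> long_path (Suc i)"
    using inj_onD[OF inj_long_path, of i "Suc i"] assms by auto
  moreover have "par (long_path i) = long_path (Suc i) \<or> par (long_path (Suc i)) = long_path i"
  proof -
    consider "i < d div 2" | "i = d div 2" | "i > d div 2" by linarith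
    then show ?thesis
    proof cases
      case 1
      then show ?thesis by (simp add: long_path_def)
    next
      case 2
      have m: "(d + 1) div 2 = Suc (d - Suc i)"
        using 2 assms by presburger
      have "par (long_path (Suc i)) = (par ^^ ((d + 1) div 2)) tip2"
        unfolding m using 2 by (simp add: long_path_def)
      then show ?thesis
        using chains_meet 2 by (simp add: long_path_def)
    next
      case 3
      then have "d - i = Suc (d - Suc i)" using assms by simp
      then show ?thesis using 3 by (simp add: long_path_def)
    qed
  qed
  ultimately show ?thesis
    using long_path_in by (auto simp: arcs_iff)
qed

end

lemma in_vwalk_arcs_nth:
  "a \<in> set (vwalk_arcs p) \<Longrightarrow> \<exists>i. Suc i < length p \<and> a = (p ! i, p ! Suc i)"
proof (induction p rule: vwalk_arcs.induct)
  case (3 x y xs)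
  then consider "a = (x, y)" | "a \<in> set (vwalk_arcs (y # xs))"
    by auto
  then show ?case
  proof cases
    case 1
    then show ?thesis by (intro exI[of _ 0]) simp
  next
    case 2
    then obtain i where "Suc i < length (y # xs)" "a = ((y # xs) ! i, (y # xs) ! Suc i)"
      using 3 by blast
    then show ?thesis by (intro exI[of _ "Suc i"]) simp
  qed
qed auto

context diam_tree
begin

lemma vpath_long_path: "vpath (map long_path [0..<d + 1]) (with_proj G)"
proof (intro vpathI vwalkI)
  show "set (map long_path [0..<d + 1]) \<subseteq> verts (with_proj G)"
    using long_path_in by auto
  have "a \<in> parcs G" if a: "a \<in> set (vwalk_arcs (map long_path [0..<d + 1]))" for a
  proof -
    obtain i where i: "Suc i < length (map long_path [0..<d + 1])"
      "a = (map long_path [0..<d + 1] ! i, map long_path [0..<d + 1] ! Suc i)"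
      using in_vwalk_arcs_nth[OF a] by blast
    then have "a = (long_path i, long_path (Suc i))" "i < d"
      by (simp_all del: upt_Suc)
    then show ?thesis using arc_long_path by simp
  qed
  then show "set (vwalk_arcs (map long_path [0..<d + 1])) \<subseteq> arcs_ends (with_proj G)"
    by (auto simp: arcs_ends_def arc_to_ends_def)
  show "distinct (map long_path [0..<d + 1])"
    using inj_long_path by (simp add: distinct_map del: upt_Suc)
qed (simp del: upt_Suc)

lemma diam_eq: "diam G = d"
proof -
  let ?S = "{vwalk_length p | p. vpath p (with_proj G)}"
  have le: "n \<le> d" if "n \<in> ?S" for n
    using that vpath_length_le_d by fastforce
  moreover have "d \<in> ?S"
    using vpath_long_path by (intro CollectI exI[of _ "map long_path [0..<d + 1]"]) (simp del: upt_Suc)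
  moreover have "finite ?S"
    by (rule finite_subset[of _ "{..d}"]) (use le in auto)
  ultimately show ?thesis
    unfolding diam_def by (intro Max_eqI) auto
qed

text \<open>Diameter preservation enters here: a branch that avoids \<open>main_roots\<close>
  contains no vertex of depth 0. Such a vertex is the end of the chain of \<open>tip1\<close> or,
  for odd \<open>d\<close>, its partner across the main edge; both lie in the middle of
  \<open>long_path\<close>.\<close>

lemma root_in_main_roots:
  assumes r: "r \<in> V" "dep r = 0"
  shows "r \<in> main_roots G"
proof -
  have mem: "long_path i \<in> main_roots G" if "i = d div 2 \<or> i = (d + 1) div 2" for i
  proof -
    have "i < d + 1" using that d_pos by auto
    then have "map long_path [0..<d + 1] ! i = long_path i"
      by (simp del: upt_Suc)
    then show ?thesis
      unfolding main_roots_def diam_eq using vpath_long_path that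
      by (intro CollectI exI[of _ "map long_path [0..<d + 1]"] exI[of _ i]) (auto simp del: upt_Suc)
  qed
  let ?c = "(par ^^ (d div 2)) tip1"
  have c: "long_path (d div 2) = ?c"
    by (simp add: long_path_def)
  show ?thesis
  proof (cases "r = ?c")
    case True
    then show ?thesis using mem[of "d div 2"] c by simp
  next
    case False
    then have r': "r = par ?c"
      using roots[OF root_tip1 r] by auto
    then have "odd d"
      using par_root[OF root_tip1] False by auto
    then have e: "(d + 1) div 2 = Suc (d div 2)" "d - Suc (d div 2) = d div 2"
      by presburger+
    have "par ((par ^^ (d div 2)) tip2) = ?c"
      using chains_meet e by simp
    then have "r = (par ^^ (d div 2)) tip2"
      using r' par_par_root[of "(par ^^ (d div 2)) tip2"] funpow_par_in[OF tips(3)]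
        dep_funpow[OF tips(3)] tips(4) by auto
    then have "r = long_path ((d + 1) div 2)"
      using e by (simp add: long_path_def)
    then show ?thesis using mem by simp
  qed
qed

text \<open>Re-rooting at an end of a longest path: the level of a vertex is its distance from
  \<open>tip1\<close>, computed through the first ancestor lying on the path from \<open>tip1\<close> to the centre.\<close>

definition up_chain :: "'a set" where
  "up_chain = (\<lambda>i. (par ^^ i) tip1) ` {..d div 2}"

definition level :: "'a \<Rightarrow> nat" where
  "level y = (let j = LEAST j. (par ^^ j) y \<in> up_chain in j + (d div 2 - dep ((par ^^ j) y)))"

lemma up_chain_eq: "c \<in> up_chain \<Longrightarrow> c = (par ^^ (d div 2 - dep c)) tip1"
  using dep_funpow[OF tips(1)] tips(2) by (auto simp: up_chain_def)

lemma up_chain_unique: "c \<in> up_chain \<Longrightarrow> c' \<in> up_chain \<Longrightarrow> dep c = dep c' \<Longrightarrow> c = c'"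
  using up_chain_eq by metis

lemma up_chain_in: "c \<in> up_chain \<Longrightarrow> c \<in> V"
  using funpow_par_in[OF tips(1)] by (auto simp: up_chain_def)

lemma par_up_chain: "c \<in> up_chain \<Longrightarrow> dep c > 0 \<Longrightarrow> par c \<in> up_chain"
proof -
  assume c: "c \<in> up_chain" "dep c > 0"
  then obtain i where i: "c = (par ^^ i) tip1" "i \<le> d div 2"
    by (auto simp: up_chain_def)
  then have "i < d div 2"
    using c(2) dep_funpow[OF tips(1), of i] tips(2) by auto
  then have "(par ^^ Suc i) tip1 \<in> up_chain"
    unfolding up_chain_def by (intro imageI) simp
  then show ?thesis using i by simp
qed

lemma level_on: "y \<in> up_chain \<Longrightarrow> level y = d div 2 - dep y"
proof -
  assume "y \<in> up_chain"
  then have "(LEAST j. (par ^^ j) y \<in> up_chain) = 0"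
    by (intro Least_eq_0) simp
  then show ?thesis by (simp add: level_def)
qed

text \<open>Ancestors end at depth 0. For odd \<open>d\<close> this may be the endpoint of the main
  edge that is not on \<open>up_chain\<close>; one more application of \<open>par\<close> crosses
  over.\<close>

lemma reaches_up_chain:
  assumes y: "y \<in> V"
  shows "\<exists>j. (par ^^ j) y \<in> up_chain"
proof -
  let ?c = "(par ^^ (d div 2)) tip1" and ?s = "(par ^^ dep y) y"
  have c: "?c \<in> up_chain" by (auto simp: up_chain_def)
  have "?s \<in> V" "dep ?s = 0"
    using funpow_par_in[OF y] dep_funpow[OF y] by auto
  then consider "?s = ?c" | "par ?s = ?c"
    using roots[of ?s ?c] root_tip1 by auto
  then show ?thesis
  proof cases
    case 1
    then show ?thesis using c by metis
  next
    case 2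
    then have "(par ^^ Suc (dep y)) y \<in> up_chain" using c by simp
    then show ?thesis by blast
  qed
qed

lemma level_off:
  assumes "y \<in> V" "y \<notin> up_chain"
  shows "level y = Suc (level (par y))"
proof -
  obtain j where j: "(par ^^ j) y \<in> up_chain"
    using reaches_up_chain[OF assms(1)] by blast
  have "(LEAST j. (par ^^ j) y \<in> up_chain) = Suc (LEAST j. (par ^^ Suc j) y \<in> up_chain)"
    using Least_Suc[of "\<lambda>j. (par ^^ j) y \<in> up_chain" j] j assms(2) by simp
  then show ?thesis
    by (simp add: level_def Let_def funpow_Suc_right del: funpow.simps)
qed

lemma level_eq_0_iff:
  assumes "y \<in> V"
  shows "level y = 0 \<longleftrightarrow> y = tip1"
proof (cases "y \<in> up_chain")
  case True
  show ?thesis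
  proof
    assume "level y = 0"
    then have "dep y = d div 2"
      using level_on[OF True] dep_le[OF assms] by simp
    then have "d div 2 - dep y = 0"
      by simp
    then show "y = tip1"
      using up_chain_eq[OF True] by (metis funpow_0)
  qed (use level_on[OF True] tips(2) in simp)
next
  case False
  moreover have "tip1 \<in> up_chain"
    unfolding up_chain_def by (rule image_eqI[of _ _ 0]) auto
  ultimately show ?thesis
    using level_off[OF assms False] by auto
qed

text \<open>Re-rooting reverses exactly the edges along \<open>up_chain\<close>: there the lower
  neighbour is the preceding vertex of the chain, elsewhere it is the parent.\<close>

lemma unique_lower_neighbour:
  assumes y: "y \<in> V" and pos: "level y > 0"
  shows "\<exists>z\<in>V. (y, z) \<in> parcs G \<and> Suc (level z) = level y \<and>
    (\<forall>z'. z' \<noteq> z \<longrightarrow> (y, z') \<in> parcs G \<longrightarrow> level y \<le> level z')"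
proof (cases "y \<in> up_chain")
  case True
  then obtain i where i: "y = (par ^^ i) tip1" "i \<le> d div 2"
    by (auto simp: up_chain_def)
  have di: "dep y = d div 2 - i"
    using dep_funpow[OF tips(1)] tips(2) i by auto
  have "i > 0"
    using pos level_on[OF True] di by (cases i) auto
  define z where "z = (par ^^ (i - 1)) tip1"
  have pz: "par z = y"
    using i \<open>i > 0\<close> by (cases i) (auto simp: z_def)
  have z: "z \<in> up_chain"
    using i by (auto simp: z_def up_chain_def)
  have dz: "dep z = Suc (dep y)"
    using dep_funpow[OF tips(1), of "i - 1"] tips(2) i(2) \<open>i > 0\<close> di by (simp add: z_def)
  have "(y, z) \<in> parcs G"
    using pz dz y up_chain_in[OF z] by (auto simp: arcs_iff)
  moreover have "Suc (level z) = level y"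
    using level_on[OF True] level_on[OF z] dz dep_le[OF up_chain_in[OF z]] by simp
  moreover have "level y \<le> level z'" if z': "z' \<noteq> z" "(y, z') \<in> parcs G" for z'
    using z'(2)
  proof (cases rule: arc_cases)
    case up
    then have "z' \<in> up_chain" using par_up_chain[OF True] by auto
    then show ?thesis using level_on True up by auto
  next
    case down
    then have "z' \<notin> up_chain"
      using up_chain_unique[OF z, of z'] z'(1) dz by auto
    then show ?thesis using level_off[of z'] down by auto
  next
    case root
    then have "z' \<notin> up_chain"
      using up_chain_unique[OF True, of z'] by auto
    then show ?thesis using level_off[of z'] root by auto
  qed
  ultimately show ?thesis
    using up_chain_in[OF z] by blast
next
  case False
  have "par y \<noteq> y"
  proof
    assume eq: "par y = y"
    then have "dep y = 0" using dep_par[OF y] by (cases "dep y = 0") auto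
    then have "y = (par ^^ (d div 2)) tip1"
      using roots[OF y, of "(par ^^ (d div 2)) tip1"] root_tip1 eq by auto
    then show False using False by (auto simp: up_chain_def)
  qed
  then have "(y, par y) \<in> parcs G"
    using y par_in by (auto simp: arcs_iff)
  moreover have "level y \<le> level z'" if z': "z' \<noteq> par y" "(y, z') \<in> parcs G" for z'
    using z'(2)
  proof (cases rule: arc_cases)
    case down
    then have "z' \<notin> up_chain" using par_up_chain[of z'] False by auto
    then show ?thesis using level_off[of z'] down by auto
  qed (use z' in auto)
  ultimately show ?thesis
    using level_off[OF y False] par_in[OF y] by metis
qed

text \<open>\<open>tip2\<close> reaches \<open>up_chain\<close> only at its top, after
  \<open>(d + 1) div 2\<close> steps, and the top is \<open>d div 2\<close> steps away from
  \<open>tip1\<close>.\<close>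

lemma level_tip2: "level tip2 = d"
proof -
  let ?m = "(d + 1) div 2"
  have "(LEAST j. (par ^^ j) tip2 \<in> up_chain) = ?m"
  proof (rule Least_equality)
    show "(par ^^ ?m) tip2 \<in> up_chain"
      unfolding chains_meet by (auto simp: up_chain_def)
    show "?m \<le> j" if "(par ^^ j) tip2 \<in> up_chain" for j
      using that chains_disjoint[of _ j] by (force simp: up_chain_def not_le[symmetric])
  qed
  then have "level tip2 = ?m + (d div 2 - dep ((par ^^ ?m) tip2))"
    by (simp only: level_def Let_def)
  also have "\<dots> = ?m + d div 2"
    by (simp only: chains_meet root_tip1(2) diff_zero)
  also have "\<dots> = d"
    by presburger
  finally show ?thesis .
qed

end

section \<open>Weights and branch duplication\<close>

definition children :: "'v pair_pre_digraph \<Rightarrow> ('v \<Rightarrow> 'v) \<Rightarrow> ('v \<Rightarrow> nat) \<Rightarrow> 'v \<Rightarrow> 'v set" where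
  "children G par dep v = {c \<in> pverts G. dep c > 0 \<and> par c = v}"

text \<open>Here \<open>w c\<close> is the square of the matrix entry joining \<open>c\<close> to its parent. The identity also holds
  at the poles, where division by zero yields zero.\<close>

definition weighting ::
  "'v pair_pre_digraph \<Rightarrow> ('v \<Rightarrow> 'v) \<Rightarrow> ('v \<Rightarrow> nat) \<Rightarrow> ('v \<Rightarrow> real) \<Rightarrow> ('v \<Rightarrow> real \<Rightarrow> real) \<Rightarrow> bool" where
  "weighting G par dep w F \<longleftrightarrow>
    (\<forall>c\<in>pverts G. dep c > 0 \<longrightarrow> w c > 0) \<and>
    (\<forall>v\<in>pverts G. \<exists>\<alpha>. \<forall>x. F v x = x - \<alpha> - (\<Sum>c\<in>children G par dep v. w c / F c x))"

text \<open>\<open>\<Lambda>\<close> is the set that will contain the spectrum. Unlike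
  \<open>w\<close>, \<open>w0\<close> is the matrix entry of the main edge itself, hence the square.
  If \<open>par r = r\<close>, the last condition says \<open>F r x \<noteq> 0\<close>, and
  \<open>w0\<close> can be any positive number.\<close>

definition realized :: "nat \<Rightarrow> real set \<Rightarrow> 'v pair_pre_digraph \<Rightarrow> bool" where
  "realized d \<Lambda> G \<longleftrightarrow> (\<exists>par dep w F w0.
    diam_tree G par dep d \<and> weighting G par dep w F \<and> w0 > 0 \<and>
    (\<forall>v\<in>pverts G. dep v > 0 \<longrightarrow> (\<forall>x. x \<notin> \<Lambda> \<longrightarrow> F v x \<noteq> 0)) \<and>
    (\<forall>r\<in>pverts G. dep r = 0 \<longrightarrow>
      (\<forall>x. x \<notin> \<Lambda> \<longrightarrow> F r x * F (par r) x \<noteq> (if par r = r then 0 else w0\<^sup>2))))"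

section \<open>Branches and their copies\<close>

context ptree
begin

text \<open>\<open>is_branch\<close> speaks of components only. As the component has no vertex of
  depth 0, climbing from any of its vertices must leave it, and the only exit is \<open>v\<close>.
  Hence it contains a child \<open>b\<close> of \<open>v\<close>, and all of it lies below
  \<open>b\<close>.\<close>

lemma branch_structure:
  assumes br: "is_branch G v B" and no_root: "\<And>x. x \<in> B \<Longrightarrow> x \<in> V \<Longrightarrow> dep x > 0"
  obtains b where "b \<in> B" "par b = v" "v \<in> V" "B \<subseteq> V" "v \<notin> B"
    "\<And>r. r \<in> B \<Longrightarrow> (v, r) \<in> parcs G \<longleftrightarrow> r = b"
    "\<And>x. x \<in> B \<Longrightarrow> x \<noteq> b \<Longrightarrow> par x \<in> B"
    "\<And>x. x \<in> V \<Longrightarrow> dep x > 0 \<Longrightarrow> par x \<in> B \<Longrightarrow> x \<in> B"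
proof -
  define D where "D = pre_digraph.del_vert (with_proj G) v"
  have ends: "arcs_ends D = {(x, y) \<in> parcs G. x \<noteq> v \<and> y \<noteq> v}"
    by (auto simp: D_def arcs_ends_def arc_to_ends_def pre_digraph.del_vert_simps)
  have verts: "verts D = V - {v}"
    by (simp add: D_def pre_digraph.del_vert_simps)
  have B: "B \<noteq> {}" "\<And>x y. x \<in> B \<Longrightarrow> y \<in> B \<Longrightarrow> x \<rightarrow>\<^sup>*\<^bsub>D\<^esub> y"
    "\<And>x y. x \<in> B \<Longrightarrow> y \<notin> B \<Longrightarrow> \<not> x \<rightarrow>\<^sup>*\<^bsub>D\<^esub> y \<or> \<not> y \<rightarrow>\<^sup>*\<^bsub>D\<^esub> x"
    and v: "v \<in> V"
    using br by (auto simp: is_branch_def pre_digraph.sccs_verts_def D_def)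
  have BV: "B \<subseteq> V - {v}"
    using B(2) verts unfolding reachable_def by (metis in_rtrancl_on_in_F(1) subsetI)
  have step: "x \<rightarrow>\<^sup>*\<^bsub>D\<^esub> y" if "(x, y) \<in> parcs G" "x \<noteq> v" "y \<noteq> v" for x y
  proof -
    have "x \<in> verts D" "y \<in> verts D" "(x, y) \<in> arcs_ends D"
      using that by (auto simp: verts ends arcs_iff)
    then show ?thesis
      unfolding reachable_def by (meson rtrancl_on_refl rtrancl_on_into_rtrancl_on)
  qed
  have closed: "y \<in> B" if "x \<in> B" "(x, y) \<in> parcs G" "y \<noteq> v" for x y
  proof -
    have "x \<noteq> v" "(y, x) \<in> parcs G"
      using that BV by (auto simp: arcs_iff)
    then show ?thesis
      using B(3)[of x y] step[of x y] step[of y x] that by blast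
  qed
  have up_arc: "(x, par x) \<in> parcs G" if "x \<in> V" "dep x > 0" for x
    using that par_in dep_par[OF that] by (auto simp: arcs_iff)
  have dpos: "dep x > 0" if "x \<in> B" for x
    using no_root that BV by auto
  have up: "par x = v \<or> par x \<in> B" if "x \<in> B" for x
    using closed[OF that up_arc] dpos[OF that] that BV by blast
  have "\<exists>b\<in>B. par b = v"
  proof (rule ccontr)
    assume *: "\<not> (\<exists>b\<in>B. par b = v)"
    obtain x where x: "x \<in> B" using B(1) by blast
    have "(par ^^ i) x \<in> B" for i
      using up * x by (induction i) auto
    moreover have "dep ((par ^^ dep x) x) = 0"
      using dep_funpow x BV by auto
    ultimately show False
      using dpos by (metis less_irrefl)
  qed
  then obtain b where b: "b \<in> B" "par b = v" by blast
  have bV: "b \<in> V" and db: "dep b = Suc (dep v)"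
    using b BV dep_par[of b] dpos[of b] by auto
  \<comment> \<open>The descendants of \<open>b\<close>. An arc that avoids \<open>v\<close> cannot
    leave this set, whose only exit is the arc from \<open>b\<close> to \<open>v\<close>.\<close>
  define below where "below = {x \<in> V. dep b \<le> dep x \<and> (par ^^ (dep x - dep b)) x = b}"
  have closed_below: "y \<in> below" if "x \<in> below" "(x, y) \<in> parcs G" "y \<noteq> v" for x y
    using that(2)
  proof (cases rule: arc_cases)
    case up
    then have "x \<noteq> b" using b that by auto
    then have "dep x \<noteq> dep b" using that(1) by (auto simp: below_def)
    then have "dep b \<le> dep y" "dep x - dep b = Suc (dep y - dep b)"
      using that(1) up by (auto simp: below_def)
    then show ?thesis
      using that(1) up by (auto simp: below_def funpow_swap1)
  next
    case down
    then have "dep y - dep b = Suc (dep x - dep b)"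
      using that(1) by (auto simp: below_def)
    then show ?thesis
      using that(1) down by (auto simp: below_def funpow_swap1)
  next
    case root
    then show ?thesis using that(1) db by (auto simp: below_def)
  qed
  have "y \<in> below" if "b \<rightarrow>\<^sup>*\<^bsub>D\<^esub> y" for y
  proof -
    from that have "(b, y) \<in> rtrancl_on (verts D) (arcs_ends D)"
      by (simp add: reachable_def)
    then show ?thesis
    proof (induction rule: rtrancl_on_induct)
      case base
      show ?case by (simp add: below_def bV)
    next
      case (step y z)
      then show ?case using closed_below[of y z] by (auto simp: ends)
    qed
  qed
  then have B_below: "B \<subseteq> below"
    using B(2)[OF b(1)] by blast
  have uniq: "r = b" if "r \<in> B" "(v, r) \<in> parcs G" for r
    using that(2)
  proof (cases rule: arc_cases)
    case up
    then show ?thesis using B_below that(1) db by (auto simp: below_def)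
  next
    case down
    then show ?thesis using B_below that(1) db by (auto simp: below_def)
  next
    case root
    then show ?thesis using dpos[OF that(1)] by simp
  qed
  have "(v, b) \<in> parcs G"
    using b bV v BV by (auto simp: arcs_iff)
  then have iff: "(v, r) \<in> parcs G \<longleftrightarrow> r = b" if "r \<in> B" for r
    using uniq that by blast
  have up': "par x \<in> B" if "x \<in> B" "x \<noteq> b" for x
  proof -
    have "(par x, x) \<in> parcs G"
      using up_arc[of x] that BV dpos[of x] by (auto simp: arcs_iff)
    then show ?thesis
      using up[OF that(1)] uniq[OF that(1)] that(2) by auto
  qed
  have down: "x \<in> B" if "x \<in> V" "dep x > 0" "par x \<in> B" for x
  proof -
    have "(par x, x) \<in> parcs G"
      using up_arc[OF that(1,2)] by (auto simp: arcs_iff)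
    \<comment> \<open>Otherwise the parent of \<open>v\<close> would be a descendant of the child
      \<open>b\<close> of \<open>v\<close>, contradicting the depths.\<close>
    moreover have "x \<noteq> v"
    proof
      assume "x = v"
      then have "dep b \<le> dep (par v)"
        using B_below that(3) by (auto simp: below_def)
      then show False using db dep_par[OF v] that(2) \<open>x = v\<close> by auto
    qed
    ultimately show ?thesis using closed[OF that(3)] by blast
  qed
  show thesis
    using that[OF b v] BV iff up' down by blast
qed

end

text \<open>\<open>B\<close> stays in place and \<open>f i\<close> for \<open>i < s\<close> are the
  additional copies. The map \<open>orig\<close> defined below folds \<open>H\<close> back onto
  \<open>G\<close>; it is compatible with the parent maps, and depths and functions are pulled back
  along it.\<close>

locale branch_copy = ptree +
  fixes v b :: 'a and B :: "'a set" and s :: nat and f :: "nat \<Rightarrow> 'a \<Rightarrow> 'a" and H :: "'a pair_pre_digraph"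
  assumes bB: "b \<in> B" and par_b: "par b = v" and vV: "v \<in> V" and BV: "B \<subseteq> V" and vB: "v \<notin> B"
    and dep_B: "\<And>x. x \<in> B \<Longrightarrow> dep x > 0"
    and par_B: "\<And>x. x \<in> B \<Longrightarrow> x \<noteq> b \<Longrightarrow> par x \<in> B"
    and child_B: "\<And>x. x \<in> V \<Longrightarrow> dep x > 0 \<Longrightarrow> par x \<in> B \<Longrightarrow> x \<in> B"
    and inj: "inj_on (\<lambda>(i, x). f i x) ({..<s} \<times> B)"
    and fresh: "\<And>i x. i < s \<Longrightarrow> x \<in> B \<Longrightarrow> f i x \<notin> V"
    and vertsH: "pverts H = V \<union> (\<Union>i<s. f i ` B)"
    and arcsH: "parcs H = parcs G \<union> (\<Union>i<s. map_prod (f i) (f i) ` (parcs G \<inter> B \<times> B))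
        \<union> (\<Union>i<s. {(v, f i b), (f i b, v)})"
begin

definition origin :: "'a \<Rightarrow> nat \<times> 'a" where
  "origin y = inv_into ({..<s} \<times> B) (\<lambda>(i, x). f i x) y"

definition orig :: "'a \<Rightarrow> 'a" where
  "orig y = (if y \<in> V then y else snd (origin y))"

definition parH :: "'a \<Rightarrow> 'a" where
  "parH y = (if y \<in> V then par y else if orig y = b then v else f (fst (origin y)) (par (orig y)))"

lemma origin_copy: "i < s \<Longrightarrow> x \<in> B \<Longrightarrow> origin (f i x) = (i, x)"
  unfolding origin_def using inv_into_f_f[OF inj, of "(i, x)"] by simp

lemma orig_copy [simp]: "i < s \<Longrightarrow> x \<in> B \<Longrightarrow> orig (f i x) = x"
  by (simp add: orig_def fresh origin_copy)

lemma orig_old [simp]: "x \<in> V \<Longrightarrow> orig x = x"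
  by (simp add: orig_def)

lemma parH_old [simp]: "x \<in> V \<Longrightarrow> parH x = par x"
  by (simp add: parH_def)

lemma parH_copy: "i < s \<Longrightarrow> x \<in> B \<Longrightarrow> parH (f i x) = (if x = b then v else f i (par x))"
  by (simp add: parH_def fresh origin_copy)

lemma copy_eq_iff [simp]:
  "i < s \<Longrightarrow> j < s \<Longrightarrow> x \<in> B \<Longrightarrow> y \<in> B \<Longrightarrow> f i x = f j y \<longleftrightarrow> i = j \<and> x = y"
  by (metis origin_copy Pair_inject)

lemma vert_cases:
  assumes "y \<in> pverts H"
  obtains (old) "y \<in> V" | (copy) i x where "i < s" "x \<in> B" "y = f i x"
  using assms vertsH by auto

lemma old_in: "x \<in> V \<Longrightarrow> x \<in> pverts H"
  by (simp add: vertsH)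

lemma copy_in: "i < s \<Longrightarrow> x \<in> B \<Longrightarrow> f i x \<in> pverts H"
  by (auto simp: vertsH)

lemma orig_in: "y \<in> pverts H \<Longrightarrow> orig y \<in> V"
  by (erule vert_cases) (use BV in auto)

lemma dep_root_old: "y \<in> pverts H \<Longrightarrow> dep (orig y) = 0 \<Longrightarrow> y \<in> V"
  by (metis dep_B less_irrefl orig_copy vert_cases)

lemma parH_copy_eq_copy:
  assumes "i < s" "j < s" "x \<in> B" "y \<in> B"
  shows "parH (f i x) = f j y \<longleftrightarrow> i = j \<and> par x = y"
proof (cases "x = b")
  case True
  then show ?thesis
    using assms fresh[of j y] vV vB par_b by (auto simp: parH_copy)
next
  case False
  then show ?thesis
    using assms par_B[of x] by (simp add: parH_copy)
qed

lemma parH_copy_eq_old: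
  assumes "i < s" "x \<in> B" "y \<in> V"
  shows "parH (f i x) = y \<longleftrightarrow> x = b \<and> y = v"
proof (cases "x = b")
  case True
  then show ?thesis
    using assms by (auto simp: parH_copy)
next
  case False
  then have "f i (par x) \<notin> V"
    using fresh par_B assms by blast
  then show ?thesis
    using False assms by (auto simp: parH_copy)
qed

lemma arcsH_iff:
  "(x, y) \<in> parcs H \<longleftrightarrow>
    x \<in> pverts H \<and> y \<in> pverts H \<and> x \<noteq> y \<and> (parH x = y \<or> parH y = x)"
proof -
  have sub: "x \<in> pverts H \<and> y \<in> pverts H" if "(x, y) \<in> parcs H"
    using that bB vV unfolding arcsH vertsH by (auto simp: arcs_iff)
  have "(x, y) \<in> parcs H \<longleftrightarrow> x \<noteq> y \<and> (parH x = y \<or> parH y = x)"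
    if x: "x \<in> pverts H" and y: "y \<in> pverts H"
    using x
  proof (cases rule: vert_cases)
    case xo: old
    show ?thesis using y
    proof (cases rule: vert_cases)
      case old
      then have "(x, y) \<in> parcs H \<longleftrightarrow> (x, y) \<in> parcs G"
        using xo fresh bB by (auto simp: arcsH)
      then show ?thesis using xo old by (simp add: arcs_iff)
    next
      case (copy j q)
      then have "(x, y) \<in> parcs H \<longleftrightarrow> x = v \<and> q = b"
        using xo fresh bB by (auto simp: arcsH arcs_iff)
      then show ?thesis
        using xo copy fresh[of j q] par_in[OF xo] by (auto simp: parH_copy_eq_old)
    qed
  next
    case xc: (copy i p)
    show ?thesis using y
    proof (cases rule: vert_cases)
      case old
      then have "(x, y) \<in> parcs H \<longleftrightarrow> y = v \<and> p = b"
        using xc fresh bB by (auto simp: arcsH arcs_iff)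
      then show ?thesis
        using xc old fresh[of i p] par_in[OF old] by (auto simp: parH_copy_eq_old)
    next
      case (copy j q)
      have "(x, y) \<notin> parcs G" "x \<noteq> v" "y \<noteq> v"
        using xc copy fresh vV by (auto simp: arcs_iff)
      moreover have "(f i p, f j q) \<in> map_prod (f l) (f l) ` S \<longleftrightarrow>
          (\<exists>p' q'. (p', q') \<in> S \<and> f i p = f l p' \<and> f j q = f l q')" for l S
        by (simp add: image_iff Bex_def split_paired_Ex)
      ultimately have "(x, y) \<in> parcs H \<longleftrightarrow>
          (\<exists>l<s. \<exists>p' q'. (p', q') \<in> parcs G \<inter> B \<times> B \<and> f i p = f l p' \<and> f j q = f l q')"
        using xc copy by (simp add: arcsH Bex_def)
      also have "\<dots> \<longleftrightarrow> i = j \<and> (p, q) \<in> parcs G"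
        using xc copy by auto
      finally have "(x, y) \<in> parcs H \<longleftrightarrow> i = j \<and> (p, q) \<in> parcs G" .
      then show ?thesis
        using xc copy BV by (auto simp: parH_copy_eq_copy arcs_iff)
    qed
  qed
  then show ?thesis using sub by blast
qed

lemma ptreeH: "ptree H parH (dep \<circ> orig)"
proof
  show "finite (pverts H)"
    unfolding vertsH using finite_verts BV finite_subset by blast
  show "parH y \<in> pverts H" if "y \<in> pverts H" for y
    using that
  proof (cases rule: vert_cases)
    case old
    then show ?thesis using par_in by (simp add: old_in)
  next
    case (copy i x)
    then show ?thesis using par_B vV by (auto simp: parH_copy old_in copy_in)
  qed
  show "(dep \<circ> orig) y = Suc ((dep \<circ> orig) (parH y))" if "y \<in> pverts H" "(dep \<circ> orig) y > 0" for y
    using that(1)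
  proof (cases rule: vert_cases)
    case old
    then show ?thesis using dep_par that(2) par_in by simp
  next
    case (copy i x)
    then show ?thesis
      using dep_par[of x] that(2) BV par_b vV par_B[of x] by (auto simp: parH_copy)
  qed
  show "(dep \<circ> orig) (parH r) = 0" "parH (parH r) = r" if "r \<in> pverts H" "(dep \<circ> orig) r = 0" for r
    using that dep_root_old[of r] par_in[of r] dep_par_root[of r] par_par_root[of r] by auto
  show "t = r \<or> t = parH r"
    if "r \<in> pverts H" "(dep \<circ> orig) r = 0" "t \<in> pverts H" "(dep \<circ> orig) t = 0" for r t
    using that dep_root_old[of r] dep_root_old[of t] roots[of r t] by auto
qed (rule arcsH_iff)

lemma children_old:
  assumes "y \<in> V" "y \<noteq> v"
  shows "children H parH (dep \<circ> orig) y = children G par dep y"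
proof -
  have "c \<in> V" if "c \<in> pverts H" "parH c = y" for c
    using that(1) by (cases rule: vert_cases) (use that assms parH_copy_eq_old in auto)
  then have "c \<in> children H parH (dep \<circ> orig) y \<longleftrightarrow> c \<in> children G par dep y" for c
    by (cases "c \<in> V") (auto simp add: children_def old_in)
  then show ?thesis
    by blast
qed

lemma children_v:
  "children H parH (dep \<circ> orig) v = children G par dep v \<union> (\<lambda>i. f i b) ` {..<s}"
proof (intro Set.set_eqI iffI)
  fix c assume "c \<in> children H parH (dep \<circ> orig) v"
  then have c: "c \<in> pverts H" "dep (orig c) > 0" "parH c = v"
    by (auto simp: children_def)
  from c(1) show "c \<in> children G par dep v \<union> (\<lambda>i. f i b) ` {..<s}"
  proof (cases rule: vert_cases)
    case old
    then show ?thesis using c by (simp add: children_def)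
  next
    case (copy i x)
    then show ?thesis using c parH_copy_eq_old[OF copy(1,2) vV] by auto
  qed
next
  fix c assume "c \<in> children G par dep v \<union> (\<lambda>i. f i b) ` {..<s}"
  then show "c \<in> children H parH (dep \<circ> orig) v"
  proof
    assume "c \<in> children G par dep v"
    then show ?thesis by (simp add: children_def old_in)
  next
    assume "c \<in> (\<lambda>i. f i b) ` {..<s}"
    then show ?thesis
      using bB dep_B[OF bB] by (auto simp: children_def copy_in parH_copy)
  qed
qed

lemma children_copy:
  assumes "i < s" "x \<in> B"
  shows "children H parH (dep \<circ> orig) (f i x) = f i ` children G par dep x"
proof -
  have "c \<in> f i ` children G par dep x"
    if c: "c \<in> children H parH (dep \<circ> orig) (f i x)" for c
  proof -
    have c': "c \<in> pverts H" "dep (orig c) > 0" "parH c = f i x"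
      using c by (auto simp: children_def)
    from c'(1) show ?thesis
    proof (cases rule: vert_cases)
      case old
      then show ?thesis using c'(3) par_in[OF old] fresh[OF assms] by auto
    next
      case (copy j y)
      then show ?thesis
        using c' assms BV by (auto simp: parH_copy_eq_copy children_def)
    qed
  qed
  moreover have "f i c \<in> children H parH (dep \<circ> orig) (f i x)" if "c \<in> children G par dep x" for c
    using that assms child_B[of c] by (auto simp: children_def copy_in parH_copy_eq_copy)
  ultimately show ?thesis by blast
qed

text \<open>The divisor is \<open>s + 1\<close> because the \<open>s\<close> copies join the
  original branch. At \<open>v\<close> the \<open>s + 1\<close> equal terms add up to
  \<open>w b / F b x\<close>, also at a zero of \<open>F b\<close>. At every other vertex
  \<open>orig\<close> maps the children bijectively to the children in \<open>G\<close>.\<close>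

lemma weightingH:
  assumes "weighting G par dep w F"
  shows "weighting H parH (dep \<circ> orig)
    (\<lambda>y. if orig y = b then w b / real (s + 1) else w (orig y)) (F \<circ> orig)"
  unfolding weighting_def
proof (intro conjI ballI impI)
  let ?w = "\<lambda>y. if orig y = b then w b / real (s + 1) else w (orig y)"
  have w: "\<And>c. c \<in> V \<Longrightarrow> dep c > 0 \<Longrightarrow> w c > 0"
    and F: "\<And>y. y \<in> V \<Longrightarrow> \<exists>\<alpha>. \<forall>x. F y x = x - \<alpha> - (\<Sum>c\<in>children G par dep y. w c / F c x)"
    using assms by (auto simp: weighting_def)
  show "?w c > 0" if "c \<in> pverts H" "(dep \<circ> orig) c > 0" for c
    using w[of b] w[of "orig c"] orig_in[OF that(1)] that(2) bB BV dep_B by auto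
  fix y assume y: "y \<in> pverts H"
  have b_ch: "b \<notin> children G par dep z" if "z \<noteq> v" for z
    using that par_b by (auto simp: children_def)
  have ch_V: "children G par dep z \<subseteq> V" for z
    by (auto simp: children_def)
  have sum: "(\<Sum>c\<in>children H parH (dep \<circ> orig) y. ?w c / (F \<circ> orig) c x)
      = (\<Sum>c\<in>children G par dep (orig y). w c / F c x)" for x
    using y
  proof (cases rule: vert_cases)
    case old
    show ?thesis
    proof (cases "y = v")
      case False
      then show ?thesis
        unfolding children_old[OF old False] using b_ch[OF False] ch_V[of y] old
        by (intro sum.cong) (auto simp: subset_iff)
    next
      case True
      have fin: "finite (children G par dep v)"
        using finite_verts by (simp add: children_def)
      have b: "b \<in> children G par dep v"
        using bB BV dep_B par_b by (auto simp: children_def)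
      define t where "t = (w b / real (s + 1)) / F b x"
      define R where "R = (\<Sum>c\<in>children G par dep v - {b}. w c / F c x)"
      have new: "(\<Sum>c\<in>(\<lambda>i. f i b) ` {..<s}. ?w c / (F \<circ> orig) c x) = (\<Sum>i<s. t)"
        using bB unfolding t_def by (subst sum.reindex) (auto simp: inj_on_def)
      have old: "(\<Sum>c\<in>children G par dep v. ?w c / (F \<circ> orig) c x) = t + R"
        unfolding sum.remove[OF fin b] t_def R_def using ch_V[of v] bB BV
        by (intro arg_cong2[where f = "(+)"] sum.cong) (auto simp: subset_iff)
      have "children G par dep v \<inter> (\<lambda>i. f i b) ` {..<s} = {}"
        using ch_V[of v] fresh bB by auto
      then have "(\<Sum>c\<in>children H parH (dep \<circ> orig) v. ?w c / (F \<circ> orig) c x) = (t + R) + (\<Sum>i<s. t)"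
        unfolding children_v using fin by (subst sum.union_disjoint) (simp_all only: old new finite_imageI finite_lessThan)
      also have "\<dots> = real (s + 1) * t + R"
        by (simp add: distrib_right)
      also have "real (s + 1) * t = w b / F b x"
        by (simp add: t_def)
      also have "w b / F b x + R = (\<Sum>c\<in>children G par dep v. w c / F c x)"
        using sum.remove[OF fin b, of "\<lambda>c. w c / F c x"] by (simp add: R_def)
      finally show ?thesis using True vV by (simp only: orig_old)
    qed
  next
    case (copy i z)
    have ch: "children G par dep z \<subseteq> B"
      using copy child_B by (auto simp: children_def)
    have "b \<notin> children G par dep z"
      using copy vB by (intro b_ch) auto
    moreover have "inj_on (f i) (children G par dep z)"
      using ch copy by (auto simp: inj_on_def subset_iff)
    ultimately show ?thesis
      unfolding copy(3) children_copy[OF copy(1,2)] using copy ch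
      by (subst sum.reindex) (auto intro!: sum.cong simp: subset_iff)
  qed
  show "\<exists>\<alpha>. \<forall>x. (F \<circ> orig) y x = x - \<alpha> - (\<Sum>c\<in>children H parH (dep \<circ> orig) y. ?w c / (F \<circ> orig) c x)"
    unfolding sum using F[OF orig_in[OF y]] by simp
qed

end

lemma realized_dp_CBD:
  assumes G: "realized d \<Lambda> G" and GH: "dp_CBD G H"
  shows "realized d \<Lambda> H"
proof -
  obtain par dep w F w0 where dt: "diam_tree G par dep d" and wt: "weighting G par dep w F"
    and w0: "w0 > 0"
    and nz: "\<And>v x. v \<in> pverts G \<Longrightarrow> dep v > 0 \<Longrightarrow> x \<notin> \<Lambda> \<Longrightarrow> F v x \<noteq> 0"
    and nzr: "\<And>r x. r \<in> pverts G \<Longrightarrow> dep r = 0 \<Longrightarrow> x \<notin> \<Lambda> \<Longrightarrow>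
      F r x * F (par r) x \<noteq> (if par r = r then 0 else w0\<^sup>2)"
    using G unfolding realized_def by blast
  interpret diam_tree G par dep d by (rule dt)
  obtain s v B where cbd: "is_CBD s v B G H" and main: "B \<inter> main_roots G = {}"
    using GH unfolding dp_CBD_def by blast
  then have br: "is_branch G v B"
    by (simp add: is_CBD_def)
  define is_copy where "is_copy f \<longleftrightarrow>
      inj_on (\<lambda>(i, x). f i x) ({..<s} \<times> B) \<and>
      (\<forall>i<s. f i ` B \<inter> pverts G = {}) \<and>
      pverts H = pverts G \<union> (\<Union>i<s. f i ` B) \<and>
      parcs H = parcs G
        \<union> (\<Union>i<s. map_prod (f i) (f i) ` (parcs G \<inter> B \<times> B))
        \<union> (\<Union>i<s. \<Union>r\<in>{r \<in> B. (v, r) \<in> parcs G}. {(v, f i r), (f i r, v)})" for f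
  have "\<exists>f. is_copy f"
    using cbd unfolding is_CBD_def is_copy_def by (rule conjunct2)
  then obtain f where "is_copy f" ..
  then have f: "inj_on (\<lambda>(i, x). f i x) ({..<s} \<times> B)" "\<forall>i<s. f i ` B \<inter> pverts G = {}"
      "pverts H = pverts G \<union> (\<Union>i<s. f i ` B)"
      "parcs H = parcs G
        \<union> (\<Union>i<s. map_prod (f i) (f i) ` (parcs G \<inter> B \<times> B))
        \<union> (\<Union>i<s. \<Union>r\<in>{r \<in> B. (v, r) \<in> parcs G}. {(v, f i r), (f i r, v)})"
    unfolding is_copy_def by simp_all
  have no_root: "dep x > 0" if "x \<in> B" "x \<in> V" for x
    using root_in_main_roots that main by (cases "dep x = 0") auto
  from br no_root obtain b where b: "b \<in> B" "par b = v" "v \<in> V" "B \<subseteq> V" "v \<notin> B"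
    "\<And>r. r \<in> B \<Longrightarrow> (v, r) \<in> parcs G \<longleftrightarrow> r = b"
    "\<And>x. x \<in> B \<Longrightarrow> x \<noteq> b \<Longrightarrow> par x \<in> B"
    "\<And>x. x \<in> V \<Longrightarrow> dep x > 0 \<Longrightarrow> par x \<in> B \<Longrightarrow> x \<in> B"
    by (rule branch_structure) blast+
  have rb: "{r \<in> B. (v, r) \<in> parcs G} = {b}"
    using b(1,6) by blast
  interpret bc: branch_copy G par dep v b B s f H
  proof unfold_locales
    show "b \<in> B" "par b = v" "v \<in> V" "B \<subseteq> V" "v \<notin> B"
      by (rule b(1-5))+
    show "dep x > 0" if "x \<in> B" for x
      using no_root that b(4) by blast
    show "f i x \<notin> V" if "i < s" "x \<in> B" for i x
      using f(2) that by blast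
    show "parcs H = parcs G \<union> (\<Union>i<s. map_prod (f i) (f i) ` (parcs G \<inter> B \<times> B))
        \<union> (\<Union>i<s. {(v, f i b), (f i b, v)})"
      using f(4) unfolding rb by simp
  qed (use b(7,8) f(1,3) in blast)+
  \<comment> \<open>Old vertices keep their ancestors, so the deep pair of \<open>G\<close> still
    witnesses the diameter of \<open>H\<close>.\<close>
  have pow: "(bc.parH ^^ i) x = (par ^^ i) x" if "x \<in> V" for i x
    using that by (induction i) (auto simp: funpow_par_in)
  obtain x y where xy: "x \<in> V" "y \<in> V" "dep x = d div 2" "dep y = d div 2"
      "(par ^^ ((d + 1) div 2 - 1)) x \<noteq> (par ^^ ((d + 1) div 2 - 1)) y"
    using deep_pair by blast
  interpret H: ptree H bc.parH "dep \<circ> bc.orig" by (rule bc.ptreeH)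
  have dtH: "diam_tree H bc.parH (dep \<circ> bc.orig) d"
  proof
    show "d \<ge> 1" by (rule d_pos)
    show "(dep \<circ> bc.orig) y \<le> d div 2" if "y \<in> pverts H" for y
      using dep_le bc.orig_in that by auto
    show "bc.parH r = r \<longleftrightarrow> even d" if "r \<in> pverts H" "(dep \<circ> bc.orig) r = 0" for r
      using that bc.dep_root_old[of r] par_root[of r] by auto
    show "\<exists>x\<in>pverts H. \<exists>y\<in>pverts H. (dep \<circ> bc.orig) x = d div 2 \<and> (dep \<circ> bc.orig) y = d div 2 \<and>
      (bc.parH ^^ ((d + 1) div 2 - 1)) x \<noteq> (bc.parH ^^ ((d + 1) div 2 - 1)) y"
      using xy by (intro bexI[of _ x] bexI[of _ y]) (auto simp: pow bc.old_in)
  qed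
  have nzH: "(F \<circ> bc.orig) y x \<noteq> 0" if "y \<in> pverts H" "(dep \<circ> bc.orig) y > 0" "x \<notin> \<Lambda>" for y x
    using nz[of "bc.orig y" x] bc.orig_in that by auto
  have nzrH: "(F \<circ> bc.orig) r x * (F \<circ> bc.orig) (bc.parH r) x \<noteq> (if bc.parH r = r then 0 else w0\<^sup>2)"
    if "r \<in> pverts H" "(dep \<circ> bc.orig) r = 0" "x \<notin> \<Lambda>" for r x
  proof -
    have "r \<in> V" "dep r = 0"
      using that bc.dep_root_old[of r] by auto
    then show ?thesis
      using nzr[of r x] par_in[of r] that(3) by simp
  qed
  show ?thesis
    unfolding realized_def
    by (intro exI[of _ bc.parH] exI[of _ "dep \<circ> bc.orig"] exI[of _ "F \<circ> bc.orig"] exI conjI ballI allI impI)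
      (rule dtH bc.weightingH[OF wt] w0 nzH nzrH; assumption)+
qed

section \<open>Isomorphisms and matrices\<close>

definition pair_iso :: "('a \<Rightarrow> 'b) \<Rightarrow> 'a pair_pre_digraph \<Rightarrow> 'b pair_pre_digraph \<Rightarrow> bool" where
  "pair_iso h G H \<longleftrightarrow>
    inj_on h (pverts G) \<and> pverts H = h ` pverts G \<and> parcs H = map_prod h h ` parcs G"

text \<open>Both graphs have \<open>fst\<close> and \<open>snd\<close> as tail and head, so the arc
  map of an isomorphism is determined by its vertex map. Inverting the vertex map requires the arcs
  of \<open>G\<close> to end in \<open>pverts G\<close>, which \<open>digraph_isomorphism\<close>
  provides.\<close>

lemma pair_iso_of_digraph_iso:
  assumes "digraph_iso (with_proj G) (with_proj H)"
  shows "\<exists>h. pair_iso h G H" and "\<exists>h. pair_iso h H G"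
proof -
  obtain m where m: "pre_digraph.digraph_isomorphism (with_proj G) m"
    and H: "with_proj H = app_iso m (with_proj G)"
    using assms by (auto simp: digraph_iso_def)
  define h where "h = iso_verts m"
  have wf: "\<And>x y. (x, y) \<in> parcs G \<Longrightarrow> x \<in> pverts G \<and> y \<in> pverts G"
    using m by (force simp: pre_digraph.digraph_isomorphism_def wf_digraph_def)
  have inj: "inj_on h (pverts G)"
    using m by (simp add: pre_digraph.digraph_isomorphism_def h_def)
  have verts: "pverts H = h ` pverts G"
    using arg_cong[OF H, of verts] by (simp add: h_def)
  have ht: "iso_tail m = fst" "iso_head m = snd"
    using arg_cong[OF H, of tail] arg_cong[OF H, of head] by simp_all
  have "iso_arcs m a = map_prod h h a" if "a \<in> parcs G" for a
    using m that ht by (auto simp: pre_digraph.digraph_isomorphism_def h_def prod_eq_iff)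
  then have arcs: "parcs H = map_prod h h ` parcs G"
    using arg_cong[OF H, of arcs] by simp
  show "\<exists>h. pair_iso h G H"
    using inj verts arcs by (auto simp: pair_iso_def)
  define g where "g = inv_into (pverts G) h"
  have gh: "g (h x) = x" if "x \<in> pverts G" for x
    using inj that by (simp add: g_def)
  have "pverts G = g ` pverts H"
    using gh by (force simp: verts)
  moreover have "map_prod g g ` map_prod h h ` parcs G = (\<lambda>a. a) ` parcs G"
    unfolding image_image by (rule image_cong) (use gh wf in \<open>auto simp: map_prod_def split_beta\<close>)
  moreover have "inj_on g (pverts H)"
    unfolding g_def verts by (rule inj_on_inv_into) simp
  ultimately show "\<exists>h. pair_iso h H G"
    unfolding pair_iso_def arcs by (intro exI[of _ g]) auto
qed

lemma digraph_iso_of_pair_iso: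
  assumes h: "pair_iso h G H" and wf: "\<And>x y. (x, y) \<in> parcs G \<Longrightarrow> x \<in> pverts G \<and> y \<in> pverts G"
  shows "digraph_iso (with_proj G) (with_proj H)"
proof -
  let ?m = "\<lparr> iso_verts = h, iso_arcs = map_prod h h, iso_head = snd, iso_tail = fst \<rparr>"
  have inj: "inj_on h (pverts G)"
    using h by (simp add: pair_iso_def)
  have "inj_on (map_prod h h) (parcs G)"
    using map_prod_inj_on[OF inj inj] by (rule inj_on_subset) (use wf in auto)
  moreover have "wf_digraph (with_proj G)"
    by unfold_locales (use wf in auto)
  ultimately have "pre_digraph.digraph_isomorphism (with_proj G) ?m"
    using inj by (simp add: pre_digraph.digraph_isomorphism_def)
  moreover have "with_proj H = app_iso ?m (with_proj G)"
    using h by (simp add: pair_iso_def app_iso_def with_proj_def)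
  ultimately show ?thesis
    unfolding digraph_iso_def by blast
qed

locale ptree_transport = ptree +
  fixes h :: "'a \<Rightarrow> 'b" and H :: "'b pair_pre_digraph"
  assumes iso: "pair_iso h G H"
begin

definition src :: "'b \<Rightarrow> 'a" where
  "src = inv_into V h"

definition parT :: "'b \<Rightarrow> 'b" where
  "parT = h \<circ> par \<circ> src"

lemma inj_h: "inj_on h V" and vertsT: "pverts H = h ` V" and arcsT: "parcs H = map_prod h h ` parcs G"
  using iso by (auto simp: pair_iso_def)

lemma src_h [simp]: "x \<in> V \<Longrightarrow> src (h x) = x"
  by (simp add: src_def inj_h)

lemma h_eq_iff [simp]: "x \<in> V \<Longrightarrow> y \<in> V \<Longrightarrow> h x = h y \<longleftrightarrow> x = y"
  using inj_h by (auto dest: inj_onD)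

lemma parT_h [simp]: "x \<in> V \<Longrightarrow> parT (h x) = h (par x)"
  by (simp add: parT_def)

lemma vertT_cases: 
  assumes "y \<in> pverts H"
  obtains x where "x \<in> V" "y = h x"
  using assms by (auto simp: vertsT)

lemma arcsT_iff:
  assumes "x \<in> V" "y \<in> V"
  shows "(h x, h y) \<in> parcs H \<longleftrightarrow> (x, y) \<in> parcs G"
proof
  assume "(h x, h y) \<in> parcs H"
  then obtain p q where "(p, q) \<in> parcs G" "h x = h p" "h y = h q"
    by (auto simp: arcsT)
  then show "(x, y) \<in> parcs G"
    using assms by (auto simp: arcs_iff)
next
  assume "(x, y) \<in> parcs G"
  then show "(h x, h y) \<in> parcs H"
    unfolding arcsT by (rule map_prod_imageI)
qed

lemma ptreeT: "ptree H parT (dep \<circ> src)"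
proof
  show "finite (pverts H)"
    unfolding vertsT using finite_verts by simp
  show "parT y \<in> pverts H" if "y \<in> pverts H" for y
    using that by (elim vertT_cases) (simp add: vertsT par_in)
  show "(dep \<circ> src) y = Suc ((dep \<circ> src) (parT y))" if "y \<in> pverts H" "(dep \<circ> src) y > 0" for y
    using that(1)
  proof (cases rule: vertT_cases)
    case (1 x)
    then show ?thesis using that(2) dep_par[of x] par_in[of x] by simp
  qed
  show "(dep \<circ> src) (parT r) = 0" "parT (parT r) = r" if r: "r \<in> pverts H" "(dep \<circ> src) r = 0" for r
  proof -
    obtain x where "x \<in> V" "r = h x" using r(1) by (rule vertT_cases)
    then show "(dep \<circ> src) (parT r) = 0" "parT (parT r) = r"
      using r(2) dep_par_root[of x] par_par_root[of x] par_in[of x] by simp_all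
  qed
  show "t = r \<or> t = parT r"
    if rt: "r \<in> pverts H" "(dep \<circ> src) r = 0" "t \<in> pverts H" "(dep \<circ> src) t = 0" for r t
  proof -
    obtain x where "x \<in> V" "r = h x" using rt(1) by (rule vertT_cases)
    moreover obtain y where "y \<in> V" "t = h y" using rt(3) by (rule vertT_cases)
    ultimately show ?thesis
      using rt(2,4) roots[of x y] by auto
  qed
  show "(x, y) \<in> parcs H \<longleftrightarrow>
    x \<in> pverts H \<and> y \<in> pverts H \<and> x \<noteq> y \<and> (parT x = y \<or> parT y = x)" for x y
  proof (cases "x \<in> pverts H \<and> y \<in> pverts H")
    case True
    obtain p where "p \<in> V" "x = h p" using True by (blast elim: vertT_cases)
    moreover obtain q where "q \<in> V" "y = h q" using True by (blast elim: vertT_cases)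
    ultimately show ?thesis
      using True par_in[of p] par_in[of q] by (simp add: arcsT_iff arcs_iff)
  next
    case False
    then show ?thesis by (auto simp: arcsT vertsT arcs_iff)
  qed
qed

lemma children_transport:
  assumes "x \<in> V"
  shows "children H parT (dep \<circ> src) (h x) = h ` children G par dep x"
proof (intro Set.set_eqI iffI)
  fix c assume "c \<in> children H parT (dep \<circ> src) (h x)"
  then have c: "c \<in> pverts H" "dep (src c) > 0" "parT c = h x"
    by (auto simp: children_def)
  obtain y where "y \<in> V" "c = h y" using c(1) by (rule vertT_cases)
  then show "c \<in> h ` children G par dep x"
    using c assms par_in[of y] by (simp add: children_def)
next
  fix c assume "c \<in> h ` children G par dep x"
  then obtain y where "c = h y" "y \<in> V" "dep y > 0" "par y = x"
    by (auto simp: children_def)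
  then show "c \<in> children H parT (dep \<circ> src) (h x)"
    by (simp add: children_def vertsT)
qed

lemma weighting_transport:
  assumes "weighting G par dep w F"
  shows "weighting H parT (dep \<circ> src) (w \<circ> src) (F \<circ> src)"
  unfolding weighting_def
proof (intro conjI ballI impI)
  have w: "\<And>c. c \<in> V \<Longrightarrow> dep c > 0 \<Longrightarrow> w c > 0"
    and F: "\<And>y. y \<in> V \<Longrightarrow> \<exists>\<alpha>. \<forall>x. F y x = x - \<alpha> - (\<Sum>c\<in>children G par dep y. w c / F c x)"
    using assms by (auto simp: weighting_def)
  show "(w \<circ> src) c > 0" if "c \<in> pverts H" "(dep \<circ> src) c > 0" for c
    using that w by (elim vertT_cases) simp
  fix y assume "y \<in> pverts H"
  then obtain z where z: "z \<in> V" "y = h z" by (rule vertT_cases)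
  have sub: "children G par dep z \<subseteq> V"
    by (auto simp: children_def)
  have "(\<Sum>c\<in>children H parT (dep \<circ> src) y. (w \<circ> src) c / (F \<circ> src) c x)
      = (\<Sum>c\<in>children G par dep z. w c / F c x)" for x
    unfolding z(2) children_transport[OF z(1)]
    using sub inj_on_subset[OF inj_h sub]
    by (subst sum.reindex) (auto intro!: sum.cong simp: subset_iff)
  then show "\<exists>\<alpha>. \<forall>x. (F \<circ> src) y x =
      x - \<alpha> - (\<Sum>c\<in>children H parT (dep \<circ> src) y. (w \<circ> src) c / (F \<circ> src) c x)"
    using F[OF z(1)] z by simp
qed

end

lemma realized_pair_iso:
  assumes G: "realized d \<Lambda> G" and h: "pair_iso h G H"
  shows "realized d \<Lambda> H"
proof -
  obtain par dep w F w0 where dt: "diam_tree G par dep d" and wt: "weighting G par dep w F"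
    and w0: "w0 > 0"
    and nz: "\<And>v x. v \<in> pverts G \<Longrightarrow> dep v > 0 \<Longrightarrow> x \<notin> \<Lambda> \<Longrightarrow> F v x \<noteq> 0"
    and nzr: "\<And>r x. r \<in> pverts G \<Longrightarrow> dep r = 0 \<Longrightarrow> x \<notin> \<Lambda> \<Longrightarrow>
      F r x * F (par r) x \<noteq> (if par r = r then 0 else w0\<^sup>2)"
    using G unfolding realized_def by blast
  interpret diam_tree G par dep d by (rule dt)
  interpret t: ptree_transport G par dep h H by unfold_locales (rule h)
  have pow: "(t.parT ^^ i) (h x) = h ((par ^^ i) x)" if "x \<in> V" for i x
    using that by (induction i) (auto simp: funpow_par_in)
  obtain x y where xy: "x \<in> V" "y \<in> V" "dep x = d div 2" "dep y = d div 2"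
      "(par ^^ ((d + 1) div 2 - 1)) x \<noteq> (par ^^ ((d + 1) div 2 - 1)) y"
    using deep_pair by blast
  interpret H: ptree H t.parT "dep \<circ> t.src" by (rule t.ptreeT)
  have dtH: "diam_tree H t.parT (dep \<circ> t.src) d"
  proof
    show "d \<ge> 1" by (rule d_pos)
    show "(dep \<circ> t.src) y \<le> d div 2" if "y \<in> pverts H" for y
      using that dep_le by (elim t.vertT_cases) simp
    show "t.parT r = r \<longleftrightarrow> even d" if r: "r \<in> pverts H" "(dep \<circ> t.src) r = 0" for r
    proof -
      obtain z where "z \<in> V" "r = h z" using r(1) by (rule t.vertT_cases)
      then show ?thesis using r(2) par_root[of z] par_in[of z] by simp
    qed
    show "\<exists>x\<in>pverts H. \<exists>y\<in>pverts H. (dep \<circ> t.src) x = d div 2 \<and> (dep \<circ> t.src) y = d div 2 \<and>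
      (t.parT ^^ ((d + 1) div 2 - 1)) x \<noteq> (t.parT ^^ ((d + 1) div 2 - 1)) y"
      using xy by (intro bexI[of _ "h x"] bexI[of _ "h y"]) (simp_all add: pow t.vertsT funpow_par_in)
  qed
  have nzH: "(F \<circ> t.src) y x \<noteq> 0" if "y \<in> pverts H" "(dep \<circ> t.src) y > 0" "x \<notin> \<Lambda>" for y x
    using that nz by (elim t.vertT_cases) simp
  have nzrH: "(F \<circ> t.src) r x * (F \<circ> t.src) (t.parT r) x \<noteq> (if t.parT r = r then 0 else w0\<^sup>2)"
    if r: "r \<in> pverts H" "(dep \<circ> t.src) r = 0" "x \<notin> \<Lambda>" for r x
  proof -
    obtain z where "z \<in> V" "r = h z" using r(1) by (rule t.vertT_cases)
    then show ?thesis using r(2,3) nzr[of z x] par_in[of z] by simp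
  qed
  show ?thesis
    unfolding realized_def
    by (intro exI[of _ t.parT] exI[of _ "dep \<circ> t.src"] exI[of _ "F \<circ> t.src"] exI conjI ballI allI impI)
      (rule dtH t.weighting_transport[OF wt] w0 nzH nzrH; assumption)+
qed

section \<open>The matrix of a weighted tree and elimination\<close>

locale weighted_ptree = ptree +
  fixes w :: "'a \<Rightarrow> real" and F :: "'a \<Rightarrow> real \<Rightarrow> real" and w0 :: real and \<alpha> :: "'a \<Rightarrow> real"
  assumes w_pos: "\<And>c. c \<in> V \<Longrightarrow> dep c > 0 \<Longrightarrow> w c > 0"
    and F_eq: "\<And>v x. v \<in> V \<Longrightarrow> F v x = x - \<alpha> v - (\<Sum>c\<in>children G par dep v. w c / F c x)"
    and w0_pos: "w0 > 0"
begin

text \<open>The cases are summed, not nested, so that a row sum splits into four sums of simple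
  support.\<close>

definition entry :: "'a \<Rightarrow> 'a \<Rightarrow> real" where
  "entry x y = (if x = y then \<alpha> x else 0) + (if x \<in> children G par dep y then sqrt (w x) else 0)
    + (if y \<in> children G par dep x then sqrt (w y) else 0)
    + (if x \<noteq> y \<and> dep x = 0 \<and> dep y = 0 then w0 else 0)"

lemma entry_sym: "entry x y = entry y x"
  by (auto simp: entry_def)

lemma entry_nonzero_iff:
  assumes "x \<in> V" "y \<in> V" "x \<noteq> y"
  shows "entry x y \<noteq> 0 \<longleftrightarrow> (x, y) \<in> parcs G"
proof
  assume "(x, y) \<in> parcs G"
  then show "entry x y \<noteq> 0"
  proof (cases rule: arc_cases)
    case up
    then have "sqrt (w x) > 0" "x \<in> children G par dep y" "y \<notin> children G par dep x"
      using w_pos[of x] dep_par[of y] by (auto simp: children_def)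
    then show ?thesis using assms up by (simp add: entry_def)
  next
    case down
    then have "sqrt (w y) > 0" "y \<in> children G par dep x" "x \<notin> children G par dep y"
      using w_pos[of y] dep_par[of x] by (auto simp: children_def)
    then show ?thesis using assms down by (simp add: entry_def)
  next
    case root
    then show ?thesis using w0_pos by (simp add: entry_def children_def)
  qed
next
  assume "entry x y \<noteq> 0"
  then consider "x \<in> children G par dep y" | "y \<in> children G par dep x" | "dep x = 0" "dep y = 0"
    using assms by (auto simp: entry_def split: if_splits)
  then show "(x, y) \<in> parcs G"
  proof cases
    case 3
    then show ?thesis using roots[of x y] assms by (auto simp: arcs_iff)
  qed (use assms in \<open>auto simp: children_def arcs_iff\<close>)
qed

definition upward :: "('a \<Rightarrow> real) \<Rightarrow> 'a \<Rightarrow> real" where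
  "upward u x = (if dep x > 0 then sqrt (w x) * u (par x) else if par x = x then 0 else w0 * u (par x))"

lemma entry_row_sum:
  assumes x: "x \<in> V"
  shows "(\<Sum>y\<in>V. entry x y * u y)
    = \<alpha> x * u x + upward u x + (\<Sum>c\<in>children G par dep x. sqrt (w c) * u c)"
proof -
  have "(\<Sum>y\<in>V. entry x y * u y)
    = (\<Sum>y\<in>V. (if x = y then \<alpha> x * u y else 0) + (if x \<in> children G par dep y then sqrt (w x) * u y else 0)
      + (if y \<in> children G par dep x then sqrt (w y) * u y else 0)
      + (if x \<noteq> y \<and> dep x = 0 \<and> dep y = 0 then w0 * u y else 0))"
    by (intro sum.cong refl) (simp add: entry_def distrib_right)
  also have "\<dots> = (\<Sum>y\<in>V. if x = y then \<alpha> x * u y else 0)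
    + (\<Sum>y\<in>V. if x \<in> children G par dep y then sqrt (w x) * u y else 0)
    + (\<Sum>y\<in>V. if y \<in> children G par dep x then sqrt (w y) * u y else 0)
    + (\<Sum>y\<in>V. if x \<noteq> y \<and> dep x = 0 \<and> dep y = 0 then w0 * u y else 0)"
    by (simp only: sum.distrib)
  also have "(\<Sum>y\<in>V. if x = y then \<alpha> x * u y else 0) = \<alpha> x * u x"
    using x finite_verts by simp
  also have "(\<Sum>y\<in>V. if x \<in> children G par dep y then sqrt (w x) * u y else 0)
      = (\<Sum>y\<in>V. if par x = y then (if dep x > 0 then sqrt (w x) * u y else 0) else 0)"
    using x by (intro sum.cong) (auto simp: children_def)
  also have "\<dots> = (if dep x > 0 then sqrt (w x) * u (par x) else 0)"
    using par_in[OF x] finite_verts by simp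
  also have "(\<Sum>y\<in>V. if y \<in> children G par dep x then sqrt (w y) * u y else 0)
      = (\<Sum>c\<in>children G par dep x. sqrt (w c) * u c)"
    using finite_verts by (intro sum.mono_neutral_cong_right) (auto simp: children_def)
  also have "(\<Sum>y\<in>V. if x \<noteq> y \<and> dep x = 0 \<and> dep y = 0 then w0 * u y else 0)
      = (\<Sum>y\<in>V. if par x = y then (if dep x = 0 \<and> par x \<noteq> x then w0 * u y else 0) else 0)"
    using x roots[of x] dep_par_root[of x] by (intro sum.cong) auto
  also have "\<dots> = (if dep x = 0 \<and> par x \<noteq> x then w0 * u (par x) else 0)"
    using par_in[OF x] finite_verts by simp
  finally show ?thesis
    by (simp add: upward_def)
qed

text \<open>Gaussian elimination from the leaves to the centre.\<close>

lemma eigenvector_zero: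
  assumes nz: "\<And>v. v \<in> V \<Longrightarrow> dep v > 0 \<Longrightarrow> F v x \<noteq> 0"
    and nzr: "\<And>r. r \<in> V \<Longrightarrow> dep r = 0 \<Longrightarrow>
      F r x * F (par r) x \<noteq> (if par r = r then 0 else w0\<^sup>2)"
    and eig: "\<And>v. v \<in> V \<Longrightarrow> (\<Sum>y\<in>V. entry v y * u y) = x * u v"
    and v: "v \<in> V"
  shows "u v = 0"
proof -
  define m where "m = Max (dep ` V)"
  have le: "dep y \<le> m" if "y \<in> V" for y
    using that finite_verts by (simp add: m_def)
  have elim: "F y x * u y = upward u y" if "y \<in> V" for y
    using that
  proof (induction "m - dep y" arbitrary: y rule: less_induct)
    case less
    have "sqrt (w c) * u c = w c / F c x * u y" if c: "c \<in> children G par dep y" for c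
    proof -
      have c': "c \<in> V" "dep c > 0" "par c = y"
        using c by (auto simp: children_def)
      then have "m - dep c < m - dep y"
        using le[of c] dep_par[of c] by auto
      then have "F c x * u c = sqrt (w c) * u y"
        using less.hyps[of c] c' by (simp add: upward_def)
      then have "u c = sqrt (w c) * u y / F c x"
        using nz[of c] c' by (simp add: field_simps)
      then show ?thesis
        using w_pos[of c] c' by simp
    qed
    then have "(\<Sum>c\<in>children G par dep y. sqrt (w c) * u c)
        = (\<Sum>c\<in>children G par dep y. w c / F c x) * u y"
      by (simp add: sum_distrib_right)
    then have "\<alpha> y * u y + upward u y + (\<Sum>c\<in>children G par dep y. w c / F c x) * u y = x * u y"
      using eig[OF less.prems] entry_row_sum[OF less.prems, of u] by simp
    then show ?case
      unfolding F_eq[OF less.prems] by (simp add: algebra_simps)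
  qed
  have root: "u r = 0" if r: "r \<in> V" "dep r = 0" for r
  proof (cases "par r = r")
    case True
    then have "F r x * u r = 0"
      using elim[OF r(1)] r by (simp add: upward_def)
    then show ?thesis
      using nzr[OF r] True by simp
  next
    case False
    have 1: "F r x * u r = w0 * u (par r)"
      using elim[OF r(1)] r False by (simp add: upward_def)
    have 2: "F (par r) x * u (par r) = w0 * u r"
      using elim[OF par_in[OF r(1)]] dep_par_root[OF r] par_par_root[OF r] False by (simp add: upward_def)
    \<comment> \<open>The two equations at the main edge form a 2 by 2 system with determinant
      \<open>F r x * F (par r) x - w0^2\<close>.\<close>
    have "F r x * F (par r) x * u r = F (par r) x * (w0 * u (par r))"
      using 1 by (simp add: mult_ac)
    also have "\<dots> = w0\<^sup>2 * u r"
      using 2 by (simp add: power2_eq_square mult_ac)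
    finally have "(F r x * F (par r) x - w0\<^sup>2) * u r = 0"
      by (simp add: left_diff_distrib)
    then show ?thesis
      using nzr[OF r] False by simp
  qed
  \<comment> \<open>Back substitution from the centre to the leaves: once the value at the parent is
    zero, \<open>F v x * u v = 0\<close>.\<close>
  show ?thesis
    using v
  proof (induction "dep v" arbitrary: v)
    case 0
    then show ?case using root by simp
  next
    case (Suc k)
    then have "u (par v) = 0"
      using dep_par[of v] par_in[of v] by simp
    then have "F v x * u v = 0"
      using elim[OF Suc.prems] Suc.hyps(2) by (simp add: upward_def)
    then show ?case
      using nz[of v] Suc by simp
  qed
qed

end

text \<open>Outside \<open>\<Lambda>\<close> the elimination forces every solution to vanish, so
  there is no eigenvector. The vertex set \<open>{0..<n}\<close> makes the underlying graph equal to
  \<open>G\<close>, not merely isomorphic.\<close>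

lemma realized_matrix_exists:
  assumes G: "realized d \<Lambda> G" and V: "pverts G = {0..<n}"
  shows "\<exists>M. square_mat M \<and> transpose_mat M = M \<and> underlying_graph M = G \<and> spectrum M \<subseteq> \<Lambda>"
proof -
  obtain par dep w F w0 where dt: "diam_tree G par dep d" and wt: "weighting G par dep w F"
    and w0: "w0 > 0"
    and nz: "\<And>v x. v \<in> pverts G \<Longrightarrow> dep v > 0 \<Longrightarrow> x \<notin> \<Lambda> \<Longrightarrow> F v x \<noteq> 0"
    and nzr: "\<And>r x. r \<in> pverts G \<Longrightarrow> dep r = 0 \<Longrightarrow> x \<notin> \<Lambda> \<Longrightarrow>
      F r x * F (par r) x \<noteq> (if par r = r then 0 else w0\<^sup>2)"
    using G unfolding realized_def by blast
  have "\<forall>v\<in>pverts G. \<exists>\<alpha>. \<forall>x. F v x = x - \<alpha> - (\<Sum>c\<in>children G par dep v. w c / F c x)"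
    using wt by (simp add: weighting_def)
  then obtain \<alpha> where \<alpha>: "\<forall>v\<in>pverts G. \<forall>x. F v x = x - \<alpha> v - (\<Sum>c\<in>children G par dep v. w c / F c x)"
    by (rule bchoice[THEN exE])
  interpret diam_tree G par dep d by (rule dt)
  interpret weighted_ptree G par dep w F w0 \<alpha>
    using wt \<alpha> w0 by unfold_locales (auto simp: weighting_def)
  define M where "M = mat n n (\<lambda>(i, j). entry i j)"
  have M: "M \<in> carrier_mat n n"
    by (simp add: M_def)
  have "transpose_mat M = M"
    by (rule eq_matI) (auto simp: M_def entry_sym)
  moreover have "(x, y) \<in> parcs (underlying_graph M) \<longleftrightarrow> (x, y) \<in> parcs G" for x y
  proof (cases "x < n \<and> y < n \<and> x \<noteq> y")
    case True
    then show ?thesis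
      using entry_nonzero_iff[of x y] V by (simp add: underlying_graph_def M_def)
  next
    case False
    then show ?thesis
      using V by (auto simp: underlying_graph_def M_def arcs_iff)
  qed
  then have "parcs (underlying_graph M) = parcs G"
    by auto
  then have "underlying_graph M = G"
    using V by (simp add: underlying_graph_def M_def)
  moreover have "spectrum M \<subseteq> \<Lambda>"
  proof
    fix \<mu> assume "\<mu> \<in> spectrum M"
    then obtain v x where x: "x < n" "v x \<noteq> 0"
      and v: "\<And>x. x < n \<Longrightarrow> (\<Sum>y<n. M $$ (x, y) * v y) = \<mu> * v x"
      unfolding spectrum_eq_eigs[OF M] by blast
    show "\<mu> \<in> \<Lambda>"
    proof (rule ccontr)
      assume \<mu>: "\<mu> \<notin> \<Lambda>"
      have "(\<Sum>y\<in>V. entry z y * v y) = \<mu> * v z" if "z \<in> V" for z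
        using v[of z] that V by (simp add: M_def lessThan_atLeast0)
      then have "v x = 0"
        using eigenvector_zero[of \<mu> v x] nz nzr \<mu> x V by auto
      then show False using x by simp
    qed
  qed
  ultimately show ?thesis
    using M by (intro exI[of _ M]) simp
qed

lemma card_spectrum_ge:
  assumes real: "realized d \<Lambda> (underlying_graph M)" and sq: "square_mat M" and tr: "transpose_mat M = M"
  shows "d + 1 \<le> card (spectrum M)"
proof -
  define n where "n = dim_row M"
  have M: "M \<in> carrier_mat n n"
    using sq by (intro carrier_matI) (simp_all add: n_def)
  have sym: "M $$ (x, y) = M $$ (y, x)" if "x < n" "y < n" for x y
    using arg_cong[OF tr, of "\<lambda>N. N $$ (x, y)"] M that by simp
  interpret symmetric_op n "\<lambda>i j. M $$ (i, j)"
    by unfold_locales (rule sym)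
  obtain par dep where "diam_tree (underlying_graph M) par dep d"
    using real unfolding realized_def by blast
  then interpret diam_tree "underlying_graph M" par dep d .
  have V: "V = {0..<n}"
    by (simp add: underlying_graph_def n_def)
  have adj: "(x, y) \<in> parcs (underlying_graph M) \<longleftrightarrow> x < n \<and> y < n \<and> x \<noteq> y \<and> M $$ (x, y) \<noteq> 0" for x y
    by (simp add: underlying_graph_def n_def)
  have eigs: "eigs = spectrum M"
    unfolding eigs_def spectrum_eq_eigs[OF M] ..
  have "d + 1 \<le> card eigs"
  proof (rule card_eigs_ge)
    show "level y = 0 \<longleftrightarrow> y = tip1" if "y < n" for y
      using level_eq_0_iff that V by simp
    show "\<exists>z<n. M $$ (y, z) \<noteq> 0 \<and> Suc (level z) = level y \<and>
        (\<forall>z'<n. z' \<noteq> z \<longrightarrow> M $$ (y, z') \<noteq> 0 \<longrightarrow> level y \<le> level z')" if y: "y < n" "level y > 0" for y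
    proof -
      obtain z where z: "z \<in> V" "(y, z) \<in> parcs (underlying_graph M)" "Suc (level z) = level y"
        "\<forall>z'. z' \<noteq> z \<longrightarrow> (y, z') \<in> parcs (underlying_graph M) \<longrightarrow> level y \<le> level z'"
        using unique_lower_neighbour[of y] y V by auto
      have "level y \<le> level z'" if "z' < n" "z' \<noteq> z" "M $$ (y, z') \<noteq> 0" for z'
        using z(4) that \<open>y < n\<close> by (cases "z' = y") (auto simp: adj)
      then show ?thesis
        using z(1,2,3) V by (intro exI[of _ z]) (auto simp: adj)
    qed
    show "tip1 < n" "tip2 < n"
      using tips(1,3) V by auto
    show "level tip2 = d"
      by (rule level_tip2)
    show "finite eigs"
      unfolding eigs by (rule card_finite_spectrum[OF M])
  qed
  then show ?thesis
    by (simp add: eigs)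
qed

text \<open>The lower bound applies to every matrix of \<open>T\<close>, since
  \<open>realized\<close> passes to its underlying graph. For the matching matrix, \<open>T\<close>
  is renumbered by \<open>{0..<n}\<close>; the spectrum then lies in \<open>\<Lambda>\<close>, and
  the two bounds meet.\<close>

lemma q_tree_realized:
  assumes T: "realized d \<Lambda> T" and \<Lambda>: "finite \<Lambda>" "card \<Lambda> \<le> d + 1"
  shows "q_tree T = d + 1"
proof -
  have lower: "d + 1 \<le> card (spectrum M)" if "M \<in> sym_mats T" for M
  proof -
    have M: "square_mat M" "transpose_mat M = M"
      and iso: "digraph_iso (with_proj (underlying_graph M)) (with_proj T)"
      using that by (auto simp: sym_mats_def)
    obtain h where "pair_iso h T (underlying_graph M)"
      using pair_iso_of_digraph_iso(2)[OF iso] by blast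
    then have "realized d \<Lambda> (underlying_graph M)"
      using realized_pair_iso[OF T] by blast
    then show ?thesis
      using card_spectrum_ge M by blast
  qed
  have fin: "finite (pverts T)"
    using T unfolding realized_def diam_tree_def ptree_def by blast
  define n where "n = card (pverts T)"
  obtain g where g: "bij_betw g {0..<n} (pverts T)"
    using ex_bij_betw_nat_finite[OF fin] n_def by blast
  define h where "h = inv_into {0..<n} g"
  have h: "bij_betw h (pverts T) {0..<n}"
    unfolding h_def by (rule bij_betw_inv_into[OF g])
  define G where "G = \<lparr> pverts = {0..<n}, parcs = map_prod h h ` parcs T \<rparr>"
  have hG: "pair_iso h T G"
    using h by (auto simp: pair_iso_def G_def bij_betw_def)
  obtain M where M: "square_mat M" "transpose_mat M = M" "underlying_graph M = G" "spectrum M \<subseteq> \<Lambda>"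
    using realized_matrix_exists[OF realized_pair_iso[OF T hG], of n] by (auto simp: G_def)
  have wfT: "x \<in> pverts T \<and> y \<in> pverts T" if "(x, y) \<in> parcs T" for x y
    using T that unfolding realized_def diam_tree_def ptree_def by blast
  have "digraph_iso (with_proj T) (with_proj G)"
    by (rule digraph_iso_of_pair_iso[OF hG wfT])
  then obtain g' where g': "pair_iso g' G T"
    using pair_iso_of_digraph_iso(2) by blast
  have "digraph_iso (with_proj G) (with_proj T)"
    by (rule digraph_iso_of_pair_iso[OF g']) (use wfT h in \<open>auto simp: G_def bij_betw_def\<close>)
  then have MT: "M \<in> sym_mats T"
    using M by (simp add: sym_mats_def)
  moreover have "card (spectrum M) = d + 1"
    using lower[OF MT] card_mono[OF \<Lambda>(1) M(4)] \<Lambda>(2) by simp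
  ultimately have "\<exists>M\<in>sym_mats T. d + 1 = card (spectrum M)"
    by metis
  then show ?thesis
    unfolding q_tree_def using lower by (intro Least_equality) blast+
qed

lemma q_tree_unfoldings:
  assumes S: "realized d \<Lambda> (fst S)" and \<Lambda>: "finite \<Lambda>" "card \<Lambda> \<le> d + 1" and T: "T \<in> unfoldings S"
  shows "q_tree T = d + 1"
proof -
  obtain G where G: "dp_CBD\<^sup>*\<^sup>* (fst S) G" and iso: "digraph_iso (with_proj G) (with_proj T)"
    using T by (auto simp: unfoldings_def)
  from G have "realized d \<Lambda> G"
    by (induction rule: rtranclp_induct) (auto intro: S realized_dp_CBD)
  moreover obtain h where "pair_iso h G T"
    using pair_iso_of_digraph_iso(1)[OF iso] by blast
  ultimately show ?thesis
    using q_tree_realized \<Lambda> realized_pair_iso by blast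
qed

section \<open>Gluing rooted trees\<close>

text \<open>A tree prepared for gluing, with height \<open>k\<close> and root function
  \<open>f\<close>. The zeros of \<open>f\<close> are not confined to \<open>Z\<close>: attaching
  trees to the root changes \<open>f\<close>, and when the root itself is attached elsewhere its
  zeros are checked at that moment.\<close>

definition rooted_weighting ::
  "real set \<Rightarrow> (real \<Rightarrow> real) \<Rightarrow> nat \<Rightarrow> 'v rooted \<Rightarrow>
    ('v \<Rightarrow> 'v) \<Rightarrow> ('v \<Rightarrow> nat) \<Rightarrow> ('v \<Rightarrow> real) \<Rightarrow> ('v \<Rightarrow> real \<Rightarrow> real) \<Rightarrow> bool" where
  "rooted_weighting Z f k T par dep w F \<longleftrightarrow>
    ptree (fst T) par dep \<and> weighting (fst T) par dep w F \<and>
    snd T \<in> pverts (fst T) \<and> dep (snd T) = 0 \<and> par (snd T) = snd T \<and> F (snd T) = f \<and>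
    (\<forall>v\<in>pverts (fst T). dep v \<le> k) \<and> (\<exists>v\<in>pverts (fst T). dep v = k) \<and>
    (\<forall>v\<in>pverts (fst T). dep v > 0 \<longrightarrow> (\<forall>x. x \<notin> Z \<longrightarrow> F v x \<noteq> 0))"

definition rooted_realized :: "real set \<Rightarrow> (real \<Rightarrow> real) \<Rightarrow> nat \<Rightarrow> 'v rooted \<Rightarrow> bool" where
  "rooted_realized Z f k T \<longleftrightarrow> (\<exists>par dep w F. rooted_weighting Z f k T par dep w F)"

lemma rooted_realized_mono:
  assumes "rooted_realized Z f k T" "Z \<subseteq> Z'"
  shows "rooted_realized Z' f k T"
proof -
  obtain par dep w F where "rooted_weighting Z f k T par dep w F"
    using assms(1) by (auto simp: rooted_realized_def)
  then have "rooted_weighting Z' f k T par dep w F"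
    using assms(2) by (auto simp: rooted_weighting_def)
  then show ?thesis
    unfolding rooted_realized_def by blast
qed

lemma rooted_realized_pair_iso:
  assumes T: "rooted_realized Z f k (G, r)" and h: "pair_iso h G H"
  shows "rooted_realized Z f k (H, h r)"
proof -
  obtain par dep w F where rw: "rooted_weighting Z f k (G, r) par dep w F"
    using T by (auto simp: rooted_realized_def)
  then have G: "ptree G par dep" and wt: "weighting G par dep w F"
    and r: "r \<in> pverts G" "dep r = 0" "par r = r" "F r = f"
    and le: "\<And>v. v \<in> pverts G \<Longrightarrow> dep v \<le> k" and ex: "\<exists>v\<in>pverts G. dep v = k"
    and nz: "\<And>v x. v \<in> pverts G \<Longrightarrow> dep v > 0 \<Longrightarrow> x \<notin> Z \<Longrightarrow> F v x \<noteq> 0"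
    unfolding rooted_weighting_def by simp_all
  interpret ptree G par dep by (rule G)
  interpret t: ptree_transport G par dep h H by unfold_locales (rule h)
  have "h r \<in> pverts H" "(dep \<circ> t.src) (h r) = 0" "t.parT (h r) = h r" "(F \<circ> t.src) (h r) = f"
    using r by (auto simp: t.vertsT)
  moreover have "(dep \<circ> t.src) v \<le> k" if "v \<in> pverts H" for v
    using that le by (elim t.vertT_cases) simp
  moreover have "\<exists>v\<in>pverts H. (dep \<circ> t.src) v = k"
  proof -
    obtain v where "v \<in> V" "dep v = k" using ex by blast
    then show ?thesis by (intro bexI[of _ "h v"]) (simp_all add: t.vertsT)
  qed
  moreover have "(F \<circ> t.src) v x \<noteq> 0" if "v \<in> pverts H" "(dep \<circ> t.src) v > 0" "x \<notin> Z" for v x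
    using that nz by (elim t.vertT_cases) simp
  ultimately have "rooted_weighting Z f k (H, h r) t.parT (dep \<circ> t.src) (w \<circ> t.src) (F \<circ> t.src)"
    using t.ptreeT t.weighting_transport[OF wt] unfolding rooted_weighting_def fst_conv snd_conv by blast
  then show ?thesis
    unfolding rooted_realized_def by blast
qed

text \<open>Index 0 stands for \<open>T0\<close> and \<open>i > 0\<close> for the
  \<open>i\<close>-th attached tree, the same numbers that \<open>odot\<close> uses as prefixes of
  vertices.\<close>

locale odot_parts =
  fixes T0 :: "nat list rooted" and Ts :: "nat list rooted list"
    and par :: "nat \<Rightarrow> nat list \<Rightarrow> nat list" and dep :: "nat \<Rightarrow> nat list \<Rightarrow> nat"
    and w :: "nat \<Rightarrow> nat list \<Rightarrow> real" and F :: "nat \<Rightarrow> nat list \<Rightarrow> real \<Rightarrow> real"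
  assumes part_ptree: "\<And>i. i \<le> length Ts \<Longrightarrow> ptree (fst ((T0 # Ts) ! i)) (par i) (dep i)"
    and part_weighting: "\<And>i. i \<le> length Ts \<Longrightarrow> weighting (fst ((T0 # Ts) ! i)) (par i) (dep i) (w i) (F i)"
    and part_root: "\<And>i. i \<le> length Ts \<Longrightarrow> snd ((T0 # Ts) ! i) \<in> pverts (fst ((T0 # Ts) ! i))"
      "\<And>i. i \<le> length Ts \<Longrightarrow> dep i (snd ((T0 # Ts) ! i)) = 0"
      "\<And>i. i \<le> length Ts \<Longrightarrow> par i (snd ((T0 # Ts) ! i)) = snd ((T0 # Ts) ! i)"
begin

abbreviation "n \<equiv> length Ts"

definition P :: "nat \<Rightarrow> nat list pair_pre_digraph" where "P i = fst ((T0 # Ts) ! i)"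

definition r :: "nat \<Rightarrow> nat list" where "r i = snd ((T0 # Ts) ! i)"

abbreviation "OD \<equiv> fst (odot T0 Ts)"

lemma snd_odot: "snd (odot T0 Ts) = 0 # r 0"
  by (simp add: odot_def Let_def r_def)

lemma ptree_P: "i \<le> n \<Longrightarrow> ptree (P i) (par i) (dep i)"
  and weighting_P: "i \<le> n \<Longrightarrow> weighting (P i) (par i) (dep i) (w i) (F i)"
  and r_in: "i \<le> n \<Longrightarrow> r i \<in> pverts (P i)"
  and dep_r: "i \<le> n \<Longrightarrow> dep i (r i) = 0"
  and par_r: "i \<le> n \<Longrightarrow> par i (r i) = r i"
  using part_ptree part_weighting part_root by (auto simp: P_def r_def)

lemma dep_eq_0_iff: "i \<le> n \<Longrightarrow> x \<in> pverts (P i) \<Longrightarrow> dep i x = 0 \<longleftrightarrow> x = r i"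
  using ptree.roots[OF ptree_P, of i "r i" x] r_in dep_r par_r by auto

lemma par_P: "i \<le> n \<Longrightarrow> x \<in> pverts (P i) \<Longrightarrow> par i x \<in> pverts (P i)"
  using ptree.par_in[OF ptree_P] .

lemma dep_par_P: "i \<le> n \<Longrightarrow> x \<in> pverts (P i) \<Longrightarrow> x \<noteq> r i \<Longrightarrow> dep i x = Suc (dep i (par i x))"
  using ptree.dep_par[OF ptree_P] dep_eq_0_iff by blast

lemma verts_odot: "pverts OD = {i # x | i x. i \<le> n \<and> x \<in> pverts (P i)}"
  by (auto simp: odot_def Let_def P_def less_Suc_eq_le)

lemma Cons_in_odot [simp]: "i # x \<in> pverts OD \<longleftrightarrow> i \<le> n \<and> x \<in> pverts (P i)"
  by (auto simp: verts_odot)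

lemma odot_vert_cases:
  assumes "v \<in> pverts OD"
  obtains i x where "i \<le> n" "x \<in> pverts (P i)" "v = i # x"
  using assms by (auto simp: verts_odot)

lemma finite_odot: "finite (pverts OD)"
proof -
  have "pverts OD = (\<Union>i\<in>{..n}. (#) i ` pverts (P i))"
    by (auto simp: verts_odot)
  then show ?thesis
    using ptree.finite_verts[OF ptree_P] by simp
qed

lemma arcs_odot:
  "(u, v) \<in> parcs OD \<longleftrightarrow>
    (\<exists>i x y. i \<le> n \<and> (x, y) \<in> parcs (P i) \<and> u = i # x \<and> v = i # y) \<or>
    (\<exists>j. 1 \<le> j \<and> j \<le> n \<and> (u = 0 # r 0 \<and> v = j # r j \<or> u = j # r j \<and> v = 0 # r 0))"
proof -
  have "parcs OD = (\<Union>i<Suc n. map_prod ((#) i) ((#) i) ` parcs (P i))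
      \<union> (\<Union>i\<in>{1..n}. {(0 # r 0, i # r i), (i # r i, 0 # r 0)})"
    by (simp add: odot_def Let_def P_def r_def)
  moreover have "(u, v) \<in> map_prod ((#) i) ((#) i) ` parcs (P i) \<longleftrightarrow>
      (\<exists>x y. (x, y) \<in> parcs (P i) \<and> u = i # x \<and> v = i # y)" for i
    by (simp add: image_iff Bex_def split_paired_Ex)
  ultimately show ?thesis
    by (auto simp: less_Suc_eq_le)
qed

lemma arcs_P_iff:
  "i \<le> n \<Longrightarrow> (x, y) \<in> parcs (P i) \<longleftrightarrow>
    x \<in> pverts (P i) \<and> y \<in> pverts (P i) \<and> (x \<noteq> r i \<and> par i x = y \<or> y \<noteq> r i \<and> par i y = x)"
proof -
  assume i: "i \<le> n"
  have ne: "par i z \<noteq> z" if "z \<in> pverts (P i)" "z \<noteq> r i" for z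
    using dep_par_P[OF i that] by auto
  show ?thesis
    unfolding ptree.arcs_iff[OF ptree_P[OF i]] using ne[of x] ne[of y] par_r[OF i] by auto
qed

text \<open>The first of two structures on the same graph: the root of operand 0 is the centre, its
  own parent, and the other operands move down by one level. It yields rooted trees and trees of
  even diameter.\<close>

definition attach_par :: "nat list \<Rightarrow> nat list" where
  "attach_par v = (if tl v = r (hd v) then 0 # r 0 else hd v # par (hd v) (tl v))"

definition attach_dep :: "nat list \<Rightarrow> nat" where
  "attach_dep v = dep (hd v) (tl v) + (if hd v = 0 then 0 else 1)"

lemma attach_par_Cons [simp]: "attach_par (i # x) = (if x = r i then 0 # r 0 else i # par i x)"
  by (simp add: attach_par_def)

lemma attach_dep_Cons [simp]: "attach_dep (i # x) = dep i x + (if i = 0 then 0 else 1)"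
  by (simp add: attach_dep_def)

lemma attach_dep_eq_0: "v \<in> pverts OD \<Longrightarrow> attach_dep v = 0 \<Longrightarrow> v = 0 # r 0"
  by (elim odot_vert_cases) (auto simp: dep_eq_0_iff split: if_splits)

lemma ptree_attach: "ptree OD attach_par attach_dep"
proof
  show "finite (pverts OD)" by (rule finite_odot)
  show "attach_par v \<in> pverts OD" if "v \<in> pverts OD" for v
    using that by (elim odot_vert_cases) (auto simp: r_in par_P)
  show "attach_dep v = Suc (attach_dep (attach_par v))" if v: "v \<in> pverts OD" "attach_dep v > 0" for v
  proof -
    obtain i x where ix: "i \<le> n" "x \<in> pverts (P i)" "v = i # x"
      using v(1) by (rule odot_vert_cases)
    show ?thesis
    proof (cases "x = r i")
      case True
      then show ?thesis using v(2) ix dep_r[of i] dep_r[of 0] by (auto split: if_splits)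
    next
      case False
      then show ?thesis using ix dep_par_P[OF ix(1,2) False] by simp
    qed
  qed
  show "attach_dep (attach_par v) = 0" "attach_par (attach_par v) = v"
    if "v \<in> pverts OD" "attach_dep v = 0" for v
    using attach_dep_eq_0[OF that] dep_r[of 0] by simp_all
  show "u = v \<or> u = attach_par v"
    if "v \<in> pverts OD" "attach_dep v = 0" "u \<in> pverts OD" "attach_dep u = 0" for u v
    using attach_dep_eq_0 that by metis
  show "(u, v) \<in> parcs OD \<longleftrightarrow>
      u \<in> pverts OD \<and> v \<in> pverts OD \<and> u \<noteq> v \<and> (attach_par u = v \<or> attach_par v = u)" for u v
  proof
    assume "(u, v) \<in> parcs OD"
    then consider (inner) i x y where "i \<le> n" "(x, y) \<in> parcs (P i)" "u = i # x" "v = i # y"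
      | (new) j where "1 \<le> j" "j \<le> n" "u = 0 # r 0 \<and> v = j # r j \<or> u = j # r j \<and> v = 0 # r 0"
      unfolding arcs_odot by blast
    then show "u \<in> pverts OD \<and> v \<in> pverts OD \<and> u \<noteq> v \<and> (attach_par u = v \<or> attach_par v = u)"
    proof cases
      case inner
      then have "x \<noteq> y"
        using ptree.arcs_iff[OF ptree_P] by blast
      then show ?thesis
        using inner arcs_P_iff[OF inner(1), of x y] by auto
    next
      case new
      then show ?thesis by (auto simp: r_in)
    qed
  next
    have half: "(a, b) \<in> parcs OD \<and> (b, a) \<in> parcs OD"
      if ab: "a \<in> pverts OD" "a \<noteq> b" "attach_par a = b" for a b
    proof -
      obtain i x where ix: "i \<le> n" "x \<in> pverts (P i)" "a = i # x"
        using ab(1) by (rule odot_vert_cases)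
      show ?thesis
      proof (cases "x = r i")
        case True
        then have "b = 0 # r 0" "1 \<le> i"
          using ab ix by (cases i; simp)+
        then show ?thesis
          using ix True unfolding arcs_odot by blast
      next
        case False
        then have "(x, par i x) \<in> parcs (P i)" "(par i x, x) \<in> parcs (P i)"
          using ix par_P by (auto simp: arcs_P_iff)
        moreover have "b = i # par i x"
          using ab ix False by simp
        ultimately show ?thesis
          using ix unfolding arcs_odot by blast
      qed
    qed
    assume "u \<in> pverts OD \<and> v \<in> pverts OD \<and> u \<noteq> v \<and> (attach_par u = v \<or> attach_par v = u)"
    then show "(u, v) \<in> parcs OD"
      using half[of u v] half[of v u] by auto
  qed
qed

lemma children_attach:
  assumes "i \<le> n" "x \<in> pverts (P i)"
  shows "children OD attach_par attach_dep (i # x) = (#) i ` children (P i) (par i) (dep i) x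
    \<union> (if i # x = 0 # r 0 then (\<lambda>j. j # r j) ` {1..n} else {})"
    (is "?L = ?R1 \<union> ?R2")
proof (intro Set.set_eqI iffI)
  fix c assume "c \<in> ?L"
  then have c: "c \<in> pverts OD" "attach_dep c > 0" "attach_par c = i # x"
    by (auto simp: children_def)
  obtain j y where jy: "j \<le> n" "y \<in> pverts (P j)" "c = j # y"
    using c(1) by (rule odot_vert_cases)
  show "c \<in> ?R1 \<union> ?R2"
  proof (cases "y = r j")
    case True
    then have "j \<noteq> 0"
      using c(2) jy dep_r[of 0] by (cases j) auto
    then show ?thesis
      using True c(3) jy by auto
  next
    case False
    then have "dep j y > 0"
      using dep_eq_0_iff[OF jy(1,2)] by simp
    then show ?thesis
      using False c(3) jy by (auto simp: children_def)
  qed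
next
  fix c assume "c \<in> ?R1 \<union> ?R2"
  then show "c \<in> ?L"
  proof
    assume "c \<in> ?R1"
    then obtain y where y: "c = i # y" "y \<in> pverts (P i)" "dep i y > 0" "par i y = x"
      by (auto simp: children_def)
    then have "y \<noteq> r i"
      using dep_r[OF assms(1)] by auto
    then show ?thesis
      using y assms by (simp add: children_def)
  next
    assume "c \<in> ?R2"
    then show ?thesis
      by (auto simp: children_def r_in split: if_splits)
  qed
qed

definition attach_weight :: "real \<Rightarrow> nat list \<Rightarrow> real" where
  "attach_weight q v = (if tl v = r (hd v) then q else w (hd v) (tl v))"

definition attach_fun :: "real \<Rightarrow> nat list \<Rightarrow> real \<Rightarrow> real" where
  "attach_fun q v x = F (hd v) (tl v) x - (if v = 0 # r 0 then \<Sum>j\<in>{1..n}. q / F j (r j) x else 0)"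

lemma attach_fun_Cons [simp]: "i # x \<noteq> 0 # r 0 \<Longrightarrow> attach_fun q (i # x) = F i x"
  by (rule ext) (auto simp: attach_fun_def)

lemma weighting_attach:
  assumes q: "q > 0"
  shows "weighting OD attach_par attach_dep (attach_weight q) (attach_fun q)"
  unfolding weighting_def
proof (intro conjI ballI impI)
  show "attach_weight q c > 0" if c: "c \<in> pverts OD" "attach_dep c > 0" for c
  proof -
    obtain i x where ix: "i \<le> n" "x \<in> pverts (P i)" "c = i # x"
      using c(1) by (rule odot_vert_cases)
    have "w i x > 0" if "x \<noteq> r i"
      using weighting_P[OF ix(1)] ix(2) dep_eq_0_iff[OF ix(1,2)] that by (simp add: weighting_def)
    then show ?thesis
      using ix q by (simp add: attach_weight_def)
  qed
  fix v assume "v \<in> pverts OD"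
  then obtain i x where ix: "i \<le> n" "x \<in> pverts (P i)" "v = i # x"
    by (rule odot_vert_cases)
  let ?C = "children (P i) (par i) (dep i) x"
  obtain \<alpha> where \<alpha>: "\<And>t. F i x t = t - \<alpha> - (\<Sum>c\<in>?C. w i c / F i c t)"
    using weighting_P[OF ix(1)] ix(2) unfolding weighting_def by blast
  have not_r: "c \<noteq> r i" if "c \<in> ?C" for c
    using that dep_r[OF ix(1)] by (auto simp: children_def)
  have fun_C: "attach_fun q (i # c) = F i c" if "c \<in> ?C" for c
    using not_r[OF that] by (intro attach_fun_Cons) auto
  have inner: "(\<Sum>c\<in>(#) i ` ?C. attach_weight q c / attach_fun q c t) = (\<Sum>c\<in>?C. w i c / F i c t)" for t
  proof (subst sum.reindex)
    show "inj_on ((#) i) ?C" by (simp add: inj_on_def)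
    show "(\<Sum>c\<in>?C. ((\<lambda>c. attach_weight q c / attach_fun q c t) \<circ> (#) i) c) = (\<Sum>c\<in>?C. w i c / F i c t)"
      using not_r by (intro sum.cong) (simp_all add: attach_weight_def fun_C)
  qed
  have fin: "finite ((#) i ` ?C)"
    using ptree.finite_verts[OF ptree_P[OF ix(1)]] by (simp add: children_def)
  have "attach_fun q v t = t - \<alpha> - (\<Sum>c\<in>children OD attach_par attach_dep v. attach_weight q c / attach_fun q c t)" for t
  proof (cases "i # x = 0 # r 0")
    case False
    have "children OD attach_par attach_dep v = (#) i ` ?C"
      unfolding ix(3) children_attach[OF ix(1,2)] if_not_P[OF False] by simp
    then show ?thesis
      unfolding ix(3) attach_fun_Cons[OF False] using inner[of t] \<alpha>[of t] ix(3) by simp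
  next
    case True
    have disj: "(#) i ` ?C \<inter> (\<lambda>j. j # r j) ` {1..n} = {}"
      using True by auto
    have "(\<Sum>c\<in>(\<lambda>j. j # r j) ` {1..n}. attach_weight q c / attach_fun q c t) = (\<Sum>j\<in>{1..n}. q / F j (r j) t)"
      by (subst sum.reindex) (auto simp: inj_on_def attach_weight_def intro!: sum.cong)
    then have "(\<Sum>c\<in>children OD attach_par attach_dep v. attach_weight q c / attach_fun q c t)
        = (\<Sum>c\<in>?C. w i c / F i c t) + (\<Sum>j\<in>{1..n}. q / F j (r j) t)"
      unfolding ix(3) children_attach[OF ix(1,2)] if_P[OF True]
      using inner by (subst sum.union_disjoint[OF fin _ disj]) simp_all
    then show ?thesis
      using \<alpha>[of t] True ix(3) by (simp add: attach_fun_def)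
  qed
  then show "\<exists>\<alpha>. \<forall>t. attach_fun q v t =
      t - \<alpha> - (\<Sum>c\<in>children OD attach_par attach_dep v. attach_weight q c / attach_fun q c t)"
    by blast
qed

lemma funpow_attach_par:
  assumes "i \<le> n" "x \<in> pverts (P i)"
  shows "t \<le> dep i x \<Longrightarrow> (attach_par ^^ t) (i # x) = i # (par i ^^ t) x"
proof (induction t)
  case (Suc t)
  interpret Pi: ptree "P i" "par i" "dep i" by (rule ptree_P[OF assms(1)])
  have "dep i ((par i ^^ t) x) > 0"
    using Pi.dep_funpow[OF assms(2), of t] Suc.prems by simp
  then have "(par i ^^ t) x \<noteq> r i"
    using dep_r[OF assms(1)] by auto
  then show ?case using Suc by simp
qed simp

text \<open>The second structure, for one attached tree: the new edge is the main edge,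
  \<open>1 - i\<close> exchanges its endpoints, and depths stay as they are. It yields trees of odd
  diameter.\<close>

definition join_par :: "nat list \<Rightarrow> nat list" where
  "join_par v = (if tl v = r (hd v) then (1 - hd v) # r (1 - hd v) else hd v # par (hd v) (tl v))"

definition join_dep :: "nat list \<Rightarrow> nat" where
  "join_dep v = dep (hd v) (tl v)"

lemma join_par_Cons [simp]: "join_par (i # x) = (if x = r i then (1 - i) # r (1 - i) else i # par i x)"
  by (simp add: join_par_def)

lemma join_dep_Cons [simp]: "join_dep (i # x) = dep i x"
  by (simp add: join_dep_def)

lemma join_dep_eq_0: "v \<in> pverts OD \<Longrightarrow> join_dep v = 0 \<Longrightarrow> \<exists>i\<le>n. v = i # r i"
  by (elim odot_vert_cases) (auto simp: dep_eq_0_iff)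

lemma ptree_join:
  assumes n: "n = 1"
  shows "ptree OD join_par join_dep"
proof
  have d: "dep 0 (r 0) = 0" "dep 1 (r 1) = 0" "dep (Suc 0) (r (Suc 0)) = 0"
    using dep_r[of 0] dep_r[of 1] n by simp_all
  have root_cases: "v = 0 # r 0 \<or> v = 1 # r 1" if v: "v \<in> pverts OD" "join_dep v = 0" for v
  proof -
    obtain i where "i \<le> n" "v = i # r i"
      using join_dep_eq_0[OF v] by blast
    then show ?thesis
      using n by (cases i) auto
  qed
  show "finite (pverts OD)" by (rule finite_odot)
  show "join_par v \<in> pverts OD" if "v \<in> pverts OD" for v
    using that by (elim odot_vert_cases) (auto simp: r_in par_P n)
  show "join_dep v = Suc (join_dep (join_par v))" if v: "v \<in> pverts OD" "join_dep v > 0" for v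
  proof -
    obtain i x where ix: "i \<le> n" "x \<in> pverts (P i)" "v = i # x"
      using v(1) by (rule odot_vert_cases)
    then have "x \<noteq> r i"
      using v(2) dep_r[of i] by auto
    then show ?thesis using ix dep_par_P[OF ix(1,2)] by simp
  qed
  show "join_dep (join_par v) = 0" "join_par (join_par v) = v"
    if "v \<in> pverts OD" "join_dep v = 0" for v
    using root_cases[OF that] d by auto
  show "u = v \<or> u = join_par v"
    if "v \<in> pverts OD" "join_dep v = 0" "u \<in> pverts OD" "join_dep u = 0" for u v
    using root_cases[OF that(1,2)] root_cases[OF that(3,4)] by auto
  show "(u, v) \<in> parcs OD \<longleftrightarrow>
      u \<in> pverts OD \<and> v \<in> pverts OD \<and> u \<noteq> v \<and> (join_par u = v \<or> join_par v = u)" for u v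
  proof
    assume "(u, v) \<in> parcs OD"
    then consider (inner) i x y where "i \<le> n" "(x, y) \<in> parcs (P i)" "u = i # x" "v = i # y"
      | (new) j where "1 \<le> j" "j \<le> n" "u = 0 # r 0 \<and> v = j # r j \<or> u = j # r j \<and> v = 0 # r 0"
      unfolding arcs_odot by blast
    then show "u \<in> pverts OD \<and> v \<in> pverts OD \<and> u \<noteq> v \<and> (join_par u = v \<or> join_par v = u)"
    proof cases
      case inner
      then have "x \<noteq> y"
        using ptree.arcs_iff[OF ptree_P] by blast
      then show ?thesis
        using inner arcs_P_iff[OF inner(1), of x y] by auto
    next
      case new
      then have "j = 1"
        using n by simp
      then show ?thesis
        using new r_in[of 0] r_in[of 1] n by auto
    qed
  next
    have half: "(a, b) \<in> parcs OD \<and> (b, a) \<in> parcs OD"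
      if ab: "a \<in> pverts OD" "a \<noteq> b" "join_par a = b" for a b
    proof -
      obtain i x where ix: "i \<le> n" "x \<in> pverts (P i)" "a = i # x"
        using ab(1) by (rule odot_vert_cases)
      show ?thesis
      proof (cases "x = r i")
        case True
        then have b: "b = (1 - i) # r (1 - i)"
          using ab ix by simp
        have "i = 0 \<or> i = 1"
          using ix n by linarith
        then have "a = 0 # r 0 \<and> b = 1 # r 1 \<or> a = 1 # r 1 \<and> b = 0 # r 0"
          using b True ix by auto
        then show ?thesis
          using n unfolding arcs_odot by (metis order_refl)
      next
        case False
        then have "(x, par i x) \<in> parcs (P i)" "(par i x, x) \<in> parcs (P i)"
          using ix par_P by (auto simp: arcs_P_iff)
        moreover have "b = i # par i x"
          using ab ix False by simp
        ultimately show ?thesis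
          using ix unfolding arcs_odot by blast
      qed
    qed
    assume "u \<in> pverts OD \<and> v \<in> pverts OD \<and> u \<noteq> v \<and> (join_par u = v \<or> join_par v = u)"
    then show "(u, v) \<in> parcs OD"
      using half[of u v] half[of v u] by auto
  qed
qed

lemma children_join:
  assumes "i \<le> n" "x \<in> pverts (P i)"
  shows "children OD join_par join_dep (i # x) = (#) i ` children (P i) (par i) (dep i) x" (is "?L = ?R")
proof (intro Set.set_eqI iffI)
  fix c assume "c \<in> ?L"
  then have c: "c \<in> pverts OD" "join_dep c > 0" "join_par c = i # x"
    by (auto simp: children_def)
  obtain j y where jy: "j \<le> n" "y \<in> pverts (P j)" "c = j # y"
    using c(1) by (rule odot_vert_cases)
  then have "y \<noteq> r j"
    using c(2) dep_r[of j] by auto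
  then show "c \<in> ?R"
    using c jy by (auto simp: children_def)
next
  fix c assume "c \<in> ?R"
  then obtain y where y: "c = i # y" "y \<in> pverts (P i)" "dep i y > 0" "par i y = x"
    by (auto simp: children_def)
  then have "y \<noteq> r i"
    using dep_r[OF assms(1)] by auto
  then show "c \<in> ?L"
    using y assms by (simp add: children_def)
qed

lemma weighting_join:
  "weighting OD join_par join_dep (\<lambda>v. w (hd v) (tl v)) (\<lambda>v. F (hd v) (tl v))"
  unfolding weighting_def
proof (intro conjI ballI impI)
  show "w (hd c) (tl c) > 0" if c: "c \<in> pverts OD" "join_dep c > 0" for c
  proof -
    obtain i x where ix: "i \<le> n" "x \<in> pverts (P i)" "c = i # x"
      using c(1) by (rule odot_vert_cases)
    then show ?thesis
      using weighting_P[OF ix(1)] c(2) by (simp add: weighting_def)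
  qed
  fix v assume "v \<in> pverts OD"
  then obtain i x where ix: "i \<le> n" "x \<in> pverts (P i)" "v = i # x"
    by (rule odot_vert_cases)
  let ?C = "children (P i) (par i) (dep i) x"
  obtain \<alpha> where \<alpha>: "\<And>t. F i x t = t - \<alpha> - (\<Sum>c\<in>?C. w i c / F i c t)"
    using weighting_P[OF ix(1)] ix(2) unfolding weighting_def by blast
  have "(\<Sum>c\<in>(#) i ` ?C. w (hd c) (tl c) / F (hd c) (tl c) t) = (\<Sum>c\<in>?C. w i c / F i c t)" for t
    by (subst sum.reindex) (auto simp: inj_on_def)
  then show "\<exists>\<alpha>. \<forall>t. F (hd v) (tl v) t =
      t - \<alpha> - (\<Sum>c\<in>children OD join_par join_dep v. w (hd c) (tl c) / F (hd c) (tl c) t)"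
    using \<alpha> unfolding ix(3) children_join[OF ix(1,2)] by auto
qed

lemma funpow_join_par:
  assumes "i \<le> n" "x \<in> pverts (P i)"
  shows "t \<le> dep i x \<Longrightarrow> (join_par ^^ t) (i # x) = i # (par i ^^ t) x"
proof (induction t)
  case (Suc t)
  interpret Pi: ptree "P i" "par i" "dep i" by (rule ptree_P[OF assms(1)])
  have "dep i ((par i ^^ t) x) > 0"
    using Pi.dep_funpow[OF assms(2), of t] Suc.prems by simp
  then have "(par i ^^ t) x \<noteq> r i"
    using dep_r[OF assms(1)] by auto
  then show ?case using Suc by simp
qed simp

end

section \<open>Realizing the seeds\<close>

lemma odot_parts_exist:
  assumes "rooted_realized Z f0 k0 T0" "\<And>T. T \<in> set Ts \<Longrightarrow> rooted_realized Z f1 k T"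
  obtains par dep w F where "odot_parts T0 Ts par dep w F"
    "\<And>i. i \<le> length Ts \<Longrightarrow>
      rooted_weighting Z (if i = 0 then f0 else f1) (if i = 0 then k0 else k) ((T0 # Ts) ! i)
        (par i) (dep i) (w i) (F i)"
proof -
  \<comment> \<open>The bound on \<open>i\<close> is placed inside \<open>Q\<close>, so that every
    natural number has witnesses and choice yields total functions of \<open>i\<close>.\<close>
  define Q where "Q i par dep w F \<longleftrightarrow> (i \<le> length Ts \<longrightarrow>
      rooted_weighting Z (if i = 0 then f0 else f1) (if i = 0 then k0 else k) ((T0 # Ts) ! i)
        par dep w F)" for i par dep w F
  have "\<exists>par dep w F. Q i par dep w F" for i
  proof (cases i)
    case 0
    then show ?thesis
      using assms(1) by (simp add: Q_def rooted_realized_def)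
  next
    case (Suc j)
    show ?thesis
    proof (cases "j < length Ts")
      case True
      then show ?thesis
        using assms(2)[of "Ts ! j"] Suc by (simp add: Q_def rooted_realized_def)
    next
      case False
      then show ?thesis using Suc by (simp add: Q_def)
    qed
  qed
  then obtain par dep w F where Q: "\<And>i. Q i (par i) (dep i) (w i) (F i)"
    by metis
  have rw: "rooted_weighting Z (if i = 0 then f0 else f1) (if i = 0 then k0 else k) ((T0 # Ts) ! i)
        (par i) (dep i) (w i) (F i)" if "i \<le> length Ts" for i
    using Q[of i] that by (simp add: Q_def)
  have "odot_parts T0 Ts par dep w F"
    by unfold_locales (use rw in \<open>auto simp: rooted_weighting_def ptree_def\<close>)
  then show thesis
    using rw that by blast
qed

text \<open>The squared weight \<open>q\<close> is shared equally by the new edges, so the root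
  function does not depend on the number of attached trees. Attached roots are no longer roots,
  which is why the zeros of \<open>f1\<close> must lie in \<open>Z\<close>. Two attached trees of
  height \<open>k\<close> have deepest vertices in different branches, hence diameter
  \<open>2 * Suc k\<close>.\<close>

lemma rooted_realized_odot:
  assumes T0: "rooted_realized Z f0 k0 T0" and Ts: "\<And>T. T \<in> set Ts \<Longrightarrow> rooted_realized Z f1 k T"
    and ne: "Ts \<noteq> []" and k0: "k0 \<le> Suc k" and nz1: "\<And>x. x \<notin> Z \<Longrightarrow> f1 x \<noteq> 0" and q: "q > 0"
  shows "rooted_realized Z (\<lambda>x. f0 x - q / f1 x) (Suc k) (odot T0 Ts)"
    and "length Ts \<ge> 2 \<Longrightarrow> Z \<subseteq> \<Lambda> \<Longrightarrow> (\<And>x. x \<notin> \<Lambda> \<Longrightarrow> f0 x - q / f1 x \<noteq> 0) \<Longrightarrow>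
      realized (2 * Suc k) \<Lambda> (fst (odot T0 Ts))"
proof -
  obtain par dep w F where parts: "odot_parts T0 Ts par dep w F"
    and rw: "\<And>i. i \<le> length Ts \<Longrightarrow>
      rooted_weighting Z (if i = 0 then f0 else f1) (if i = 0 then k0 else k) ((T0 # Ts) ! i)
        (par i) (dep i) (w i) (F i)"
    using odot_parts_exist[OF T0 Ts] by blast
  interpret odot_parts T0 Ts par dep w F by (rule parts)
  have Fr: "F i (r i) = (if i = 0 then f0 else f1)"
    and dep_le: "\<And>v. v \<in> pverts (P i) \<Longrightarrow> dep i v \<le> (if i = 0 then k0 else k)"
    and dep_ex: "\<exists>v\<in>pverts (P i). dep i v = (if i = 0 then k0 else k)"
    and nz: "\<And>v x. v \<in> pverts (P i) \<Longrightarrow> dep i v > 0 \<Longrightarrow> x \<notin> Z \<Longrightarrow> F i v x \<noteq> 0" if "i \<le> n" for i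
    using rw[OF that] unfolding rooted_weighting_def P_def r_def by blast+
  define p where "p = q / real n"
  have n: "n > 0" using ne by simp
  then have p: "p > 0" using q by (simp add: p_def)
  have root_fun: "attach_fun p (0 # r 0) = (\<lambda>x. f0 x - q / f1 x)"
  proof
    fix x
    have "(\<Sum>j\<in>{1..n}. p / F j (r j) x) = (\<Sum>j\<in>{1..n}. p / f1 x)"
      by (intro sum.cong refl) (simp add: Fr)
    also have "\<dots> = q / f1 x"
      using n by (simp add: p_def)
    finally show "attach_fun p (0 # r 0) x = f0 x - q / f1 x"
      using Fr[of 0] by (simp add: attach_fun_def)
  qed
  have le: "attach_dep v \<le> Suc k" if v: "v \<in> pverts OD" for v
  proof -
    obtain i x where ix: "i \<le> n" "x \<in> pverts (P i)" "v = i # x"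
      using v by (rule odot_vert_cases)
    then show ?thesis
      using dep_le[OF ix(1,2)] k0 by (simp split: if_splits)
  qed
  have deep: "\<exists>x. i # x \<in> pverts OD \<and> dep i x = k" if "i \<le> n" "i > 0" for i
    using dep_ex[OF that(1)] that by auto
  have nzO: "attach_fun p v x \<noteq> 0" if v: "v \<in> pverts OD" "attach_dep v > 0" "x \<notin> Z" for v x
  proof -
    obtain i y where iy: "i \<le> n" "y \<in> pverts (P i)" "v = i # y"
      using v(1) by (rule odot_vert_cases)
    have "v \<noteq> 0 # r 0"
      using v(2) dep_r[of 0] by auto
    then have eq: "attach_fun p v x = F i y x"
      using iy(3) attach_fun_Cons by metis
    show ?thesis
    proof (cases "y = r i")
      case True
      then have "i \<noteq> 0"
        using \<open>v \<noteq> 0 # r 0\<close> iy(3) by (cases i) auto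
      then show ?thesis
        using eq True Fr[OF iy(1)] nz1[OF v(3)] by simp
    next
      case False
      then have "dep i y > 0"
        using dep_eq_0_iff[OF iy(1,2)] by simp
      then show ?thesis
        using eq nz[OF iy(1,2) _ v(3)] by simp
    qed
  qed
  have root: "0 # r 0 \<in> pverts OD" "attach_dep (0 # r 0) = 0" "attach_par (0 # r 0) = 0 # r 0"
    using r_in[of 0] dep_r[of 0] by simp_all
  obtain x1 where x1: "1 # x1 \<in> pverts OD" "dep 1 x1 = k"
    using deep[of 1] n by auto
  have "\<exists>v\<in>pverts OD. attach_dep v = Suc k"
    using x1 by (intro bexI[of _ "1 # x1"]) simp_all
  then have "rooted_weighting Z (\<lambda>x. f0 x - q / f1 x) (Suc k) (odot T0 Ts)
      attach_par attach_dep (attach_weight p) (attach_fun p)"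
    unfolding rooted_weighting_def snd_odot
    using ptree_attach weighting_attach[OF p] root root_fun le nzO by blast
  then show "rooted_realized Z (\<lambda>x. f0 x - q / f1 x) (Suc k) (odot T0 Ts)"
    unfolding rooted_realized_def by blast
  assume two: "n \<ge> 2" and Z: "Z \<subseteq> \<Lambda>" and nzr: "\<And>x. x \<notin> \<Lambda> \<Longrightarrow> f0 x - q / f1 x \<noteq> 0"
  obtain x2 where x2: "2 # x2 \<in> pverts OD" "dep 2 x2 = k"
    using deep[of 2] two by auto
  interpret A: ptree OD attach_par attach_dep by (rule ptree_attach)
  have dt: "diam_tree OD attach_par attach_dep (2 * Suc k)"
  proof
    show "1 \<le> 2 * Suc k" by simp
    show "attach_dep v \<le> 2 * Suc k div 2" if "v \<in> pverts OD" for v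
      using le[OF that] by simp
    show "attach_par v = v \<longleftrightarrow> even (2 * Suc k)" if "v \<in> pverts OD" "attach_dep v = 0" for v
      using attach_dep_eq_0[OF that] by simp
    have e: "(2 * Suc k + 1) div 2 - 1 = k" by simp
    have "(attach_par ^^ k) (1 # x1) \<noteq> (attach_par ^^ k) (2 # x2)"
      using funpow_attach_par[of 1 x1 k] funpow_attach_par[of 2 x2 k] x1 x2 by simp
    then show "\<exists>x\<in>pverts OD. \<exists>y\<in>pverts OD. attach_dep x = 2 * Suc k div 2 \<and> attach_dep y = 2 * Suc k div 2 \<and>
      (attach_par ^^ ((2 * Suc k + 1) div 2 - 1)) x \<noteq> (attach_par ^^ ((2 * Suc k + 1) div 2 - 1)) y"
      unfolding e using x1 x2 by (intro bexI[of _ "1 # x1"] bexI[of _ "2 # x2"]) simp_all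
  qed
  have nz\<Lambda>: "attach_fun p v x \<noteq> 0" if "v \<in> pverts OD" "attach_dep v > 0" "x \<notin> \<Lambda>" for v x
    using nzO[OF that(1,2)] that(3) Z by blast
  have nzr\<Lambda>: "attach_fun p v x * attach_fun p (attach_par v) x \<noteq> (if attach_par v = v then 0 else 1\<^sup>2)"
    if "v \<in> pverts OD" "attach_dep v = 0" "x \<notin> \<Lambda>" for v x
    using attach_dep_eq_0[OF that(1,2)] nzr[OF that(3)] root(3) root_fun by simp
  \<comment> \<open>With a central vertex there is no main edge; 1 is an arbitrary choice for
    \<open>w0\<close>.\<close>
  have one: "(0::real) < 1" by simp
  show "realized (2 * Suc k) \<Lambda> OD"
    unfolding realized_def
    by (intro exI[of _ attach_par] exI[of _ attach_dep] exI[of _ "attach_weight p"]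
        exI[of _ "attach_fun p"] exI[of _ 1] conjI ballI allI impI)
      (rule dt weighting_attach[OF p] one nz\<Lambda> nzr\<Lambda>; assumption)+
qed

text \<open>Nothing changes inside the two trees; only the condition at the main edge is new. Equal
  heights \<open>k\<close> on both sides give diameter \<open>2 * k + 1\<close>.\<close>

lemma realized_join:
  assumes T0: "rooted_realized Z f0 k T0" and T1: "rooted_realized Z f1 k T1"
    and w0: "w0 > 0" and Z: "Z \<subseteq> \<Lambda>" and nzr: "\<And>x. x \<notin> \<Lambda> \<Longrightarrow> f0 x * f1 x \<noteq> w0\<^sup>2"
  shows "realized (2 * k + 1) \<Lambda> (fst (odot T0 [T1]))"
proof -
  have "\<And>T. T \<in> set [T1] \<Longrightarrow> rooted_realized Z f1 k T"
    using T1 by simp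
  from odot_parts_exist[OF T0 this]
  obtain par dep w F where parts: "odot_parts T0 [T1] par dep w F"
    and rw: "\<And>i. i \<le> length [T1] \<Longrightarrow>
      rooted_weighting Z (if i = 0 then f0 else f1) (if i = 0 then k else k) ((T0 # [T1]) ! i)
        (par i) (dep i) (w i) (F i)"
    by blast
  interpret odot_parts T0 "[T1]" par dep w F by (rule parts)
  have n: "length [T1] = 1" by simp
  have Fr: "F i (r i) = (if i = 0 then f0 else f1)"
    and dep_le: "\<And>v. v \<in> pverts (P i) \<Longrightarrow> dep i v \<le> k"
    and dep_ex: "\<exists>v\<in>pverts (P i). dep i v = k"
    and nz: "\<And>v x. v \<in> pverts (P i) \<Longrightarrow> dep i v > 0 \<Longrightarrow> x \<notin> Z \<Longrightarrow> F i v x \<noteq> 0"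
    if "i \<le> length [T1]" for i
    using rw[OF that] unfolding rooted_weighting_def P_def r_def if_cancel by blast+
  have deep: "\<exists>x. i # x \<in> pverts OD \<and> dep i x = k" if "i \<le> length [T1]" for i
    using dep_ex[OF that] that by auto
  obtain x0 where x0: "0 # x0 \<in> pverts OD" "dep 0 x0 = k"
    using deep[of 0] by auto
  obtain x1 where x1: "1 # x1 \<in> pverts OD" "dep 1 x1 = k"
    using deep[of 1] by auto
  have root_cases: "v = 0 # r 0 \<or> v = 1 # r 1" if v: "v \<in> pverts OD" "join_dep v = 0" for v
  proof -
    obtain i where "i \<le> length [T1]" "v = i # r i"
      using join_dep_eq_0[OF v] by blast
    then show ?thesis by (cases i) auto
  qed
  interpret A: ptree OD join_par join_dep by (rule ptree_join) simp
  have dt: "diam_tree OD join_par join_dep (2 * k + 1)"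
  proof
    show "1 \<le> 2 * k + 1" by simp
    show "join_dep v \<le> (2 * k + 1) div 2" if "v \<in> pverts OD" for v
      using that dep_le by (elim odot_vert_cases) simp
    show "join_par v = v \<longleftrightarrow> even (2 * k + 1)" if "v \<in> pverts OD" "join_dep v = 0" for v
      using root_cases[OF that] by auto
    have e: "(2 * k + 1 + 1) div 2 - 1 = k" by simp
    have "(join_par ^^ k) (0 # x0) \<noteq> (join_par ^^ k) (1 # x1)"
      using funpow_join_par[of 0 x0 k] funpow_join_par[of 1 x1 k] x0 x1 by simp
    then show "\<exists>x\<in>pverts OD. \<exists>y\<in>pverts OD. join_dep x = (2 * k + 1) div 2 \<and> join_dep y = (2 * k + 1) div 2 \<and>
      (join_par ^^ ((2 * k + 1 + 1) div 2 - 1)) x \<noteq> (join_par ^^ ((2 * k + 1 + 1) div 2 - 1)) y"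
      unfolding e using x0 x1 by (intro bexI[of _ "0 # x0"] bexI[of _ "1 # x1"]) simp_all
  qed
  have nz\<Lambda>: "F (hd v) (tl v) x \<noteq> 0" if v: "v \<in> pverts OD" "join_dep v > 0" "x \<notin> \<Lambda>" for v x
  proof -
    obtain i y where "i \<le> length [T1]" "y \<in> pverts (P i)" "v = i # y"
      using v(1) by (rule odot_vert_cases)
    then show ?thesis
      using nz[of i y x] v(2,3) Z by auto
  qed
  have nzr\<Lambda>: "F (hd v) (tl v) x * F (hd (join_par v)) (tl (join_par v)) x
      \<noteq> (if join_par v = v then 0 else w0\<^sup>2)"
    if v: "v \<in> pverts OD" "join_dep v = 0" "x \<notin> \<Lambda>" for v x
    using root_cases[OF v(1,2)] nzr[OF v(3)] Fr[of 0] Fr[of 1] by (auto simp: mult.commute)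
  show ?thesis
    unfolding realized_def
    by (intro exI[of _ join_par] exI[of _ join_dep] exI[of _ "\<lambda>v. w (hd v) (tl v)"]
        exI[of _ "\<lambda>v. F (hd v) (tl v)"] exI[of _ w0] conjI ballI allI impI)
      (rule dt weighting_join w0 nz\<Lambda> nzr\<Lambda>; assumption)+
qed

section \<open>Alternating quotients and lists of points with wide gaps\<close>

fun alt_quot :: "real list \<Rightarrow> real \<Rightarrow> real" where
  "alt_quot [] x = 1"
| "alt_quot (a # l) x = (x - a) / alt_quot l x"

lemma alt_quot_nonzero: "x \<notin> set l \<Longrightarrow> alt_quot l x \<noteq> 0"
  by (induction l) auto

lemma alt_quot_snoc:
  "alt_quot (l @ [c]) x = (if even (length l) then alt_quot l x * (x - c) else alt_quot l x / (x - c))"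
  by (induction l) auto

lemma alt_quot_Cons_snoc:
  "odd (length l) \<Longrightarrow> alt_quot (a # l @ [b]) x = (x - a) * (x - b) / alt_quot l x"
  by (simp add: alt_quot_snoc)

text \<open>Each gap exceeds the sum of all later gaps. This leaves room to move the first point of the
  list towards the second one in the recursion for the binomial trees.\<close>

fun wide_gaps :: "real list \<Rightarrow> bool" where
  "wide_gaps [] \<longleftrightarrow> True"
| "wide_gaps [a] \<longleftrightarrow> True"
| "wide_gaps (a # b # l) \<longleftrightarrow> a < b \<and> last (b # l) - b < b - a \<and> wide_gaps (b # l)"

lemma wide_gaps_tl: "wide_gaps (a # l) \<Longrightarrow> wide_gaps l"
  by (cases l) auto

lemma wide_gaps_less: "wide_gaps (a # l) \<Longrightarrow> b \<in> set l \<Longrightarrow> a < b"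
  by (induction l arbitrary: a) force+

lemma wide_gaps_last: "wide_gaps (a # l) \<Longrightarrow> a \<le> last (a # l)"
  using wide_gaps_less[of a l "last l"] by (cases "l = []") auto

lemma wide_gaps_snoc_less: "wide_gaps (l @ [c]) \<Longrightarrow> b \<in> set l \<Longrightarrow> b < c"
proof (induction l)
  case (Cons a l)
  then show ?case
    using wide_gaps_less[of a "l @ [c]" c] wide_gaps_tl[of a "l @ [c]"] by auto
qed simp

lemma wide_gaps_butlast: "wide_gaps (l @ [c]) \<Longrightarrow> wide_gaps l"
proof (induction l rule: induct_list012)
  case (3 a b l)
  have "last (b # l) < c"
    using wide_gaps_snoc_less[OF 3(3), of "last (b # l)"] by simp
  then show ?case
    using 3 by (auto split: if_splits)
qed auto

lemma wide_gaps_exist: "\<exists>l. length l = n \<and> wide_gaps l"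
proof (induction n)
  case (Suc n)
  then obtain l where l: "length l = n" "wide_gaps l" by blast
  show ?case
  proof (cases l)
    case Nil
    then show ?thesis using l by (intro exI[of _ "[0]"]) simp
  next
    case (Cons b l')
    then have "b \<le> last (b # l')"
      using l wide_gaps_last by simp
    \<comment> \<open>The new gap is \<open>last (b # l') - b + 1\<close>, one more than the sum of
      all later gaps.\<close>
    then show ?thesis
      using l Cons by (intro exI[of _ "(b - (last (b # l') - b) - 1) # l"]) simp
  qed
qed simp

lemma set_butlast_tl: "set (butlast (tl l)) \<subseteq> set l"
  by (cases l) (auto dest: in_set_butlastD)

text \<open>The two ends of the list are left out of the exceptional set: only the root function may
  vanish there, and it can still be changed by gluing. Equality with the quotient is claimed off the
  inner points only, since the computations cancel factors that vanish there.\<close>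

definition realizes_points :: "nat \<Rightarrow> 'v rooted \<Rightarrow> real list \<Rightarrow> bool" where
  "realizes_points k T l \<longleftrightarrow> (\<exists>f. rooted_realized (set (butlast (tl l))) f k T \<and>
    (\<forall>x. x \<notin> set (butlast (tl l)) \<longrightarrow> f x = alt_quot l x))"

text \<open>One identity serves two purposes: a single copy of \<open>T1\<close> gives a rooted tree
  for further gluing, two copies give a tree of even diameter with the same root function. In the
  second case the root function is final, so its zeros \<open>a\<close> and \<open>b\<close> join
  the set.\<close>

lemma realizes_points_odot:
  assumes T0: "rooted_realized (set L) f0 k0 T0" and T1: "rooted_realized (set L) f1 k T1"
    and k0: "k0 \<le> Suc k" and q: "q > 0"
    and f: "\<And>x. x \<notin> set L \<Longrightarrow> f1 x \<noteq> 0 \<and> f0 x - q / f1 x = alt_quot (a # L @ [b]) x"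
  shows "realizes_points (Suc k) (odot T0 [T1]) (a # L @ [b])"
    and "realized (2 * Suc k) (set (a # L @ [b])) (fst (odot T0 [T1, T1]))"
proof -
  have nz: "\<And>x. x \<notin> set L \<Longrightarrow> f1 x \<noteq> 0"
    using f by blast
  have "rooted_realized (set L) (\<lambda>x. f0 x - q / f1 x) (Suc k) (odot T0 [T1])"
    by (rule rooted_realized_odot(1)[OF T0 _ _ k0 nz q]) (use T1 in auto)
  then show "realizes_points (Suc k) (odot T0 [T1]) (a # L @ [b])"
    unfolding realizes_points_def using f by (intro exI[of _ "\<lambda>x. f0 x - q / f1 x"]) simp
  show "realized (2 * Suc k) (set (a # L @ [b])) (fst (odot T0 [T1, T1]))"
  proof (rule rooted_realized_odot(2)[OF T0 _ _ k0 nz q])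
    show "f0 x - q / f1 x \<noteq> 0" if "x \<notin> set (a # L @ [b])" for x
      using f[of x] alt_quot_nonzero[OF that] that by simp
  qed (use T1 in auto)
qed

text \<open>The tree realizing the points \<open>a, L, b\<close> is glued from realizations of \<open>a + b - c\<close> followed by
  \<open>butlast L\<close>, and of \<open>L\<close>, where \<open>c\<close> is the last point of \<open>L\<close>: the product of their alternating
  quotients is \<open>(x - (a + b - c)) (x - c)\<close>, which differs from \<open>(x - a) (x - b)\<close> by a constant.\<close>

lemma binomial_step:
  assumes T: "\<And>l. length l = 2 * j + 1 \<Longrightarrow> wide_gaps l \<Longrightarrow> realizes_points j T l"
    and L: "length L = 2 * j + 1" "wide_gaps (a # L @ [b])"
  shows "\<exists>f0 f1 q. rooted_realized (set L) f0 j T \<and> rooted_realized (set L) f1 j T \<and> q > 0 \<and>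
    (\<forall>x. x \<notin> set L \<longrightarrow> f1 x \<noteq> 0 \<and> f0 x - q / f1 x = alt_quot (a # L @ [b]) x)"
proof -
  obtain M c where M: "L = M @ [c]"
    using L(1) by (cases L rule: rev_cases) auto
  have len: "length M = 2 * j"
    using L(1) M by simp
  have gap: "wide_gaps (L @ [b])" "wide_gaps L" "wide_gaps M"
    using wide_gaps_tl[OF L(2)] wide_gaps_butlast M by metis+
  have "a < c" "c < b"
    using wide_gaps_less[OF L(2), of c] wide_gaps_snoc_less[OF gap(1), of c] M by auto
  \<comment> \<open>This is where the wide gap after \<open>a\<close> is spent: for the first point
    \<open>m\<close> of \<open>M\<close>, \<open>m - (a + b - c) = (m - a) - (b - c) > (b - m) - (b
    - c) = c - m > last M - m\<close>.\<close>
  have "wide_gaps ((a + b - c) # M)"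
  proof (cases M)
    case (Cons m M')
    have "last M < c"
      using wide_gaps_snoc_less[of M c "last M"] gap(2) M Cons by auto
    moreover have "m < c"
      using wide_gaps_snoc_less[of M c m] gap(2) M Cons by auto
    moreover have "b - m < m - a"
      using L(2) M Cons by simp
    ultimately show ?thesis
      using Cons gap(3) by simp
  qed simp
  then have "realizes_points j T ((a + b - c) # M)"
    using T len by simp
  then obtain f0 where f0: "rooted_realized (set (butlast M)) f0 j T"
    "\<And>x. x \<notin> set (butlast M) \<Longrightarrow> f0 x = alt_quot ((a + b - c) # M) x"
    unfolding realizes_points_def by auto
  have "realizes_points j T L"
    using T L(1) gap(2) by blast
  then obtain f1 where f1: "rooted_realized (set (butlast (tl L))) f1 j T"
    "\<And>x. x \<notin> set (butlast (tl L)) \<Longrightarrow> f1 x = alt_quot L x"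
    unfolding realizes_points_def by auto
  have sub: "set (butlast M) \<subseteq> set L" "set (butlast (tl L)) \<subseteq> set L"
    using set_butlast_tl[of L] M by (auto dest: in_set_butlastD)
  \<comment> \<open>The quadratics \<open>(x - (a + b - c)) * (x - c)\<close> and
    \<open>(x - a) * (x - b)\<close> have the same root sum; \<open>q\<close> is the difference of
    their constant terms, positive because \<open>c\<close> lies between \<open>a\<close> and
    \<open>b\<close>.\<close>
  define q where "q = (b - c) * (c - a)"
  have "q > 0"
    using \<open>a < c\<close> \<open>c < b\<close> by (simp add: q_def)
  moreover have "f1 x \<noteq> 0 \<and> f0 x - q / f1 x = alt_quot (a # L @ [b]) x" if x: "x \<notin> set L" for x
  proof -
    have v1: "f1 x = alt_quot L x"
      using f1(2) sub x by blast
    have v0: "f0 x = (x - (a + b - c)) / alt_quot M x"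
      using f0(2)[of x] sub x by auto
    have vL: "alt_quot L x = alt_quot M x * (x - c)"
      using M len by (simp add: alt_quot_snoc)
    have nz: "alt_quot M x \<noteq> 0" "x - c \<noteq> 0"
      using alt_quot_nonzero[of x M] x M by auto
    have "f0 x - q / f1 x = ((x - (a + b - c)) * (x - c) - q) / alt_quot L x"
      unfolding v0 v1 vL using nz by (simp add: field_simps)
    also have "(x - (a + b - c)) * (x - c) - q = (x - a) * (x - b)"
      by (simp add: q_def algebra_simps)
    finally have "f0 x - q / f1 x = (x - a) * (x - b) / alt_quot L x" .
    also have "\<dots> = alt_quot (a # L @ [b]) x"
      by (rule alt_quot_Cons_snoc[symmetric]) (simp add: L(1))
    finally have "f0 x - q / f1 x = alt_quot (a # L @ [b]) x" .
    moreover have "f1 x \<noteq> 0"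
      using v1 alt_quot_nonzero[OF x] by simp
    ultimately show ?thesis
      by blast
  qed
  ultimately show ?thesis
    using rooted_realized_mono[OF f0(1) sub(1)] rooted_realized_mono[OF f1(1) sub(2)] by blast
qed

text \<open>The smaller tree takes the inner points \<open>M\<close> of \<open>L\<close>, the larger
  one all of \<open>L = c, M, e\<close>, so the product of the root functions is
  \<open>(x - c) * (x - e)\<close>. Equal root sums force \<open>a + b = c + e\<close>: one new end
  determines the other, and any \<open>a\<close> left of \<open>L\<close> will do.\<close>

lemma binomial_minus_step:
  assumes T: "\<And>l. length l = 2 * j + 1 \<Longrightarrow> wide_gaps l \<Longrightarrow> realizes_points j T l"
    and T': "\<And>l. length l = 2 * j + 3 \<Longrightarrow> wide_gaps l \<Longrightarrow> realizes_points (Suc j) T' l"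
    and L: "length L = 2 * j + 3" "wide_gaps L" and a: "a < hd L" and b: "b = hd L + last L - a"
  shows "\<exists>f0 f1 q. rooted_realized (set L) f0 j T \<and> rooted_realized (set L) f1 (Suc j) T' \<and> q > 0 \<and>
    (\<forall>x. x \<notin> set L \<longrightarrow> f1 x \<noteq> 0 \<and> f0 x - q / f1 x = alt_quot (a # L @ [b]) x)"
proof -
  obtain c K where K: "L = c # K" "length K = 2 * j + 2"
    using L(1) by (cases L) auto
  obtain M e where M: "K = M @ [e]"
    using K(2) by (cases K rule: rev_cases) auto
  have L': "L = c # M @ [e]" and len: "length M = 2 * j + 1"
    using K M by auto
  have "wide_gaps M"
    using L(2) L' wide_gaps_tl wide_gaps_butlast by metis
  then have "realizes_points j T M"
    using T len by blast
  then obtain f0 where f0: "rooted_realized (set (butlast (tl M))) f0 j T"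
    "\<And>x. x \<notin> set (butlast (tl M)) \<Longrightarrow> f0 x = alt_quot M x"
    unfolding realizes_points_def by auto
  have "realizes_points (Suc j) T' L"
    using T' L by blast
  then obtain f1 where f1: "rooted_realized (set (butlast (tl L))) f1 (Suc j) T'"
    "\<And>x. x \<notin> set (butlast (tl L)) \<Longrightarrow> f1 x = alt_quot L x"
    unfolding realizes_points_def by auto
  have sub: "set (butlast (tl M)) \<subseteq> set L" "set (butlast (tl L)) \<subseteq> set L"
    using set_butlast_tl[of L] set_butlast_tl[of M] L' by auto
  have ce: "c < e" and ac: "a < c" and b': "b = c + e - a"
    using wide_gaps_less[of c "M @ [e]" e] L(2) L' a b by auto
  define q where "q = (b - e) * (e - a)"
  have "q > 0"
    using ce ac b' by (simp add: q_def)
  moreover have "f1 x \<noteq> 0 \<and> f0 x - q / f1 x = alt_quot (a # L @ [b]) x" if x: "x \<notin> set L" for x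
  proof -
    have v1: "f1 x = alt_quot L x"
      using f1(2) sub x by blast
    have v0: "f0 x = alt_quot M x"
      using f0(2) sub x by blast
    have vL: "alt_quot L x = (x - c) * (x - e) / alt_quot M x"
      unfolding L' by (rule alt_quot_Cons_snoc) (simp add: len)
    have nz: "alt_quot M x \<noteq> 0" "x - c \<noteq> 0" "x - e \<noteq> 0"
      using alt_quot_nonzero[of x M] x L' by auto
    have "A - q / (D / A) = (D - q) / (D / A)" if "A \<noteq> 0" "D \<noteq> 0" for A D :: real
      using that by (simp add: field_simps)
    from this[of "alt_quot M x" "(x - c) * (x - e)"]
    have "f0 x - q / f1 x = ((x - c) * (x - e) - q) / alt_quot L x"
      unfolding v0 v1 vL using nz by simp
    also have "(x - c) * (x - e) - q = (x - a) * (x - b)"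
      by (simp add: q_def b' algebra_simps)
    finally have "f0 x - q / f1 x = (x - a) * (x - b) / alt_quot L x" .
    also have "\<dots> = alt_quot (a # L @ [b]) x"
      by (rule alt_quot_Cons_snoc[symmetric]) (simp add: L(1))
    finally have "f0 x - q / f1 x = alt_quot (a # L @ [b]) x" .
    moreover have "f1 x \<noteq> 0"
      using v1 alt_quot_nonzero[OF x] by simp
    ultimately show ?thesis
      by blast
  qed
  ultimately show ?thesis
    using rooted_realized_mono[OF f0(1) sub(1)] rooted_realized_mono[OF f1(1) sub(2)] by blast
qed

text \<open>The lists share \<open>L\<close>, so the quotients cancel up to
  \<open>(x - a) * (x - b)\<close>. The squared entry \<open>b - a + 1\<close> is chosen to make the
  shifted quadratic split as \<open>(x - (a - 1)) * (x - (b + 1))\<close>.\<close>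

lemma realized_odd_join:
  assumes T0: "realizes_points k T0 (a # L)" and T1: "realizes_points k T1 (L @ [b])"
    and L: "length L = 2 * k" and ab: "a < b"
  shows "\<exists>\<Lambda>. finite \<Lambda> \<and> card \<Lambda> \<le> 2 * k + 2 \<and> realized (2 * k + 1) \<Lambda> (fst (odot T0 [T1]))"
proof -
  obtain f0 where f0: "rooted_realized (set (butlast L)) f0 k T0"
    "\<And>x. x \<notin> set (butlast L) \<Longrightarrow> f0 x = alt_quot (a # L) x"
    using T0 unfolding realizes_points_def by auto
  obtain f1 where f1: "rooted_realized (set (butlast (tl (L @ [b])))) f1 k T1"
    "\<And>x. x \<notin> set (butlast (tl (L @ [b]))) \<Longrightarrow> f1 x = alt_quot (L @ [b]) x"
    using T1 unfolding realizes_points_def by auto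
  have sub: "set (butlast L) \<subseteq> set L" "set (butlast (tl (L @ [b]))) \<subseteq> set L"
    by (auto dest: in_set_butlastD) (cases L; auto)
  define \<Lambda> where "\<Lambda> = set ((a - 1) # (b + 1) # L)"
  have "realized (2 * k + 1) \<Lambda> (fst (odot T0 [T1]))"
  proof (rule realized_join)
    show "rooted_realized (set L) f0 k T0" "rooted_realized (set L) f1 k T1"
      using rooted_realized_mono f0(1) f1(1) sub by blast+
    show "sqrt (b - a + 1) > 0"
      using ab by simp
    show "set L \<subseteq> \<Lambda>"
      by (auto simp: \<Lambda>_def)
    fix x assume x: "x \<notin> \<Lambda>"
    then have xL: "x \<notin> set L" and ne: "x - (a - 1) \<noteq> 0" "x - (b + 1) \<noteq> 0"
      by (auto simp: \<Lambda>_def)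
    have "f0 x = (x - a) / alt_quot L x" "f1 x = alt_quot L x * (x - b)"
      using f0(2)[of x] f1(2)[of x] sub xL L by (auto simp: alt_quot_snoc)
    then have "f0 x * f1 x = (x - a) * (x - b)"
      using alt_quot_nonzero[OF xL] by simp
    moreover have "(x - a) * (x - b) - (b - a + 1) = (x - (a - 1)) * (x - (b + 1))"
      by (simp add: algebra_simps)
    ultimately have "f0 x * f1 x \<noteq> b - a + 1"
      using ne by auto
    then show "f0 x * f1 x \<noteq> (sqrt (b - a + 1))\<^sup>2"
      using ab by simp
  qed
  moreover have "card \<Lambda> \<le> 2 * k + 2"
    unfolding \<Lambda>_def using card_length[of "(a - 1) # (b + 1) # L"] L by simp
  ultimately show ?thesis
    by (intro exI[of _ \<Lambda>]) (simp add: \<Lambda>_def)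
qed


section \<open>Binomial trees among the seeds\<close>

lemma realizes_points_pair_iso:
  assumes T: "realizes_points k T l" and h: "pair_iso h (fst T) (fst T')" "h (snd T) = snd T'"
  shows "realizes_points k T' l"
  using T rooted_realized_pair_iso[of _ _ k "fst T" "snd T" h "fst T'"] h
  unfolding realizes_points_def by auto

text \<open>\<open>seed 1\<close> and \<open>seed 2\<close> are written out, not built by
  \<open>odot\<close>. Up to this renaming they are gluings of single vertices and thus fall under
  the general constructions.\<close>

lemma pair_iso_seed_1_2:
  fixes h :: "nat list \<Rightarrow> nat list"
  defines "h \<equiv> (\<lambda>v. if v = [0] then [] else [hd v - 1])"
  shows "pair_iso h (fst (odot (seed 0) [seed 0])) (fst (seed 1))"
    and "h (snd (odot (seed 0) [seed 0])) = snd (seed 1)"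
    and "pair_iso h (fst (odot (seed 0) [seed 0, seed 0])) (fst (seed 2))"
proof -
  have s2: "seed 2 = (\<lparr> pverts = {[], [0], [1]},
       parcs = {([], [0]), ([0], []), ([], [1]), ([1], [])} \<rparr>, [])"
    by (simp add: numeral_2_eq_2)
  have s11: "odot (seed 0) [seed 0] = (\<lparr> pverts = {[0], [1]}, parcs = {([0], [1]), ([1], [0])} \<rparr>, [0])"
    by (simp add: odot_def Let_def lessThan_Suc insert_commute)
  have s111: "odot (seed 0) [seed 0, seed 0] = (\<lparr> pverts = {[0], [1], [2]},
      parcs = {([0], [1]), ([1], [0]), ([0], [2]), ([2], [0])} \<rparr>, [0])"
  proof -
    have "{1..length [seed 0, seed 0]} = {1, 2}" "{..<length [seed 0, seed 0, seed 0]} = {0, 1, 2}"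
      by auto
    then show ?thesis
      unfolding odot_def Let_def by (simp add: insert_commute)
  qed
  show "pair_iso h (fst (odot (seed 0) [seed 0])) (fst (seed 1))"
    unfolding s11 by (auto simp: pair_iso_def h_def)
  show "h (snd (odot (seed 0) [seed 0])) = snd (seed 1)"
    unfolding s11 by (simp add: h_def)
  show "pair_iso h (fst (odot (seed 0) [seed 0, seed 0])) (fst (seed 2))"
    unfolding s111 s2 by (auto simp: pair_iso_def h_def)
qed

text \<open>The order \<open>j\<close> is also the height. Order 1 equals the gluing of two single
  vertices only up to isomorphism, so \<open>binomial_tree_Suc\<close> starts at
  \<open>j = 1\<close>.\<close>

definition binomial_tree :: "nat \<Rightarrow> nat list rooted" where
  "binomial_tree j = (if j = 0 then seed 0 else seed (2 * j - 1))"

lemma binomial_tree_0: "binomial_tree 0 = seed 0" and binomial_tree_1: "binomial_tree 1 = seed 1"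
  and binomial_tree_pos: "j > 0 \<Longrightarrow> binomial_tree j = seed (2 * j - 1)"
  by (simp_all add: binomial_tree_def del: seed.simps)

lemma binomial_tree_Suc: "j > 0 \<Longrightarrow> binomial_tree (Suc j) = odot (binomial_tree j) [binomial_tree j]"
  using seed_recursion(1)[of "Suc j"] by (simp add: binomial_tree_pos numeral_3_eq_3 del: seed.simps)

lemma realizes_points_seed_0: "realizes_points 0 (seed 0) [a]"
proof -
  have "rooted_weighting {} (\<lambda>x. x - a) 0 (seed 0) (\<lambda>v. v) (\<lambda>v. 0) (\<lambda>v. 1) (\<lambda>v x. x - a)"
    unfolding rooted_weighting_def weighting_def
  proof (intro conjI)
    show "ptree (fst (seed 0)) (\<lambda>v. v) (\<lambda>v. 0)"
      by unfold_locales auto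
    show "\<forall>v\<in>pverts (fst (seed 0)). \<exists>\<alpha>. \<forall>x. x - a =
        x - \<alpha> - (\<Sum>c\<in>children (fst (seed 0)) (\<lambda>v. v) (\<lambda>v. 0) v. 1 / (x - a))"
      by (auto simp: children_def)
  qed simp_all
  then show ?thesis
    unfolding realizes_points_def rooted_realized_def by (intro exI[of _ "\<lambda>x. x - a"]) auto
qed

text \<open>Both halves of the tree of order \<open>j + 1\<close> are the same tree realized on
  different lists; therefore the induction hypothesis ranges over all lists with wide gaps.\<close>

lemma binomial_realizes_points:
  "length l = 2 * j + 1 \<Longrightarrow> wide_gaps l \<Longrightarrow> realizes_points j (binomial_tree j) l"
proof (induction j arbitrary: l)
  case 0
  then obtain a where "l = [a]"
    by (auto simp: length_Suc_conv)
  then show ?case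
    using realizes_points_seed_0 binomial_tree_0 by metis
next
  case (Suc j)
  obtain a K where K: "l = a # K" "length K = 2 * j + 2"
    using Suc.prems(1) by (cases l) auto
  obtain L b where L: "K = L @ [b]"
    using K(2) by (cases K rule: rev_cases) auto
  have l: "l = a # L @ [b]" and len: "length L = 2 * j + 1"
    using K L by auto
  from binomial_step[OF Suc.IH len, of a b] Suc.prems(2)
  have *: "realizes_points (Suc j) (odot (binomial_tree j) [binomial_tree j]) l"
    unfolding l using realizes_points_odot(1)[of L _ j "binomial_tree j" _ j "binomial_tree j"] by fastforce
  show ?case
  proof (cases "j = 0")
    case True
    have "realizes_points (Suc j) (odot (seed 0) [seed 0]) l"
      using * unfolding True binomial_tree_0 .
    from realizes_points_pair_iso[OF this pair_iso_seed_1_2(1,2)] show ?thesis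
      unfolding True One_nat_def[symmetric] binomial_tree_1 .
  next
    case False
    then show ?thesis
      using * by (simp add: binomial_tree_Suc)
  qed
qed

text \<open>The branch at a main root of \<open>S'\<close> and \<open>S''\<close> of odd diameter.\<close>

lemma binomial_minus_realizes_points:
  assumes "length L = 2 * j + 3" "wide_gaps L" "a < hd L" "b = hd L + last L - a"
  shows "realizes_points (Suc (Suc j)) (odot (binomial_tree j) [binomial_tree (Suc j)]) (a # L @ [b])"
    and "realized (2 * Suc (Suc j)) (set (a # L @ [b]))
      (fst (odot (binomial_tree j) [binomial_tree (Suc j), binomial_tree (Suc j)]))"
proof -
  have T': "realizes_points (Suc j) (binomial_tree (Suc j)) l" if "length l = 2 * j + 3" "wide_gaps l" for l
    using binomial_realizes_points[of l "Suc j"] that by simp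
  obtain f0 f1 q where f: "rooted_realized (set L) f0 j (binomial_tree j)"
    "rooted_realized (set L) f1 (Suc j) (binomial_tree (Suc j))" "q > 0"
    "\<forall>x. x \<notin> set L \<longrightarrow> f1 x \<noteq> 0 \<and> f0 x - q / f1 x = alt_quot (a # L @ [b]) x"
    using binomial_minus_step[OF binomial_realizes_points T' assms] by blast
  show "realizes_points (Suc (Suc j)) (odot (binomial_tree j) [binomial_tree (Suc j)]) (a # L @ [b])"
    by (rule realizes_points_odot(1)[OF f(1,2) _ f(3)]) (use f(4) in auto)
  show "realized (2 * Suc (Suc j)) (set (a # L @ [b]))
      (fst (odot (binomial_tree j) [binomial_tree (Suc j), binomial_tree (Suc j)]))"
    by (rule realizes_points_odot(2)[OF f(1,2) _ f(3)]) (use f(4) in auto)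
qed

section \<open>Point sets for all seeds\<close>

definition realizable :: "nat \<Rightarrow> nat list rooted \<Rightarrow> bool" where
  "realizable d S \<longleftrightarrow> (\<exists>\<Lambda>. finite \<Lambda> \<and> card \<Lambda> \<le> d + 1 \<and> realized d \<Lambda> (fst S))"

lemma realizable_pair_iso:
  "realizable d S \<Longrightarrow> pair_iso h (fst S) (fst S') \<Longrightarrow> realizable d S'"
  unfolding realizable_def using realized_pair_iso by blast

lemma realizable_even: "realizable (2 * Suc j) (odot (binomial_tree j) [binomial_tree j, binomial_tree j])"
proof -
  obtain l where l: "length l = 2 * j + 3" "wide_gaps l"
    using wide_gaps_exist by blast
  obtain a K where K: "l = a # K" "length K = 2 * j + 2"
    using l(1) by (cases l) auto
  obtain L b where L: "K = L @ [b]"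
    using K(2) by (cases K rule: rev_cases) auto
  have len: "length L = 2 * j + 1" and gap: "wide_gaps (a # L @ [b])"
    using K L l by auto
  obtain f0 f1 q where f: "rooted_realized (set L) f0 j (binomial_tree j)"
    "rooted_realized (set L) f1 j (binomial_tree j)" "q > 0"
    "\<forall>x. x \<notin> set L \<longrightarrow> f1 x \<noteq> 0 \<and> f0 x - q / f1 x = alt_quot (a # L @ [b]) x"
    using binomial_step[OF binomial_realizes_points len gap] by blast
  have "realized (2 * Suc j) (set (a # L @ [b])) (fst (odot (binomial_tree j) [binomial_tree j, binomial_tree j]))"
    by (rule realizes_points_odot(2)[OF f(1,2) _ f(3)]) (use f(4) in auto)
  moreover have "card (set (a # L @ [b])) \<le> 2 * Suc j + 1"
    using card_length[of "a # L @ [b]"] len by simp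
  ultimately show ?thesis
    unfolding realizable_def by blast
qed

lemma realizable_even':
  "realizable (2 * Suc (Suc j)) (odot (binomial_tree j) [binomial_tree (Suc j), binomial_tree (Suc j)])"
proof -
  obtain L where L: "length L = 2 * j + 3" "wide_gaps L"
    using wide_gaps_exist by blast
  \<comment> \<open>Any point left of \<open>L\<close> can serve as \<open>?a\<close>;
    \<open>?b\<close> is its mirror image, as \<open>a + b = hd L + last L\<close> is
    required.\<close>
  let ?a = "hd L - 1" and ?b = "last L + 1"
  have "realized (2 * Suc (Suc j)) (set (?a # L @ [?b]))
      (fst (odot (binomial_tree j) [binomial_tree (Suc j), binomial_tree (Suc j)]))"
    using binomial_minus_realizes_points(2)[OF L, of ?a ?b] by simp
  moreover have "card (set (?a # L @ [?b])) \<le> 2 * Suc (Suc j) + 1"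
    using card_length[of "?a # L @ [?b]"] L(1) by simp
  ultimately show ?thesis
    unfolding realizable_def by blast
qed

lemma realizable_odd_join:
  assumes "realizes_points k T0 (a # L)" "realizes_points k T1 (L @ [b])" "length L = 2 * k" "a < b"
  shows "realizable (2 * k + 1) (odot T0 [T1])"
  using realized_odd_join[OF assms] by (simp add: realizable_def)

lemma realizable_odd: "realizable (2 * j + 1) (odot (binomial_tree j) [binomial_tree j])"
proof -
  obtain l where l: "length l = 2 * j + 2" "wide_gaps l"
    using wide_gaps_exist by blast
  obtain a K where K: "l = a # K" "length K = 2 * j + 1"
    using l(1) by (cases l) auto
  obtain L b where L: "K = L @ [b]"
    using K(2) by (cases K rule: rev_cases) auto
  have len: "length L = 2 * j" and gap: "wide_gaps (a # L @ [b])"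
    using K L l by auto
  have "realizes_points j (binomial_tree j) (a # L)"
    using binomial_realizes_points[of "a # L" j] len wide_gaps_butlast[of "a # L" b] gap by simp
  moreover have "realizes_points j (binomial_tree j) (L @ [b])"
    using binomial_realizes_points[of "L @ [b]" j] len wide_gaps_tl[OF gap] by simp
  moreover have "a < b"
    using wide_gaps_less[OF gap] by simp
  ultimately show ?thesis
    using realizable_odd_join len by blast
qed

text \<open>Here the right end is prescribed as the last point of \<open>L = K @ [b]\<close>, and
  \<open>a\<close> is solved from \<open>a + b = hd K + last K\<close>. The tree then fits on the
  left of a main edge with common list \<open>L\<close>.\<close>

lemma binomial_minus_left:
  assumes "length L = 2 * j + 4" "wide_gaps L" "a = hd L - (last L - last (butlast L))"
  shows "realizes_points (Suc (Suc j)) (odot (binomial_tree j) [binomial_tree (Suc j)]) (a # L)"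
    and "a < hd L"
proof -
  obtain K b where K: "L = K @ [b]"
    using assms(1) by (cases L rule: rev_cases) auto
  have len: "length K = 2 * j + 3" and "K \<noteq> []"
    using assms(1) K by auto
  have gap: "wide_gaps K"
    using assms(2) K wide_gaps_butlast by blast
  have "last K < b"
    using wide_gaps_snoc_less[of K b "last K"] assms(2) K \<open>K \<noteq> []\<close> by simp
  moreover have a: "a = hd K - (b - last K)"
    using assms(3) K \<open>K \<noteq> []\<close> by simp
  ultimately have "a < hd K"
    by simp
  then show "a < hd L"
    using K \<open>K \<noteq> []\<close> by simp
  have "b = hd K + last K - a"
    using a by simp
  then show "realizes_points (Suc (Suc j)) (odot (binomial_tree j) [binomial_tree (Suc j)]) (a # L)"
    unfolding K by (rule binomial_minus_realizes_points(1)[OF len gap \<open>a < hd K\<close>])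
qed

text \<open>Both copies share \<open>L = c # K\<close>. On the left, the last point of
  \<open>L\<close> determines the new end \<open>a\<close>; on the right, the first point
  \<open>c\<close> determines the new end \<open>b\<close>.\<close>

lemma realizable_odd':
  defines "X \<equiv> \<lambda>j. odot (binomial_tree j) [binomial_tree (Suc j)]"
  shows "realizable (2 * j + 5) (odot (X j) [X j])"
proof -
  obtain L where L: "length L = 2 * j + 4" "wide_gaps L"
    using wide_gaps_exist by blast
  obtain c K where K: "L = c # K" "length K = 2 * j + 3"
    using L(1) by (cases L) auto
  then have "K \<noteq> []"
    by auto
  have gap: "wide_gaps K"
    using L(2) K wide_gaps_tl by blast
  define a where "a = hd L - (last L - last (butlast L))"
  define b where "b = hd K + last K - c"
  have c: "c < hd K" "c < last K"
    using wide_gaps_less[of c K] L(2) K \<open>K \<noteq> []\<close> by auto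
  have "realizes_points (Suc (Suc j)) (X j) (a # L)" and a: "a < hd L"
    unfolding X_def using binomial_minus_left[OF L a_def] by blast+
  moreover have "realizes_points (Suc (Suc j)) (X j) (L @ [b])"
    unfolding X_def K(1) using binomial_minus_realizes_points(1)[OF K(2) gap c(1) b_def] by simp
  moreover have "a < b"
    using a c K by (simp add: b_def)
  ultimately have "realizable (2 * Suc (Suc j) + 1) (odot (X j) [X j])"
    using realizable_odd_join[of "Suc (Suc j)" "X j" a L "X j" b] L(1) by simp
  moreover have "2 * Suc (Suc j) + 1 = 2 * j + 5"
    by simp
  ultimately show ?thesis
    by (simp only:)
qed

text \<open>The right half is a binomial tree and requires wide gaps on \<open>L @ [b]\<close>, so
  this list is chosen first; the left half adapts to \<open>L\<close> through its end
  \<open>a\<close>.\<close>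

lemma realizable_odd'':
  "realizable (2 * j + 5) (odot (odot (binomial_tree j) [binomial_tree (Suc j)]) [binomial_tree (Suc (Suc j))])"
proof -
  obtain l where l: "length l = 2 * j + 5" "wide_gaps l"
    using wide_gaps_exist by blast
  obtain L b where L: "l = L @ [b]"
    using l(1) by (cases l rule: rev_cases) auto
  have len: "length L = 2 * j + 4" and gap: "wide_gaps L" and "L \<noteq> []"
    using l L wide_gaps_butlast by auto
  define a where "a = hd L - (last L - last (butlast L))"
  have "realizes_points (Suc (Suc j)) (odot (binomial_tree j) [binomial_tree (Suc j)]) (a # L)" and a: "a < hd L"
    using binomial_minus_left[OF len gap a_def] by blast+
  moreover have "realizes_points (Suc (Suc j)) (binomial_tree (Suc (Suc j))) (L @ [b])"
    using binomial_realizes_points[of l "Suc (Suc j)"] l L by simp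
  moreover have "a < b"
    using a wide_gaps_snoc_less[of L b "hd L"] l L \<open>L \<noteq> []\<close> by simp
  ultimately have
    "realizable (2 * Suc (Suc j) + 1) (odot (odot (binomial_tree j) [binomial_tree (Suc j)]) [binomial_tree (Suc (Suc j))])"
    using realizable_odd_join[of "Suc (Suc j)" _ a L _ b] len by simp
  moreover have "2 * Suc (Suc j) + 1 = 2 * j + 5"
    by simp
  ultimately show ?thesis
    by (simp only:)
qed

lemma realizable_seed:
  assumes "d \<ge> 1"
  shows "realizable d (seed d)"
proof -
  consider "d = 1" | "d = 2" | j where "d = 2 * Suc (Suc j)" | j where "d = 2 * Suc j + 1"
  proof (cases "even d")
    case True
    then obtain k where k: "d = 2 * k" by (elim evenE)
    show thesis
    proof (cases "k = 1")
      case True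
      then show thesis using that(2) k by simp
    next
      case False
      then have "d = 2 * Suc (Suc (k - 2))" using k assms by auto
      then show thesis by (rule that(3))
    qed
  next
    case False
    then obtain k where k: "d = 2 * k + 1" by (elim oddE)
    show thesis
    proof (cases k)
      case 0
      then show thesis using that(1) k by simp
    next
      case (Suc j)
      then show thesis using that(4) k by blast
    qed
  qed
  then show ?thesis
  proof cases
    case 1
    have "realizable 1 (odot (seed 0) [seed 0])"
      using realizable_odd[of 0] unfolding binomial_tree_0 by (simp only: mult_0_right add_0)
    from realizable_pair_iso[OF this pair_iso_seed_1_2(1)] show ?thesis
      unfolding 1 .
  next
    case 2
    have "realizable 2 (odot (seed 0) [seed 0, seed 0])"
      using realizable_even[of 0] unfolding binomial_tree_0 by (simp only: One_nat_def[symmetric] mult_1_right)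
    from realizable_pair_iso[OF this pair_iso_seed_1_2(3)] show ?thesis
      unfolding 2 .
  next
    case (3 j)
    have e: "2 * Suc (Suc j) - 3 = 2 * Suc j - 1" by simp
    have "seed d = odot (binomial_tree (Suc j)) [binomial_tree (Suc j), binomial_tree (Suc j)]"
      unfolding 3 seed_recursion(2)[of "Suc (Suc j)", simplified] binomial_tree_pos[OF zero_less_Suc]
      using seed_recursion(2)[of "Suc (Suc j)"] unfolding e by simp
    then show ?thesis
      using realizable_even[of "Suc j"] 3 by simp
  next
    case (4 j)
    have e: "2 * Suc (Suc j) - 1 = 2 * Suc j + 1" by simp
    have "seed d = binomial_tree (Suc (Suc j))"
      unfolding 4 binomial_tree_pos[OF zero_less_Suc] e ..
    also have "\<dots> = odot (binomial_tree (Suc j)) [binomial_tree (Suc j)]"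
      by (rule binomial_tree_Suc) simp
    finally show ?thesis
      using realizable_odd[of "Suc j"] unfolding 4 by (simp only:)
  qed
qed

text \<open>In terms of \<open>binomial_tree\<close>, the separate case \<open>d = 4\<close> of the
  definition is the instance \<open>j = 0\<close> of the general pattern; the same happens for
  \<open>d = 5\<close> in the odd case.\<close>

lemma seed'_even_eq:
  "seed' (2 * Suc (Suc j)) = odot (binomial_tree j) [binomial_tree (Suc j), binomial_tree (Suc j)]"
proof (cases j)
  case 0
  then show ?thesis
    by (simp add: seed'_def binomial_tree_def del: seed.simps)
next
  case (Suc i)
  have e: "2 * Suc j + 2 = 2 * Suc (Suc j)" "2 * Suc j - 3 = 2 * j - 1"
    using Suc by auto
  have "Suc j \<ge> 2" "j > 0"
    using Suc by auto
  then show ?thesis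
    using seed_recursion(3)[of "Suc j"] unfolding e by (simp only: binomial_tree_pos zero_less_Suc)
qed

lemma seed'_odd_eq:
  "seed' (2 * j + 5) = odot (odot (binomial_tree j) [binomial_tree (Suc j)]) [odot (binomial_tree j) [binomial_tree (Suc j)]]"
  and seed''_eq:
  "seed'' (2 * j + 5) = odot (odot (binomial_tree j) [binomial_tree (Suc j)]) [odot (binomial_tree (Suc j)) [binomial_tree (Suc j)]]"
proof -
  have "seed' (2 * j + 5) = odot (odot (binomial_tree j) [binomial_tree (Suc j)]) [odot (binomial_tree j) [binomial_tree (Suc j)]]
    \<and> seed'' (2 * j + 5) = odot (odot (binomial_tree j) [binomial_tree (Suc j)]) [odot (binomial_tree (Suc j)) [binomial_tree (Suc j)]]"
  proof (cases j)
    case 0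
    then show ?thesis
      by (simp add: seed'_def seed''_def binomial_tree_def del: seed.simps)
  next
    case (Suc i)
    have e: "2 * Suc j + 3 = 2 * j + 5" "2 * Suc j - 3 = 2 * j - 1"
      using Suc by auto
    have "Suc j \<ge> 2" "j > 0"
      using Suc by auto
    then show ?thesis
      using seed_recursion(4,5)[of "Suc j"] unfolding e by (simp only: binomial_tree_pos zero_less_Suc)
  qed
  then show "seed' (2 * j + 5) = odot (odot (binomial_tree j) [binomial_tree (Suc j)]) [odot (binomial_tree j) [binomial_tree (Suc j)]]"
    "seed'' (2 * j + 5) = odot (odot (binomial_tree j) [binomial_tree (Suc j)]) [odot (binomial_tree (Suc j)) [binomial_tree (Suc j)]]"
    by blast+
qed

lemma realizable_seed':
  assumes "d \<ge> 4"
  shows "realizable d (seed' d)"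
proof (cases "even d")
  case True
  then obtain k where k: "d = 2 * k" by (elim evenE)
  then have d: "d = 2 * Suc (Suc (k - 2))"
    using assms by simp
  show ?thesis
    by (subst (1 2) d, subst seed'_even_eq) (rule realizable_even')
next
  case False
  then obtain k where k: "d = 2 * k + 1" by (elim oddE)
  then have d: "d = 2 * (k - 2) + 5"
    using assms by simp
  show ?thesis
    by (subst (1 2) d, subst seed'_odd_eq) (rule realizable_odd')
qed

lemma realizable_seed'':
  assumes "d \<ge> 5" "odd d"
  shows "realizable d (seed'' d)"
proof -
  obtain k where k: "d = 2 * k + 1" using assms(2) by (elim oddE)
  then have d: "d = 2 * (k - 2) + 5"
    using assms by simp
  have "binomial_tree (Suc (Suc (k - 2))) = odot (binomial_tree (Suc (k - 2))) [binomial_tree (Suc (k - 2))]"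
    by (rule binomial_tree_Suc) simp
  then show ?thesis
    using realizable_odd''[of "k - 2"] seed''_eq[of "k - 2"] d by metis
qed

lemma q_tree_realizable:
  "realizable d S \<Longrightarrow> T \<in> unfoldings S \<Longrightarrow> q_tree T = d + 1"
  unfolding realizable_def using q_tree_unfoldings by blast

theorem theorem1p2:
  fixes d :: nat and T :: "'a pair_pre_digraph"
  assumes "d \<ge> 1"
    and "T \<in> unfoldings (seed d)
           \<union> (if d \<ge> 4 then unfoldings (seed' d) else {})
           \<union> (if d \<ge> 5 \<and> odd d then unfoldings (seed'' d) else {})"
  shows "q_tree T = d + 1"
proof -
  consider "T \<in> unfoldings (seed d)" | "d \<ge> 4" "T \<in> unfoldings (seed' d)"
    | "d \<ge> 5" "odd d" "T \<in> unfoldings (seed'' d)"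
    using assms(2) by (auto split: if_splits)
  then show ?thesis
  proof cases
    case 1
    then show ?thesis by (rule q_tree_realizable[OF realizable_seed[OF assms(1)]])
  next
    case 2
    then show ?thesis by (rule q_tree_realizable[OF realizable_seed'])
  next
    case 3
    then show ?thesis by (rule q_tree_realizable[OF realizable_seed''])
  qed
qed

end
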